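(* Let $a<b$ be coprime positive integers, let $\chi$ be the permutation character of the action of $\mathfrak{S}_a\times\mathbb{Z}_{b-1}$ on $\mathsf{Park}^{NC}(a,b)$ (with $\mathfrak{S}_a$ permuting labels and a generator $g$ of $\mathbb{Z}_{b-1}$ acting by rotation), let $V=\mathbb{C}^a/\langle(1,\dots,1)\rangle$ be the reflection representation of $\mathfrak{S}_a$, and let $\zeta=e^{2\pi i/(b-1)}$. For $w\in\mathfrak{S}_a$ and $d\ge0$ let $\mathrm{mult}_w(\zeta^d)$ be the multiplicity of $\zeta^d$ as an eigenvalue of $w$ acting on $V$. Then for all $w\in\mathfrak{S}_a$ and $d\ge 0$, $$\chi(w,g^d)=b^{\mathrm{mult}_w(\zeta^d)}.$$
   Context: Let $a<b$ be coprime positive integers and $[b-1]=\{1,\dots,b-1\}$. An $a,b$-Dyck path is a lattice path from $(0,0)$ to $(b,a)$ using unit north and east steps that stays weakly above the line $y=\frac{a}{b}x$. A valley of such a path $D$ is a lattice point of $D$ immediately preceded by an east step and immediately followed by a north step. From each valley $P$ fire the laser $\ell(P)$: the segment of slope $\frac ab$ from $P$ going northeast until it first meets $D$ again. Label the east endpoints of the first $b-1$ east steps of $D$ from left to right by $1,\dots,b-1$, each label regarded as sitting slightly below its lattice point. The set partition $\pi(D)$ of $[b-1]$ declares $i\sim j$ iff labels $i,j$ are not separated by any valley laser. $\mathsf{NC}(a,b)=\{\pi(D): D\text{ an }a,b\text{-Dyck path}\}$. Rank: for a noncrossing partition $\pi$ of $[b-1]$, order its blocks by $B'\preceq B$ iff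 $[\min B',\max B']\subseteq[\min B,\max B]$; the integers $\mathrm{rank}^{\pi}_{a,b}(B)$ are the unique integers with $\sum_{B'\preceq B}\mathrm{rank}^{\pi}_{a,b}(B')=\lceil(\max B-\min B+1)\frac ab\rceil$ for all blocks $B$. An $a,b$-noncrossing parking function is a pair $(\pi,f)$ with $\pi\in\mathsf{NC}(a,b)$ and $f$ a labeling of the blocks of $\pi$ by subsets of $[a]$ such that $[a]=\biguplus_{B\in\pi}f(B)$ (disjoint union) and $|f(B)|=\mathrm{rank}^{\pi}_{a,b}(B)$ for every block $B$; $\mathsf{Park}^{NC}(a,b)$ is the set of these. $w\in\mathfrak S_a$ acts by $(\pi,f)\mapsto(\pi,w\circ f)$ (replace each label set $f(B)$ by $w(f(B))$), and $g$ acts by rotation $(\pi,f)\mapsto(\mathtt{rot}(\pi), B\mapsto f(\mathtt{rot}^{-1}B))$, where $\mathtt{rot}$ is $i\mapsto i+1$ ($i<b-1$), $b-1\mapsto 1$; these commute and give an action of $\mathfrak{S}_a\times\mathbb{Z}_{b-1}$ (rotation preserves ranks). $\chi(w,g^d)$ is the number of elements of $\mathsf{Park}^{NC}(a,b)$ fixed by $(w,g^d)$. *)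

theory Defs
  imports
    "HOL-Analysis.Line_Segment"
    "HOL-Combinatorics.Permutations"
    "HOL-Algebra.AbelCoset"
    "Jordan_Normal_Form.VS_Connect"
begin

datatype step = North | East

definition path_pt :: "step list \<Rightarrow> nat \<Rightarrow> nat \<times> nat" where
  "path_pt D k = (count_list (take k D) East, count_list (take k D) North)"

definition dyck_paths :: "nat \<Rightarrow> nat \<Rightarrow> step list set" where
  "dyck_paths a b =
     {D. path_pt D (length D) = (b, a) \<and>
         (\<forall>k\<le>length D. real (snd (path_pt D k)) \<ge> real a / real b * real (fst (path_pt D k)))}"

definition plane_pt :: "nat \<times> nat \<Rightarrow> real \<times> real" where
  "plane_pt P = (real (fst P), real (snd P))"

definition path_curve :: "step list \<Rightarrow> (real \<times> real) set" where
  "path_curve D =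
     (\<Union>k<length D. closed_segment (plane_pt (path_pt D k)) (plane_pt (path_pt D (Suc k))))"

definition valleys :: "step list \<Rightarrow> (nat \<times> nat) set" where
  "valleys D = {path_pt D k | k. 0 < k \<and> k < length D \<and> D ! (k - 1) = East \<and> D ! k = North}"

definition laser :: "nat \<Rightarrow> nat \<Rightarrow> step list \<Rightarrow> nat \<times> nat \<Rightarrow> (real \<times> real) set" where
  "laser a b D P =
     {plane_pt P + t *\<^sub>R (real b, real a) | t.
        0 \<le> t \<and> (\<forall>s. 0 < s \<and> s < t \<longrightarrow> plane_pt P + s *\<^sub>R (real b, real a) \<notin> path_curve D)}"

text \<open>The height at which the \<open>i\<close>-th east step is taken, so that its east endpoint
  is the lattice point \<open>(i, east_height D i)\<close>.\<close>

definition east_height :: "step list \<Rightarrow> nat \<Rightarrow> nat" where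
  "east_height D i =
     (THE y. \<exists>k<length D. D ! k = East \<and> path_pt D (Suc k) = (i, y))"

text \<open>A laser is a chord, with both endpoints on \<open>D\<close>, of the region below \<open>D\<close>. It cuts this
  region into the part lying vertically above the chord and the rest. The label \<open>i\<close> is the point
  \<open>(i, east_height D i - \<epsilon>)\<close> for all sufficiently small \<open>\<epsilon> > 0\<close>; in particular a label at a
  valley is not above the laser fired from that valley.\<close>

definition label_above :: "step list \<Rightarrow> (real \<times> real) set \<Rightarrow> nat \<Rightarrow> bool" where
  "label_above D L i \<longleftrightarrow>
     (\<forall>\<^sub>F \<epsilon> in at_right 0. \<exists>y. (real i, y) \<in> L \<and> y < real (east_height D i) - \<epsilon>)"

definition separates :: "step list \<Rightarrow> (real \<times> real) set \<Rightarrow> nat \<Rightarrow> nat \<Rightarrow> bool" where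
  "separates D L i j \<longleftrightarrow> label_above D L i \<noteq> label_above D L j"

definition dyck_partition :: "nat \<Rightarrow> nat \<Rightarrow> step list \<Rightarrow> nat set set" where
  "dyck_partition a b D =
     {1..b - 1} // {(i, j). i \<in> {1..b - 1} \<and> j \<in> {1..b - 1} \<and>
                            (\<forall>P\<in>valleys D. \<not> separates D (laser a b D P) i j)}"

definition NC :: "nat \<Rightarrow> nat \<Rightarrow> nat set set set" where
  "NC a b = dyck_partition a b ` dyck_paths a b"

definition block_le :: "nat set \<Rightarrow> nat set \<Rightarrow> bool" (infix \<open>\<preceq>\<close> 50) where
  "B' \<preceq> B \<longleftrightarrow> {Min B'..Max B'} \<subseteq> {Min B..Max B}"

definition is_block_rank :: "nat \<Rightarrow> nat \<Rightarrow> nat set set \<Rightarrow> (nat set \<Rightarrow> int) \<Rightarrow> bool" where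
  "is_block_rank a b \<pi> r \<longleftrightarrow>
     (\<forall>B\<in>\<pi>. (\<Sum>B' | B' \<in> \<pi> \<and> B' \<preceq> B. r B') =
              \<lceil>real (Max B - Min B + 1) * (real a / real b)\<rceil>) \<and>
     (\<forall>B. B \<notin> \<pi> \<longrightarrow> r B = 0)"

definition block_rank :: "nat \<Rightarrow> nat \<Rightarrow> nat set set \<Rightarrow> nat set \<Rightarrow> int" where
  "block_rank a b \<pi> = (THE r. is_block_rank a b \<pi> r)"

lemma ex1_is_block_rank:
  assumes "finite \<pi>" and "disjoint \<pi>" and "\<And>B. B \<in> \<pi> \<Longrightarrow> finite B \<and> B \<noteq> {}"
  shows "\<exists>!r. is_block_rank a b \<pi> r"
  using assms
proof (induction \<pi> rule: finite_ranking_induct[where f = "\<lambda>B. Max B - Min B"])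
  case empty
  show ?case
    by (rule ex1I[of _ "\<lambda>_. 0"]) (auto simp: is_block_rank_def)
next
  case (insert B\<^sub>0 \<pi>)
  show ?case
  proof (cases "B\<^sub>0 \<in> \<pi>")
    case True
    then show ?thesis using insert by (simp add: insert_absorb)
  next
    case False
    define c where "c B = \<lceil>real (Max B - Min B + 1) * (real a / real b)\<rceil>" for B :: "nat set"
    have ne: "\<not> B\<^sub>0 \<preceq> B" if "B \<in> \<pi>" for B
    proof
      assume "B\<^sub>0 \<preceq> B"
      have f: "finite B" "B \<noteq> {}" "finite B\<^sub>0" "B\<^sub>0 \<noteq> {}" using insert.prems that by auto
      then have "Min B\<^sub>0 \<le> Max B\<^sub>0" "Min B \<le> Max B" by simp_all
      with \<open>B\<^sub>0 \<preceq> B\<close> have "Min B \<le> Min B\<^sub>0" "Max B\<^sub>0 \<le> Max B"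
        by (auto simp: block_le_def)
      moreover have "Max B - Min B \<le> Max B\<^sub>0 - Min B\<^sub>0" using insert.hyps that by auto
      ultimately have "Min B = Min B\<^sub>0" using \<open>Min B\<^sub>0 \<le> Max B\<^sub>0\<close> by linarith
      then have "B \<inter> B\<^sub>0 \<noteq> {}" using f Min_in by (metis disjoint_iff)
      then show False using insert.prems(1) that False
        by (metis disjointD insert_iff)
    qed
    have old: "{B'. B' \<in> insert B\<^sub>0 \<pi> \<and> B' \<preceq> B} = {B'. B' \<in> \<pi> \<and> B' \<preceq> B}" if "B \<in> \<pi>" for B
      using ne[OF that] by auto
    have new: "{B'. B' \<in> insert B\<^sub>0 \<pi> \<and> B' \<preceq> B\<^sub>0} = insert B\<^sub>0 {B'. B' \<in> \<pi> \<and> B' \<preceq> B\<^sub>0}"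
      by (auto simp: block_le_def)
    have "disjoint \<pi>" using insert.prems(1) by (auto simp: disjoint_def pairwise_def)
    then have ex1: "\<exists>!r. is_block_rank a b \<pi> r" using insert by auto
    then obtain r where r: "is_block_rank a b \<pi> r" by blast
    define r' where "r' = r(B\<^sub>0 := c B\<^sub>0 - (\<Sum>B' | B' \<in> \<pi> \<and> B' \<preceq> B\<^sub>0. r B'))"
    have upd: "(\<Sum>B' | B' \<in> \<pi> \<and> B' \<preceq> B. (s(B\<^sub>0 := x)) B') = (\<Sum>B' | B' \<in> \<pi> \<and> B' \<preceq> B. s B')"
      for B x and s :: "nat set \<Rightarrow> int"
      by (rule sum.cong) (use False in auto)
    show ?thesis
    proof (rule ex1I)
      show "is_block_rank a b (insert B\<^sub>0 \<pi>) r'"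
        unfolding is_block_rank_def
      proof (intro conjI ballI allI impI)
        fix B assume "B \<in> insert B\<^sub>0 \<pi>"
        then consider "B = B\<^sub>0" | "B \<in> \<pi>" by auto
        then show "(\<Sum>B' | B' \<in> insert B\<^sub>0 \<pi> \<and> B' \<preceq> B. r' B') =
              \<lceil>real (Max B - Min B + 1) * (real a / real b)\<rceil>"
        proof cases
          case 1
          have "(\<Sum>B' | B' \<in> insert B\<^sub>0 \<pi> \<and> B' \<preceq> B\<^sub>0. r' B') =
                r' B\<^sub>0 + (\<Sum>B' | B' \<in> \<pi> \<and> B' \<preceq> B\<^sub>0. r' B')"
            unfolding new using False insert.hyps by (subst sum.insert) auto
          also have "\<dots> = c B\<^sub>0" unfolding r'_def upd by simp
          finally show ?thesis unfolding 1 c_def .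
        next
          case 2
          then show ?thesis using r unfolding old[OF 2] r'_def upd is_block_rank_def by blast
        qed
      next
        fix B assume "B \<notin> insert B\<^sub>0 \<pi>"
        then show "r' B = 0" using r by (auto simp: r'_def is_block_rank_def)
      qed
    next
      fix s assume s: "is_block_rank a b (insert B\<^sub>0 \<pi>) s"
      have "is_block_rank a b \<pi> (s(B\<^sub>0 := 0))"
        unfolding is_block_rank_def
      proof (intro conjI ballI allI impI)
        fix B assume B: "B \<in> \<pi>"
        have "(\<Sum>B' | B' \<in> insert B\<^sub>0 \<pi> \<and> B' \<preceq> B. s B') =
              \<lceil>real (Max B - Min B + 1) * (real a / real b)\<rceil>"
          using s B unfolding is_block_rank_def by (metis insertI2)
        then show "(\<Sum>B' | B' \<in> \<pi> \<and> B' \<preceq> B. (s(B\<^sub>0 := 0)) B') =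
              \<lceil>real (Max B - Min B + 1) * (real a / real b)\<rceil>"
          unfolding old[OF B] upd .
      next
        fix B assume "B \<notin> \<pi>"
        then show "(s(B\<^sub>0 := 0)) B = 0" using s by (auto simp: is_block_rank_def)
      qed
      with ex1 r have eq: "r = s(B\<^sub>0 := 0)" by metis
      have "c B\<^sub>0 = (\<Sum>B' | B' \<in> insert B\<^sub>0 \<pi> \<and> B' \<preceq> B\<^sub>0. s B')"
        using s by (simp add: is_block_rank_def c_def)
      also have "\<dots> = s B\<^sub>0 + (\<Sum>B' | B' \<in> \<pi> \<and> B' \<preceq> B\<^sub>0. s B')"
        unfolding new using False insert.hyps by (subst sum.insert) auto
      finally have "s B\<^sub>0 = r' B\<^sub>0" unfolding r'_def eq by (simp add: upd[simplified])
      then show "s = r'" using eq by (auto simp: r'_def fun_eq_iff)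
    qed
  qed
qed

text \<open>Labelings are extensional (\<open>undefined\<close> off \<open>\<pi>\<close>), so that distinct pairs are distinct
  parking functions; the actions below restrict accordingly.\<close>

definition Park_NC :: "nat \<Rightarrow> nat \<Rightarrow> (nat set set \<times> (nat set \<Rightarrow> nat set)) set" where
  "Park_NC a b =
     {(\<pi>, f). \<pi> \<in> NC a b \<and> f \<in> \<pi> \<rightarrow>\<^sub>E Pow {1..a} \<and>
        disjoint_family_on f \<pi> \<and> (\<Union>B\<in>\<pi>. f B) = {1..a} \<and>
        (\<forall>B\<in>\<pi>. int (card (f B)) = block_rank a b \<pi> B)}"

definition perm_act ::
  "(nat \<Rightarrow> nat) \<Rightarrow> nat set set \<times> (nat set \<Rightarrow> nat set) \<Rightarrow> nat set set \<times> (nat set \<Rightarrow> nat set)" where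
  "perm_act w p = (fst p, \<lambda>B\<in>fst p. w ` snd p B)"

definition rot :: "nat \<Rightarrow> nat \<Rightarrow> nat" where
  "rot b i = (if i \<in> {1..<b - 1} then i + 1 else if i = b - 1 then 1 else i)"

definition rot_act ::
  "nat \<Rightarrow> nat set set \<times> (nat set \<Rightarrow> nat set) \<Rightarrow> nat set set \<times> (nat set \<Rightarrow> nat set)" where
  "rot_act b p =
     (let \<pi>' = (\<lambda>B. rot b ` B) ` fst p in (\<pi>', \<lambda>B\<in>\<pi>'. snd p (rot b -` B)))"

definition park_char :: "nat \<Rightarrow> nat \<Rightarrow> (nat \<Rightarrow> nat) \<Rightarrow> nat \<Rightarrow> nat" where
  "park_char a b w d = card {p \<in> Park_NC a b. perm_act w ((rot_act b ^^ d) p) = p}"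

definition quotient_module ::
  "('c, 'v, 'm) module_scheme \<Rightarrow> 'v set \<Rightarrow> ('c, 'v set) module" where
  "quotient_module M W =
     \<lparr>carrier = a_rcosets\<^bsub>M\<^esub> W, mult = undefined, one = undefined, zero = W, add = set_add M,
      smult = (\<lambda>c X. \<Union>x\<in>X. W +>\<^bsub>M\<^esub> (c \<odot>\<^bsub>M\<^esub> x))\<rparr>"

definition diagonal_line :: "nat \<Rightarrow> complex vec set" where
  "diagonal_line a = {c \<cdot>\<^sub>v vec a (\<lambda>_. 1) | c. True}"

definition refl_rep :: "nat \<Rightarrow> (complex, complex vec set) module" where
  "refl_rep a = quotient_module (module_vec TYPE(complex) a) (diagonal_line a)"

text \<open>Vectors are indexed from \<open>0\<close>, so \<open>unit_vec a i\<close> is the basis vector belonging to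
  \<open>i + 1 \<in> {1..a}\<close>, and the matrix maps the basis vector of \<open>j\<close> to that of \<open>w j\<close>.\<close>

definition perm_mat :: "nat \<Rightarrow> (nat \<Rightarrow> nat) \<Rightarrow> complex mat" where
  "perm_mat a w = mat a a (\<lambda>(i, j). if w (j + 1) = i + 1 then 1 else 0)"

definition refl_act :: "nat \<Rightarrow> (nat \<Rightarrow> nat) \<Rightarrow> complex vec set \<Rightarrow> complex vec set" where
  "refl_act a w X = (\<lambda>v. perm_mat a w *\<^sub>v v) ` X"

definition refl_eigenspace :: "nat \<Rightarrow> (nat \<Rightarrow> nat) \<Rightarrow> complex \<Rightarrow> complex vec set set" where
  "refl_eigenspace a w z =
     {X \<in> carrier (refl_rep a). refl_act a w X = z \<odot>\<^bsub>refl_rep a\<^esub> X}"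

text \<open>As \<open>w\<close> has finite order it is diagonalisable on the reflection representation, so the
  multiplicity of an eigenvalue is the dimension of its eigenspace (\<open>0\<close> if it is not an
  eigenvalue).\<close>

definition refl_mult :: "nat \<Rightarrow> (nat \<Rightarrow> nat) \<Rightarrow> complex \<Rightarrow> nat" where
  "refl_mult a w z =
     vectorspace.dim class_ring ((refl_rep a)\<lparr>carrier := refl_eigenspace a w z\<rparr>)"

lemma refl_rep_coset:
  assumes "x \<in> carrier_vec a"
  shows "diagonal_line a +>\<^bsub>module_vec TYPE(complex) a\<^esub> x = {x + c \<cdot>\<^sub>v vec a (\<lambda>_. 1) | c. True}"
  using assms
  by (force simp: a_r_coset_def r_coset_def diagonal_line_def module_vec_def
      intro: comm_add_vec[of _ a])

lemma refl_rep_carrier: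
  "carrier (refl_rep a) = {{x + c \<cdot>\<^sub>v vec a (\<lambda>_. 1) | c. True} | x. x \<in> carrier_vec a}"
proof -
  have "carrier (refl_rep a) =
      {diagonal_line a +>\<^bsub>module_vec TYPE(complex) a\<^esub> x | x. x \<in> carrier_vec a}"
    by (auto simp: refl_rep_def quotient_module_def A_RCOSETS_def RCOSETS_def a_r_coset_def
        module_vec_def)
  also have "\<dots> = {{x + c \<cdot>\<^sub>v vec a (\<lambda>_. 1) | c. True} | x. x \<in> carrier_vec a}"
    by (rule Collect_cong) (metis refl_rep_coset)
  finally show ?thesis .
qed

lemma refl_rep_add:
  assumes "x \<in> carrier_vec a" "y \<in> carrier_vec a"
  shows "{x + c \<cdot>\<^sub>v vec a (\<lambda>_. 1) | c. True} \<oplus>\<^bsub>refl_rep a\<^esub> {y + c \<cdot>\<^sub>v vec a (\<lambda>_. 1) | c. True} =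
    {(x + y) + c \<cdot>\<^sub>v vec a (\<lambda>_. 1) | c. True}" (is "?X \<oplus>\<^bsub>_\<^esub> ?Y = ?Z")
proof -
  have "?X \<oplus>\<^bsub>refl_rep a\<^esub> ?Y = {u + v | u v. u \<in> ?X \<and> v \<in> ?Y}"
    by (auto simp: refl_rep_def quotient_module_def set_add_def set_mult_def module_vec_def)
  also have "\<dots> = ?Z"
  proof (intro Set.set_eqI iffI)
    fix z assume "z \<in> {u + v | u v. u \<in> ?X \<and> v \<in> ?Y}"
    then obtain c c' where "z = (x + c \<cdot>\<^sub>v vec a (\<lambda>_. 1)) + (y + c' \<cdot>\<^sub>v vec a (\<lambda>_. 1))" by blast
    also have "\<dots> = (x + y) + (c + c') \<cdot>\<^sub>v vec a (\<lambda>_. 1)"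
      using assms by (intro eq_vecI) auto
    finally show "z \<in> ?Z" by blast
  next
    fix z assume "z \<in> ?Z"
    then obtain c where "z = (x + y) + c \<cdot>\<^sub>v vec a (\<lambda>_. 1)" by blast
    also have "\<dots> = (x + c \<cdot>\<^sub>v vec a (\<lambda>_. 1)) + (y + 0 \<cdot>\<^sub>v vec a (\<lambda>_. 1))"
      using assms by (intro eq_vecI) auto
    finally show "z \<in> {u + v | u v. u \<in> ?X \<and> v \<in> ?Y}" by blast
  qed
  finally show ?thesis .
qed

lemma refl_rep_smult:
  assumes "x \<in> carrier_vec a"
  shows "z \<odot>\<^bsub>refl_rep a\<^esub> {x + c \<cdot>\<^sub>v vec a (\<lambda>_. 1) | c. True} =
    {z \<cdot>\<^sub>v x + c \<cdot>\<^sub>v vec a (\<lambda>_. 1) | c. True}" (is "_ \<odot>\<^bsub>_\<^esub> ?X = ?Z")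
proof -
  have "?X \<subseteq> carrier_vec a" using assms by auto
  have "z \<odot>\<^bsub>refl_rep a\<^esub> ?X =
      (\<Union>u\<in>?X. diagonal_line a +>\<^bsub>module_vec TYPE(complex) a\<^esub> (z \<cdot>\<^sub>v u))"
    by (simp add: refl_rep_def quotient_module_def module_vec_def)
  also have "\<dots> = (\<Union>u\<in>?X. {z \<cdot>\<^sub>v u + c \<cdot>\<^sub>v vec a (\<lambda>_. 1) | c. True})"
    using \<open>?X \<subseteq> carrier_vec a\<close> by (intro SUP_cong refl refl_rep_coset) auto
  also have "\<dots> = ?Z"
  proof (intro Set.set_eqI iffI)
    fix y assume "y \<in> (\<Union>u\<in>?X. {z \<cdot>\<^sub>v u + c \<cdot>\<^sub>v vec a (\<lambda>_. 1) | c. True})"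
    then obtain c c' where "y = z \<cdot>\<^sub>v (x + c \<cdot>\<^sub>v vec a (\<lambda>_. 1)) + c' \<cdot>\<^sub>v vec a (\<lambda>_. 1)" by blast
    also have "\<dots> = z \<cdot>\<^sub>v x + (z * c + c') \<cdot>\<^sub>v vec a (\<lambda>_. 1)"
      using assms by (intro eq_vecI) (auto simp: algebra_simps)
    finally show "y \<in> ?Z" by blast
  next
    fix y assume "y \<in> ?Z"
    then obtain c where "y = z \<cdot>\<^sub>v x + c \<cdot>\<^sub>v vec a (\<lambda>_. 1)" by blast
    also have "\<dots> = z \<cdot>\<^sub>v (x + 0 \<cdot>\<^sub>v vec a (\<lambda>_. 1)) + c \<cdot>\<^sub>v vec a (\<lambda>_. 1)"
      using assms by (intro eq_vecI) auto
    finally show "y \<in> (\<Union>u\<in>?X. {z \<cdot>\<^sub>v u + c \<cdot>\<^sub>v vec a (\<lambda>_. 1) | c. True})" by blast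
  qed
  finally show ?thesis .
qed

lemma refl_rep_zero: "\<zero>\<^bsub>refl_rep a\<^esub> = {0\<^sub>v a + c \<cdot>\<^sub>v vec a (\<lambda>_. 1) | c. True}"
  by (force simp: refl_rep_def quotient_module_def diagonal_line_def)

lemma vectorspace_refl_rep: "vectorspace class_ring (refl_rep a)"
proof -
  define cl :: "complex vec \<Rightarrow> complex vec set"
    where "cl x = {x + c \<cdot>\<^sub>v vec a (\<lambda>_. 1) | c. True}" for x
  have ops: "\<And>x y. x \<in> carrier_vec a \<Longrightarrow> y \<in> carrier_vec a \<Longrightarrow> cl x \<oplus>\<^bsub>refl_rep a\<^esub> cl y = cl (x + y)"
    "\<And>x z. x \<in> carrier_vec a \<Longrightarrow> z \<odot>\<^bsub>refl_rep a\<^esub> cl x = cl (z \<cdot>\<^sub>v x)"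
    "\<zero>\<^bsub>refl_rep a\<^esub> = cl (0\<^sub>v a)"
    unfolding cl_def using refl_rep_add refl_rep_smult refl_rep_zero by blast+
  have car: "carrier (refl_rep a) = cl ` carrier_vec a"
    using refl_rep_carrier[of a] by (auto simp: cl_def)
  have "abelian_group (refl_rep a)"
  proof (rule abelian_groupI)
    fix X assume "X \<in> carrier (refl_rep a)"
    then obtain x where x: "x \<in> carrier_vec a" "X = cl x" unfolding car by blast
    then have "cl (- x) \<oplus>\<^bsub>refl_rep a\<^esub> X = \<zero>\<^bsub>refl_rep a\<^esub>" by (simp add: ops)
    then show "\<exists>Y\<in>carrier (refl_rep a). Y \<oplus>\<^bsub>refl_rep a\<^esub> X = \<zero>\<^bsub>refl_rep a\<^esub>"
      unfolding car using x by (metis imageI uminus_carrier_vec)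
  next
    fix X Y assume "X \<in> carrier (refl_rep a)" "Y \<in> carrier (refl_rep a)"
    then show "X \<oplus>\<^bsub>refl_rep a\<^esub> Y = Y \<oplus>\<^bsub>refl_rep a\<^esub> X"
      unfolding car by (auto simp: ops comm_add_vec[of _ a])
  qed (auto simp: car ops assoc_add_vec[of _ a])
  moreover have "field (class_ring :: complex ring)" by (rule class_field.field_axioms)
  moreover have "cring (class_ring :: complex ring)" by (rule class_cring.cring_axioms)
  ultimately show ?thesis
    unfolding vectorspace_def
    by (auto intro!: module.intro module_axioms.intro
        simp: car ops smult_add_distrib_vec[of _ a] add_smult_distrib_vec smult_smult_assoc)
qed

lemma refl_act_coset:
  assumes "w permutes {1..a}" and "x \<in> carrier_vec a"
  shows "refl_act a w {x + c \<cdot>\<^sub>v vec a (\<lambda>_. 1) | c. True} =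
    {perm_mat a w *\<^sub>v x + c \<cdot>\<^sub>v vec a (\<lambda>_. 1) | c. True}"
proof -
  have one: "perm_mat a w *\<^sub>v vec a (\<lambda>_. 1) = vec a (\<lambda>_. 1)"
  proof (rule eq_vecI)
    fix i assume "i < dim_vec (vec a (\<lambda>_. 1 :: complex))"
    then have i: "i < a" by simp
    define j where "j = inv_into UNIV w (i + 1) - 1"
    have "inv_into UNIV w (i + 1) \<in> {1..a}"
      using i permutes_in_image[OF permutes_inv[OF assms(1)]] by simp
    then have "j < a" "j + 1 = inv_into UNIV w (i + 1)" by (auto simp: j_def)
    moreover have "w k = i + 1 \<longleftrightarrow> k = inv_into UNIV w (i + 1)" for k
      using permutes_inv_eq[OF assms(1)] by metis
    ultimately have "{k. k < a \<and> w (k + 1) = i + 1} = {j}" by auto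
    moreover have "(perm_mat a w *\<^sub>v vec a (\<lambda>_. 1)) $ i = (\<Sum>k<a. if w (k + 1) = i + 1 then 1 else 0)"
      using i by (simp add: perm_mat_def scalar_prod_def row_def lessThan_atLeast0)
    moreover have "\<dots> = of_nat (card {k. k < a \<and> w (k + 1) = i + 1})"
      by (simp add: sum.If_cases Int_def lessThan_def)
    ultimately show "(perm_mat a w *\<^sub>v vec a (\<lambda>_. 1)) $ i = vec a (\<lambda>_. 1) $ i"
      using i by simp
  qed (simp add: perm_mat_def)
  have P: "perm_mat a w \<in> carrier_mat a a" by (simp add: perm_mat_def)
  have "perm_mat a w *\<^sub>v (x + c \<cdot>\<^sub>v vec a (\<lambda>_. 1)) = perm_mat a w *\<^sub>v x + c \<cdot>\<^sub>v vec a (\<lambda>_. 1)" for c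
    using P assms(2) by (simp add: mult_add_distrib_mat_vec[OF P] mult_mat_vec[OF P] one)
  then show ?thesis unfolding refl_act_def by (auto simp: image_iff) metis
qed

end

theory Submission
  imports Defs "HOL-Analysis.Complex_Transcendental"
begin

text \<open>
  Put \<open>N = b - 1\<close>. If \<open>h m\<close> is the height of the \<open>m\<close>-th east step of a Dyck path and
  \<open>c m = b * h m - a * m\<close>, then two labels lie in the same block iff the last earlier positions with
  smaller \<open>c\<close> agree. Hence the rank of a block is the length of the vertical run before its minimum, and
  noncrossing parking functions are the classical rational parking functions \<open>x : [a] \<rightarrow> [N]\<close>.

  If the rotation is trivial, the cycle lemma modulo \<open>b\<close> counts the fixed points. Otherwise the fixed
  parking functions correspond to the functions \<open>y : [a] \<rightarrow> {0} \<union> \<int>/N\<close> with \<open>y \<circ> w = y + d\<close> (where \<open>0\<close> is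
  fixed): \<open>0\<close> marks the unique block containing the centre of the rotation, and every other block is recorded
  by its cyclically first element. Conversely such a \<open>y\<close> can be cut open at a suitable place into a
  parking function, and the result does not depend on the place. Both sides are determined by free values
  on representatives of those cycles of \<open>w\<close> whose length is divisible by the order of \<open>\<zeta> ^ d\<close>, and so
  is the \<open>\<zeta> ^ d\<close>-eigenspace of \<open>w\<close>.
\<close>

subsection \<open>Height functions and sibling blocks\<close>

text \<open>The obstacle is that \<open>rho\<close> does not act on values by a fixed permutation of
  {1..N}: when part of a block wraps from N to 1 its least element jumps, and whether this happens
  depends on all of x. So \<open>(rho ^^ d) x = x \<circ> w\<close> cannot be solved cycle by cycle.
  The shift \<open>tau\<close> applies one fixed permutation of {0..N} to every value, so its
  equation splits over the cycles of w, and the b = N + 1 possible values are the source of the base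
  b. A frame is a rotated copy in which the recorded elements are the block minima, and a marked
  block contains 1; between two frames \<open>rho\<close> and \<open>tau\<close> agree. The marked
  block of a fixed parking function is unique because the rotation by e = gcd d N with 2 * e \<le> N
  would make two candidates cross. For the trivial rotation that bound fails. There the eigenvalue 1
  loses the constant vector in V, and the cycle lemma divides by b to match.\<close>

locale rational_slope =
  fixes a b N :: nat
  assumes a_pos: "0 < a" and a_less: "a < b" and coprime_ab: "coprime a b" and b_eq: "b = Suc N"
begin

lemma N_pos: "0 < N"
  using a_pos a_less b_eq by linarith

text \<open>\<open>h m\<close> is the height of the \<open>m\<close>-th east step; \<open>h 0 = 0\<close> and the values beyond \<open>b\<close> are
  conventional.\<close>

definition heights :: "(nat \<Rightarrow> nat) \<Rightarrow> bool" where
  "heights h \<longleftrightarrow> h 0 = 0 \<and> mono h \<and> (\<forall>m. h m \<le> a) \<and> (\<forall>m\<le>b. a * m \<le> b * h m)"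

text \<open>Up to the factor b, the vertical distance of the lattice point (m, h m) above the line y
  = (a/b) x; scaling keeps it integral. For p < m the line of slope a/b through (p, h p) passes
  below (m, h m) iff the excess grows from p to m.\<close>

definition excess :: "(nat \<Rightarrow> nat) \<Rightarrow> nat \<Rightarrow> int" where
  "excess h m = int b * int (h m) - int a * int m"

text \<open>The laser from \<open>p\<close> passes below label \<open>k\<close> iff the excess stays above that of \<open>p\<close> on all of
  \<open>{p<..k}\<close>. For fixed \<open>k\<close> these \<open>p\<close> form the chain of iterated parents of \<open>k\<close>, so a block of the
  partition consists of the labels with a common parent \<open>p\<close>; its least element is \<open>Suc p\<close>. The value
  \<open>0\<close> serves as a virtual root.\<close>

definition parent :: "(nat \<Rightarrow> nat) \<Rightarrow> nat \<Rightarrow> nat" where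
  "parent h m = Max {p. p < m \<and> excess h p < excess h m}"

definition leader :: "(nat \<Rightarrow> nat) \<Rightarrow> nat \<Rightarrow> nat" where
  "leader h m = Suc (parent h m)"

definition lasered :: "(nat \<Rightarrow> nat) \<Rightarrow> nat \<Rightarrow> nat \<Rightarrow> bool" where
  "lasered h p k \<longleftrightarrow> p < k \<and> (\<forall>m\<in>{p<..k}. excess h p < excess h m)"

text \<open>\<open>excess h m\<close> is congruent to -a * m modulo b, and a is invertible there. So
  there are no ties among the positions 0..N, and comparisons of excesses at distinct positions are
  strict.\<close>

lemma excess_eq_imp_eq:
  assumes "p \<le> N" "m \<le> N" "excess h p = excess h m"
  shows "p = m"
proof -
  have "int a * (int m - int p) = int b * (int (h m) - int (h p))"
    using assms(3) by (simp add: excess_def algebra_simps)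
  then have "int b dvd int a * (int m - int p)" by simp
  moreover have "coprime (int b) (int a)" using coprime_ab by (simp add: coprime_commute)
  ultimately have "int b dvd int m - int p" by (simp add: coprime_dvd_mult_right_iff)
  moreover have "\<bar>int m - int p\<bar> < int b" using assms(1,2) b_eq by linarith
  ultimately show ?thesis
    using dvd_imp_le_int[of "int m - int p" "int b"] by (cases "m = p") auto
qed

lemma excess_Suc: "excess h (Suc m) = excess h m + int b * (int (h (Suc m)) - int (h m)) - int a"
  by (simp add: excess_def algebra_simps)

end

locale path_heights = rational_slope +
  fixes h :: "nat \<Rightarrow> nat"
  assumes heights: "heights h"
begin

lemma h_0 [simp]: "h 0 = 0" and h_mono: "i \<le> j \<Longrightarrow> h i \<le> h j" and h_le: "h m \<le> a"
  using heights by (auto simp: heights_def monoD)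

lemma excess_0 [simp]: "excess h 0 = 0"
  by (simp add: excess_def)

lemma excess_nonneg:
  assumes "m \<le> b"
  shows "0 \<le> excess h m"
proof -
  have "a * m \<le> b * h m" using heights assms by (auto simp: heights_def)
  then have "int (a * m) \<le> int (b * h m)" by (simp only: of_nat_le_iff)
  then show ?thesis by (simp add: excess_def)
qed

lemma excess_pos:
  assumes "0 < m" "m \<le> N"
  shows "0 < excess h m"
proof -
  have "m \<le> b" using assms b_eq by linarith
  then have "0 \<le> excess h m" by (rule excess_nonneg)
  moreover have "excess h m \<noteq> 0" using excess_eq_imp_eq[of 0 m h] assms by auto
  ultimately show ?thesis by simp
qed

text \<open>At abscissa N the diagonal has height a - a/b > a - 1, because a < b, so a path above it
  has already reached height a.\<close>

lemma h_N:
  assumes "N \<le> m"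
  shows "h m = a"
proof -
  have "N \<le> b" using b_eq by linarith
  then have "a * N \<le> b * h N" using heights by (auto simp: heights_def)
  have "\<not> h N < a"
  proof
    assume "h N < a"
    then have "b * Suc (h N) \<le> b * a" by (intro mult_le_mono) auto
    moreover have "b * a = a * N + a" by (subst b_eq) simp
    ultimately have "b * h N + b \<le> a * N + a" by simp
    then show False using \<open>a * N \<le> b * h N\<close> a_less by linarith
  qed
  then show ?thesis using h_le[of m] h_mono[OF assms] by linarith
qed

lemma excess_N: "excess h N = int a"
proof -
  have "int b * int a = int a * int N + int a" by (subst b_eq) (simp add: algebra_simps)
  then show ?thesis by (simp add: excess_def h_N)
qed

lemma excess_b: "excess h b = 0"
proof -
  have "N \<le> b" using b_eq by linarith
  then show ?thesis by (simp add: excess_def h_N)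
qed

lemma excess_Suc_ge: "excess h m - int a \<le> excess h (Suc m)"
  using h_mono[of m "Suc m"] by (simp add: excess_Suc)

text \<open>A flat step costs a, whereas a rise gains at least b - a > 0. This is how the valleys of
  the path become visible in \<open>excess\<close>.\<close>

lemma excess_Suc_less_iff: "excess h m < excess h (Suc m) \<longleftrightarrow> h m < h (Suc m)"
proof
  assume "h m < h (Suc m)"
  then have "int b * 1 \<le> int b * (int (h (Suc m)) - int (h m))" by (intro mult_left_mono) auto
  then show "excess h m < excess h (Suc m)" using a_less unfolding excess_Suc by linarith
next
  assume "excess h m < excess h (Suc m)"
  then show "h m < h (Suc m)"
    using h_mono[of m "Suc m"] by (cases "h m = h (Suc m)") (auto simp: excess_Suc)
qed

text \<open>The maximum defining \<open>parent\<close> exists because 0 is always a candidate: its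
  excess is 0 and labels have positive excess. Positions between the parent and m cannot tie with m,
  so they lie strictly above it.\<close>

lemma
  assumes "0 < m" "m \<le> N"
  shows parent_less: "parent h m < m"
    and excess_parent: "excess h (parent h m) < excess h m"
    and excess_after_parent: "\<And>p. parent h m < p \<Longrightarrow> p < m \<Longrightarrow> excess h m < excess h p"
proof -
  let ?S = "{p. p < m \<and> excess h p < excess h m}"
  have "finite ?S" by auto
  moreover have "0 \<in> ?S" using assms excess_pos by auto
  ultimately have "parent h m \<in> ?S" unfolding parent_def using Max_in by blast
  then show "parent h m < m" "excess h (parent h m) < excess h m" by auto
  fix p assume p: "parent h m < p" "p < m"
  have "\<not> excess h p < excess h m"
  proof
    assume "excess h p < excess h m"
    then have "p \<in> ?S" using p by simp
    from Max_ge[OF \<open>finite ?S\<close> this] show False using p(1) unfolding parent_def by linarith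
  qed
  then show "excess h m < excess h p"
    using excess_eq_imp_eq[of p m h] p assms by linarith
qed

lemma parent_eqI:
  assumes "p < m" "m \<le> N" "excess h p < excess h m"
    and "\<And>q. p < q \<Longrightarrow> q < m \<Longrightarrow> excess h m < excess h q"
  shows "parent h m = p"
proof -
  have m: "0 < m" "m \<le> N" using assms(1,2) by auto
  have "\<not> p < parent h m" using assms(4)[of "parent h m"] parent_less[OF m] excess_parent[OF m] by linarith
  moreover have "\<not> parent h m < p" using excess_after_parent[OF m, of p] assms(1,3) by linarith
  ultimately show ?thesis by simp
qed

text \<open>Positions strictly between \<open>parent h m\<close> and m exceed m itself, so a laser
  that runs below the parent also clears everything up to m. Conversely the source of a laser below
  m has smaller excess than m and hence is at most the parent.\<close>

lemma lasered_iff: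
  assumes m: "0 < m" "m \<le> N"
  shows "lasered h p m \<longleftrightarrow> p = parent h m \<or> lasered h p (parent h m)"
proof
  assume l: "lasered h p m"
  then have "p < m" "excess h p < excess h m" by (auto simp: lasered_def)
  then have "p \<le> parent h m"
    using excess_after_parent[OF m, of p] by linarith
  then show "p = parent h m \<or> lasered h p (parent h m)"
    using l parent_less[OF m] by (auto simp: lasered_def)
next
  assume "p = parent h m \<or> lasered h p (parent h m)"
  then have p: "p \<le> parent h m" "excess h p \<le> excess h (parent h m)"
    and below: "\<And>q. p < q \<Longrightarrow> q \<le> parent h m \<Longrightarrow> excess h p < excess h q"
    by (auto simp: lasered_def intro: less_imp_le)
  have "excess h p < excess h q" if "p < q" "q \<le> m" for q
  proof (cases "q \<le> parent h m")
    case False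
    then have "excess h m \<le> excess h q"
      using excess_after_parent[OF m, of q] that by (cases "q = m") auto
    then show ?thesis using excess_parent[OF m] p by linarith
  qed (use below that in auto)
  then show "lasered h p m"
    using parent_less[OF m] p by (auto simp: lasered_def)
qed

text \<open>No laser is fired at 0, but the virtual laser from 0 runs below every label, so
  including it changes nothing. Then each parent runs below the other label, hence equals or
  precedes the other parent, and antisymmetry finishes.\<close>

lemma same_lasers_iff:
  assumes "i \<in> {1..N}" "j \<in> {1..N}"
  shows "(\<forall>p>0. lasered h p i \<longleftrightarrow> lasered h p j) \<longleftrightarrow> parent h i = parent h j"
proof
  have ij: "0 < i" "i \<le> N" "0 < j" "j \<le> N" using assms by auto
  assume "\<forall>p>0. lasered h p i \<longleftrightarrow> lasered h p j"
  moreover have "lasered h 0 i" "lasered h 0 j"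
    using ij excess_pos by (auto simp: lasered_def)
  ultimately have "lasered h p i \<longleftrightarrow> lasered h p j" for p by (cases "p = 0") auto
  then have "lasered h (parent h i) j" "lasered h (parent h j) i"
    using lasered_iff ij by blast+
  then have "parent h i = parent h j \<or> lasered h (parent h i) (parent h j)"
    "parent h j = parent h i \<or> lasered h (parent h j) (parent h i)"
    using lasered_iff[OF ij(1,2)] lasered_iff[OF ij(3,4)] by blast+
  then have "parent h i \<le> parent h j" "parent h j \<le> parent h i"
    unfolding lasered_def by linarith+
  then show "parent h i = parent h j" by simp
next
  assume "parent h i = parent h j"
  moreover have "lasered h p i \<longleftrightarrow> p = parent h i \<or> lasered h p (parent h i)"
    "lasered h p j \<longleftrightarrow> p = parent h j \<or> lasered h p (parent h j)" for p
    using assms by (auto intro!: lasered_iff)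
  ultimately show "\<forall>p>0. lasered h p i \<longleftrightarrow> lasered h p j" by presburger
qed

lemma leader_bounds:
  assumes "m \<in> {1..N}"
  shows "1 \<le> leader h m" "leader h m \<le> m" "leader h m \<in> {1..N}"
proof -
  have "parent h m < m" using parent_less[of m] assms by simp
  then show "1 \<le> leader h m" "leader h m \<le> m" "leader h m \<in> {1..N}"
    using assms by (simp_all add: leader_def)
qed

lemma leader_1 [simp]: "leader h (Suc 0) = Suc 0"
proof -
  have "Suc 0 \<in> {1..N}" using N_pos by simp
  from leader_bounds(1,2)[OF this] show ?thesis by simp
qed

text \<open>Block minima are the positions preceded by a vertical run. This is what allows the
  values of a parking function to be read as block minima.\<close>

lemma leader_eq_self_iff:
  assumes "m \<in> {1..N}"
  shows "leader h m = m \<longleftrightarrow> h (m - 1) < h m"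
proof -
  obtain p where p: "m = Suc p" using assms by (cases m) auto
  have "parent h (Suc p) = p \<longleftrightarrow> excess h p < excess h (Suc p)"
  proof
    assume "parent h (Suc p) = p"
    then show "excess h p < excess h (Suc p)" using excess_parent[of "Suc p"] assms p by simp
  next
    assume "excess h p < excess h (Suc p)"
    then show "parent h (Suc p) = p" using parent_eqI[of p "Suc p"] assms p by simp
  qed
  then show ?thesis by (simp add: leader_def p excess_Suc_less_iff)
qed

lemma leader_leader:
  assumes "m \<in> {1..N}"
  shows "leader h (leader h m) = leader h m"
proof -
  have m: "0 < m" "m \<le> N" using assms by auto
  have "parent h (Suc (parent h m)) = parent h m"
  proof (rule parent_eqI)
    have "Suc (parent h m) = m \<or> Suc (parent h m) < m" using parent_less[OF m] by linarith
    then show "excess h (parent h m) < excess h (Suc (parent h m))"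
    proof
      assume "Suc (parent h m) = m"
      then show ?thesis using excess_parent[OF m] by (simp only:)
    next
      assume "Suc (parent h m) < m"
      from excess_after_parent[OF m lessI this] show ?thesis using excess_parent[OF m] by linarith
    qed
    show "Suc (parent h m) \<le> N" using parent_less[OF m] m by linarith
  qed simp_all
  then show ?thesis by (simp add: leader_def)
qed

text \<open>Positions strictly between a label and its parent have larger excess. So the excess
  decreases from j to k to l, which forces the parent of l to be at most that of k, and the parent
  of k to be at most that of j.\<close>

lemma leader_noncrossing:
  assumes "1 \<le> i" "i < j" "j < k" "k < l" "l \<le> N"
    and "leader h i = leader h k" "leader h j = leader h l"
  shows "leader h i = leader h j"
proof -
  have b: "0 < i" "i \<le> N" "0 < j" "j \<le> N" "0 < k" "k \<le> N" "0 < l" "l \<le> N" using assms by auto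
  have p: "parent h i = parent h k" "parent h j = parent h l" using assms by (auto simp: leader_def)
  have lt: "parent h k < i" "parent h l < j"
    using parent_less[OF b(1,2)] parent_less[OF b(3,4)] p by auto
  have kj: "excess h k < excess h j"
    using excess_after_parent[OF b(5,6), of j] lt assms by auto
  have lk: "excess h l < excess h k"
    using excess_after_parent[OF b(7,8), of k] lt assms by auto
  have "parent h l \<le> parent h k"
    using excess_after_parent[OF b(5,6), of "parent h l"] excess_parent[OF b(7,8)] lk lt assms
    by linarith
  moreover have "parent h k \<le> parent h j"
    using excess_after_parent[OF b(3,4), of "parent h k"] excess_parent[OF b(5,6)] kj lt assms
    by linarith
  ultimately show ?thesis using p by (simp add: leader_def)
qed

end

context rational_slope
begin

subsection \<open>Parking functions and their rotation\<close>

definition residue :: "int \<Rightarrow> nat" where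
  "residue i = Suc (nat ((i - 1) mod int N))"

lemma residue_range: "residue i \<in> {1..N}" "1 \<le> residue i" "residue i \<le> N"
proof -
  have "0 \<le> (i - 1) mod int N" "(i - 1) mod int N < int N" using N_pos by auto
  then show "residue i \<in> {1..N}" "1 \<le> residue i" "residue i \<le> N" by (auto simp: residue_def)
qed

lemma int_residue: "int (residue i) = (i - 1) mod int N + 1"
  using N_pos by (simp add: residue_def)

lemma residue_eq_iff: "residue i = residue j \<longleftrightarrow> int N dvd i - j"
proof -
  have "residue i = residue j \<longleftrightarrow> (i - 1) mod int N = (j - 1) mod int N"
    using int_residue[of i] int_residue[of j] by linarith
  also have "\<dots> \<longleftrightarrow> int N dvd (i - 1) - (j - 1)" by (rule mod_eq_dvd_iff)
  finally show ?thesis by simp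
qed

lemma residue_of_nat: "m \<in> {1..N} \<Longrightarrow> residue (int m) = m"
  by (auto simp: residue_def nat_diff_distrib)

lemma dvd_residue: "int N dvd int (residue i) - i"
proof -
  have "int (residue i) - i = - (int N * ((i - 1) div int N))"
    unfolding int_residue using mult_div_mod_eq[of "int N" "i - 1"] by linarith
  then show ?thesis by simp
qed

lemma residue_cong: "int N dvd i - j \<Longrightarrow> residue i = residue j"
  by (simp add: residue_eq_iff)

lemma residue_add_left: "residue (int (residue i) + j) = residue (i + j)"
  by (rule residue_cong) (use dvd_residue[of i] in \<open>simp add: algebra_simps\<close>)

lemma residue_eqI: "m \<in> {1..N} \<Longrightarrow> int N dvd i - int m \<Longrightarrow> residue i = m"
  using residue_cong[of i "int m"] residue_of_nat by simp

lemma residue_Suc: "residue (i + 1) = (if residue i = N then 1 else Suc (residue i))"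
proof -
  have "residue (i + 1) = residue (int (residue i) + 1)" by (simp add: residue_add_left)
  also have "\<dots> = (if residue i = N then 1 else Suc (residue i))"
  proof (cases "residue i = N")
    case False
    then show ?thesis using residue_range[of i] by (auto intro: residue_eqI)
  qed (use N_pos in \<open>auto intro: residue_eqI\<close>)
  finally show ?thesis .
qed

section \<open>Rational parking functions and their blocks\<close>

definition ht :: "(nat \<Rightarrow> nat) \<Rightarrow> nat \<Rightarrow> nat" where
  "ht x m = card {k\<in>{1..a}. x k \<le> m}"

text \<open>These are labelled Dyck paths: the labels k with x k = m stand on the vertical run at
  abscissa m - 1, so \<open>ht x\<close> is the height function of the path and the inequality is
  the Dyck condition cleared of denominators.\<close>

definition parking :: "(nat \<Rightarrow> nat) set" where
  "parking = {x \<in> {1..a} \<rightarrow>\<^sub>E {1..N}. \<forall>m\<le>N. a * m \<le> b * ht x m}"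

lemma parking_in: "x \<in> parking \<Longrightarrow> k \<in> {1..a} \<Longrightarrow> x k \<in> {1..N}"
  by (auto simp: parking_def)

lemma parking_extensional: "x \<in> parking \<Longrightarrow> x \<in> extensional {1..a}"
  by (auto simp: parking_def PiE_def)

lemma ht_0: "x \<in> {1..a} \<rightarrow>\<^sub>E {1..N} \<Longrightarrow> ht x 0 = 0"
  by (force simp: ht_def dest: PiE_mem)

lemma ht_top: "x \<in> {1..a} \<rightarrow>\<^sub>E {1..N} \<Longrightarrow> N \<le> m \<Longrightarrow> ht x m = a"
proof -
  assume "x \<in> {1..a} \<rightarrow>\<^sub>E {1..N}" "N \<le> m"
  then have "x k \<le> m" if "k \<in> {1..a}" for k using that by (force dest: PiE_mem)
  then have "{k\<in>{1..a}. x k \<le> m} = {1..a}" by blast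
  then show ?thesis by (simp add: ht_def)
qed

lemma ht_add: "ht x (m + n) = ht x m + card {k\<in>{1..a}. m < x k \<and> x k \<le> m + n}"
proof -
  have "{k\<in>{1..a}. x k \<le> m + n} = {k\<in>{1..a}. x k \<le> m} \<union> {k\<in>{1..a}. m < x k \<and> x k \<le> m + n}"
    by auto
  then show ?thesis unfolding ht_def by (simp add: card_Un_disjoint disjoint_iff)
qed

lemma mono_ht: "mono (ht x)"
  by (rule monoI) (metis ht_add le_add1 le_iff_add)

lemma path_heights_ht:
  assumes "x \<in> parking"
  shows "path_heights a b N (ht x)"
proof -
  have x: "x \<in> {1..a} \<rightarrow>\<^sub>E {1..N}" using assms by (simp add: parking_def)
  have "a * m \<le> b * ht x m" if "m \<le> b" for m
  proof (cases "m = b")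
    case True
    then show ?thesis using ht_top[OF x, of m] b_eq by simp
  next
    case False
    then have "m \<le> N" using that b_eq by linarith
    then show ?thesis using assms by (simp add: parking_def)
  qed
  moreover have "ht x m \<le> a" for m
    using ht_top[OF x, of "max m N"] monoD[OF mono_ht, of m "max m N" x] by simp
  ultimately have "heights (ht x)"
    using ht_0[OF x] mono_ht by (simp add: heights_def)
  then show ?thesis by (intro path_heights.intro path_heights_axioms.intro rational_slope_axioms)
qed

lemma leader_parking:
  assumes "x \<in> parking" "k \<in> {1..a}"
  shows "leader (ht x) (x k) = x k"
proof -
  interpret path_heights a b N "ht x" using assms by (intro path_heights_ht)
  have xk: "x k \<in> {1..N}" using assms parking_in by blast
  have "k \<in> {j\<in>{1..a}. x j \<le> x k} - {j\<in>{1..a}. x j \<le> x k - 1}"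
    "{j\<in>{1..a}. x j \<le> x k - 1} \<subseteq> {j\<in>{1..a}. x j \<le> x k}"
    using xk assms(2) by auto
  then have "{j\<in>{1..a}. x j \<le> x k - 1} \<subset> {j\<in>{1..a}. x j \<le> x k}" by blast
  then have "ht x (x k - 1) < ht x (x k)"
    unfolding ht_def by (rule psubset_card_mono[rotated]) simp
  then show ?thesis using leader_eq_self_iff[OF xk] by simp
qed

text \<open>Periodic extension of \<open>leader\<close> to the integers, so that rotating a
  partition is a translation of the argument without wrap-around cases.\<close>

definition lead :: "(nat \<Rightarrow> nat) \<Rightarrow> int \<Rightarrow> nat" where
  "lead x i = leader (ht x) (residue i)"

lemma lead_cong: "int N dvd i - j \<Longrightarrow> lead x i = lead x j"
  by (simp add: lead_def residue_cong)

lemma lead_of_nat: "m \<in> {1..N} \<Longrightarrow> lead x (int m) = leader (ht x) m"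
  by (simp add: lead_def residue_of_nat)

lemma lead_range: "x \<in> parking \<Longrightarrow> lead x i \<in> {1..N}"
  using path_heights.leader_bounds(3)[OF path_heights_ht] residue_range(1) by (simp add: lead_def)

lemma lead_parking: "x \<in> parking \<Longrightarrow> k \<in> {1..a} \<Longrightarrow> lead x (int (x k)) = x k"
  using lead_of_nat[OF parking_in] leader_parking by simp

lemma lead_le:
  assumes "x \<in> parking" "m \<in> {1..N}"
  shows "lead x (int m) \<le> m"
  using path_heights.leader_bounds(2)[OF path_heights_ht[OF assms(1)] assms(2)] assms(2)
  by (simp add: lead_of_nat)

text \<open>The i in {1..N} with \<open>lead x i = x k\<close> form the block labelled by k, and x k
  is the least of them; so these sets determine x.\<close>

lemma parking_eqI:
  assumes x: "x \<in> parking" and y: "y \<in> parking"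
    and eq: "\<And>k i. k \<in> {1..a} \<Longrightarrow> lead x i = x k \<longleftrightarrow> lead y i = y k"
  shows "x = y"
proof (rule extensionalityI[OF parking_extensional[OF x] parking_extensional[OF y]])
  fix k assume k: "k \<in> {1..a}"
  have "lead x (int (y k)) = x k" "lead y (int (x k)) = y k"
    using eq[OF k] lead_parking[OF x k] lead_parking[OF y k] by auto
  then have "x k \<le> y k" "y k \<le> x k"
    using lead_le[OF x parking_in[OF y k]] lead_le[OF y parking_in[OF x k]] by simp_all
  then show "x k = y k" by simp
qed

text \<open>A parking function records, for each \<open>k\<close>, the least element of the block labelled by \<open>k\<close>.
  Rotation by one step adds one to it, unless the block contains \<open>N\<close>.\<close>

definition rho :: "(nat \<Rightarrow> nat) \<Rightarrow> nat \<Rightarrow> nat" where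
  "rho x = (\<lambda>k\<in>{1..a}. if x k = leader (ht x) N then 1 else Suc (x k))"

section \<open>One step of the rotation\<close>

context
  fixes x
  assumes x: "x \<in> parking"
begin

interpretation path_heights a b N "ht x"
  by (rule path_heights_ht[OF x])

abbreviation (input) "last_leader \<equiv> leader (ht x) N"

lemma last_leader_range: "last_leader \<in> {1..N}"
  using leader_bounds(3)[of N] N_pos by simp

text \<open>The new path is the old one moved one step to the right, with the vertical run of the
  last block brought to the very front. Heights before the old place of that run gain its length,
  the others stay.\<close>

lemma ht_rho:
  "ht (rho x) (Suc m) = ht x m + (if m < last_leader then card {k\<in>{1..a}. x k = last_leader} else 0)"
proof -
  have "{k\<in>{1..a}. rho x k \<le> Suc m} =
      {k\<in>{1..a}. x k \<le> m} \<union> {k\<in>{1..a}. x k = last_leader}"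
    by (auto simp: rho_def)
  moreover have "{k\<in>{1..a}. x k = last_leader} \<subseteq> {k\<in>{1..a}. x k \<le> m}" if "\<not> m < last_leader"
    using that by auto
  moreover have "{k\<in>{1..a}. x k = last_leader} \<inter> {k\<in>{1..a}. x k \<le> m} = {}" if "m < last_leader"
    using that by auto
  ultimately show ?thesis
    unfolding ht_def by (auto simp: card_Un_disjoint Int_commute Un_absorb2)
qed

lemma card_last_leader:
  "int b * int (card {k\<in>{1..a}. x k = last_leader})
    = excess (ht x) last_leader - excess (ht x) (last_leader - 1) + int a"
proof -
  obtain l where l: "last_leader = Suc l" using last_leader_range by (cases last_leader) auto
  have "ht x (Suc l) = ht x l + card {k\<in>{1..a}. x k = Suc l}"
    using ht_add[of x l 1] by (simp add: le_Suc_eq less_Suc_eq_le[symmetric] conj_disj_distribL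
        cong: conj_cong) (metis (no_types, lifting) Suc_lessI less_Suc_eq not_less_iff_gr_or_eq)
  then show ?thesis unfolding l by (simp add: excess_Suc)
qed

text \<open>The move by one step costs a everywhere. Before \<open>last_leader\<close> the run
  brought to the front gains b times its length, and the total is the old jump of the excess at
  \<open>last_leader\<close>.\<close>

lemma excess_rho:
  "excess (ht (rho x)) (Suc m) = (if m < last_leader
      then excess (ht x) m + (excess (ht x) last_leader - excess (ht x) (last_leader - 1))
      else excess (ht x) m - int a)"
proof (cases "m < last_leader")
  case True
  have "excess (ht (rho x)) (Suc m) = int b * int (ht x m)
      + int b * int (card {k\<in>{1..a}. x k = last_leader}) - int a * int (Suc m)"
    using True by (simp add: excess_def ht_rho algebra_simps)
  then show ?thesis using True unfolding card_last_leader
    by (simp add: excess_def[of "ht x" m] algebra_simps)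
next
  case False
  then show ?thesis by (simp add: excess_def ht_rho algebra_simps)
qed

text \<open>The label N has excess a, and everything strictly between its parent and N exceeds
  that.\<close>

lemma excess_ge_a:
  assumes "last_leader \<le> m" "m \<le> N"
  shows "int a \<le> excess (ht x) m"
proof (cases "m = N")
  case False
  have "excess (ht x) N < excess (ht x) m"
    by (rule excess_after_parent) (use assms False N_pos in \<open>auto simp: leader_def\<close>)
  then show ?thesis using excess_N by simp
qed (use excess_N in simp)

lemma excess_before_last_leader: "excess (ht x) (last_leader - 1) < int a"
  using excess_parent[OF N_pos order_refl] excess_N by (simp add: leader_def)

lemma excess_last_leader: "excess (ht x) (last_leader - 1) < excess (ht x) last_leader"
  using excess_before_last_leader excess_ge_a[of last_leader] last_leader_range by auto

lemma rho_parking: "rho x \<in> parking"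
proof -
  have xr: "x k \<in> {1..N}" if "k \<in> {1..a}" for k using x that parking_in by blast
  have "rho x k \<in> {1..N}" if "k \<in> {1..a}" for k
  proof -
    have "x k \<noteq> N \<or> x k = last_leader" using leader_parking[OF x that] by metis
    then show ?thesis using xr[OF that] that N_pos by (auto simp: rho_def)
  qed
  moreover have "rho x \<in> extensional {1..a}" by (simp add: rho_def)
  moreover have "a * m \<le> b * ht (rho x) m" if "m \<le> N" for m
  proof (cases m)
    case (Suc l)
    have "0 \<le> excess (ht (rho x)) m"
    proof (cases "l < last_leader")
      case True
      have "l \<le> b" using Suc that b_eq by linarith
      then show ?thesis unfolding Suc excess_rho
        using True excess_nonneg[of l] excess_last_leader by simp
    next
      case False
      then show ?thesis unfolding Suc excess_rho
        using excess_ge_a[of l] Suc that by simp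
    qed
    then have "int (a * m) \<le> int (b * ht (rho x) m)" by (simp add: excess_def)
    then show ?thesis by (simp only: of_nat_le_iff)
  qed simp
  ultimately show ?thesis by (auto simp: parking_def PiE_def)
qed

interpretation rho: path_heights a b N "ht (rho x)"
  by (rule path_heights_ht[OF rho_parking])

text \<open>Either m and its parent lie on the same side of \<open>last_leader\<close>, and the
  excess changes by the same amount on the whole stretch between them, or m belongs to the last
  block. That block is moved to the front, so its parent becomes the virtual root 0.\<close>

lemma leader_rho:
  assumes m: "m \<in> {1..<N}"
  shows "leader (ht (rho x)) (Suc m) =
    (if leader (ht x) m = last_leader then 1 else Suc (leader (ht x) m))"
proof -
  have m': "0 < m" "m \<le> N" using m by auto
  define p where "p = parent (ht x) m"
  have p: "p < m" "excess (ht x) p < excess (ht x) m"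
    and p_after: "\<And>q. p < q \<Longrightarrow> q < m \<Longrightarrow> excess (ht x) m < excess (ht x) q"
    using parent_less[OF m'] excess_parent[OF m'] excess_after_parent[OF m'] by (auto simp: p_def)
  consider (left) "m < last_leader" | (right) "last_leader \<le> p"
    | (block) "p < last_leader" "last_leader \<le> m" by linarith
  then show ?thesis
  proof cases
    case left
    have "parent (ht (rho x)) (Suc m) = Suc p"
    proof (rule rho.parent_eqI)
      fix q assume q: "Suc p < q" "q < Suc m"
      then obtain r where r: "q = Suc r" by (cases q) auto
      show "excess (ht (rho x)) (Suc m) < excess (ht (rho x)) q"
        unfolding r excess_rho using left q r p_after[of r] by simp
    qed (use p left m in \<open>auto simp: excess_rho\<close>)
    moreover have "leader (ht x) m \<noteq> last_leader" using p left by (simp add: leader_def p_def)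
    ultimately show ?thesis by (simp add: leader_def p_def)
  next
    case right
    have "parent (ht (rho x)) (Suc m) = Suc p"
    proof (rule rho.parent_eqI)
      fix q assume q: "Suc p < q" "q < Suc m"
      then obtain r where r: "q = Suc r" by (cases q) auto
      show "excess (ht (rho x)) (Suc m) < excess (ht (rho x)) q"
        unfolding r excess_rho using right q r p p_after[of r] by simp
    qed (use p right m in \<open>auto simp: excess_rho\<close>)
    moreover have "leader (ht x) m \<noteq> last_leader" using right by (simp add: leader_def p_def)
    ultimately show ?thesis by (simp add: leader_def p_def)
  next
    case block
    \<comment> \<open>A smaller parent would leave the position \<open>last_leader - 1\<close>
      between p and m; its excess is below a, whereas m has excess at least a.\<close>
    have "p = last_leader - 1"
    proof (rule ccontr)
      assume "p \<noteq> last_leader - 1"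
      then have "p < last_leader - 1" "last_leader - 1 < m" using block last_leader_range by auto
      from p_after[OF this] show False
        using excess_ge_a[of m] excess_before_last_leader block m by simp
    qed
    then have ll: "leader (ht x) m = last_leader"
      using last_leader_range by (simp add: leader_def[of "ht x" m] p_def)
    have le: "excess (ht x) m \<le> excess (ht x) last_leader"
      using p_after[of last_leader] block by (cases "m = last_leader") auto
    have "parent (ht (rho x)) (Suc m) = 0"
    proof (rule rho.parent_eqI)
      show "excess (ht (rho x)) 0 < excess (ht (rho x)) (Suc m)"
        using rho.excess_pos[of "Suc m"] m by simp
      fix q assume q: "0 < q" "q < Suc m"
      then obtain r where r: "q = Suc r" by (cases q) auto
      show "excess (ht (rho x)) (Suc m) < excess (ht (rho x)) q"
      proof (cases "r < last_leader")
        case True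
        have "r \<le> b" using q r m b_eq by auto
        then show ?thesis unfolding r excess_rho
          using True block le excess_before_last_leader excess_nonneg[of r] by simp
      next
        case False
        then show ?thesis unfolding r excess_rho
          using block q r p_after[of r] by simp
      qed
    qed (use m in auto)
    then show ?thesis using ll by (simp add: leader_def[of "ht (rho x)"])
  qed
qed

lemma lead_rho: "lead (rho x) (i + 1) = (if lead x i = last_leader then 1 else Suc (lead x i))"
proof (cases "residue i = N")
  case True
  then show ?thesis by (simp add: lead_def residue_Suc)
next
  case False
  then show ?thesis using leader_rho[of "residue i"] residue_range[of i]
    by (simp add: lead_def residue_Suc)
qed

lemma lead_rho_eq_iff: "lead (rho x) (i + 1) = lead (rho x) (j + 1) \<longleftrightarrow> lead x i = lead x j"
  using lead_range[OF x, of i] lead_range[OF x, of j] by (auto simp: lead_rho)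

lemma lead_rho_eq_rho_iff:
  assumes "k \<in> {1..a}"
  shows "lead (rho x) (i + 1) = rho x k \<longleftrightarrow> lead x i = x k"
proof -
  have "rho x k = (if x k = last_leader then 1 else Suc (x k))" using assms by (simp add: rho_def)
  moreover have "0 < lead x i" "0 < x k"
    using lead_range[OF x, of i] parking_in[OF x assms] by simp_all
  ultimately show ?thesis unfolding lead_rho by simp
qed

end

section \<open>Iterated rotation\<close>

lemma funpow_rho_parking: "x \<in> parking \<Longrightarrow> (rho ^^ t) x \<in> parking"
  by (induction t) (auto intro: rho_parking)

lemma lead_funpow_rho_eq_iff:
  assumes "x \<in> parking"
  shows "lead ((rho ^^ t) x) i = lead ((rho ^^ t) x) j \<longleftrightarrow> lead x (i - int t) = lead x (j - int t)"
proof (induction t arbitrary: i j)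
  case (Suc t)
  have "lead ((rho ^^ Suc t) x) i = lead ((rho ^^ Suc t) x) j \<longleftrightarrow>
      lead ((rho ^^ t) x) (i - 1) = lead ((rho ^^ t) x) (j - 1)"
    using lead_rho_eq_iff[OF funpow_rho_parking[OF assms, of t], of "i - 1" "j - 1"] by simp
  also have "\<dots> \<longleftrightarrow> lead x (i - int (Suc t)) = lead x (j - int (Suc t))"
    unfolding Suc.IH by (simp add: algebra_simps)
  finally show ?case .
qed simp

lemma lead_funpow_rho_eq_funpow_rho_iff:
  assumes "x \<in> parking" "k \<in> {1..a}"
  shows "lead ((rho ^^ t) x) i = (rho ^^ t) x k \<longleftrightarrow> lead x (i - int t) = x k"
proof (induction t arbitrary: i)
  case (Suc t)
  have "lead ((rho ^^ Suc t) x) i = (rho ^^ Suc t) x k \<longleftrightarrow>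
      lead ((rho ^^ t) x) (i - 1) = (rho ^^ t) x k"
    using lead_rho_eq_rho_iff[OF funpow_rho_parking[OF assms(1), of t] assms(2), of "i - 1"] by simp
  also have "\<dots> \<longleftrightarrow> lead x (i - int (Suc t)) = x k"
    unfolding Suc.IH by (simp add: algebra_simps)
  finally show ?case .
qed simp

text \<open>Block membership is periodic with period N by construction of \<open>lead\<close>, and
  by \<open>parking_eqI\<close> it determines the parking function.\<close>

lemma funpow_rho_N:
  assumes "x \<in> parking"
  shows "(rho ^^ N) x = x"
proof (rule parking_eqI[OF funpow_rho_parking[OF assms] assms])
  fix k i assume "k \<in> {1..a}"
  moreover have "lead x (i - int N) = lead x i" by (rule lead_cong) simp
  ultimately show "lead ((rho ^^ N) x) i = (rho ^^ N) x k \<longleftrightarrow> lead x i = x k"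
    using lead_funpow_rho_eq_funpow_rho_iff[OF assms] by simp
qed

lemma ht_comp_perm:
  assumes "w permutes {1..a}"
  shows "ht (x \<circ> w) = ht x"
proof
  fix m
  have "w ` {k\<in>{1..a}. x (w k) \<le> m} = {k\<in>{1..a}. x k \<le> m}"
  proof -
    have "k \<in> w ` {k\<in>{1..a}. x (w k) \<le> m}" if "k \<in> {1..a}" "x k \<le> m" for k
      using that permutes_inverses(1)[OF assms, of k] permutes_in_image[OF permutes_inv[OF assms], of k]
      by (intro image_eqI[of _ _ "inv_into UNIV w k"]) auto
    then show ?thesis using permutes_in_image[OF assms] by auto
  qed
  then have "card {k\<in>{1..a}. x k \<le> m} = card {k\<in>{1..a}. x (w k) \<le> m}"
    using card_image[OF inj_on_subset[OF permutes_inj[OF assms] subset_UNIV]] by metis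
  then show "ht (x \<circ> w) m = ht x m" by (simp add: ht_def)
qed

lemma PiE_comp_perm:
  assumes w: "w permutes S" and x: "x \<in> S \<rightarrow>\<^sub>E A"
  shows "x \<circ> w \<in> S \<rightarrow>\<^sub>E A"
proof (rule PiE_I)
  fix k assume "k \<in> S"
  then show "(x \<circ> w) k \<in> A" using x permutes_in_image[OF w, of k] by auto
next
  fix k assume "k \<notin> S"
  then show "(x \<circ> w) k = undefined" using x permutes_not_in[OF w, of k] by auto
qed

lemma parking_comp_perm:
  assumes "w permutes {1..a}" "x \<in> parking"
  shows "x \<circ> w \<in> parking"
  using PiE_comp_perm[OF assms(1), of x "{1..N}"] assms by (auto simp: parking_def ht_comp_perm)

lemma rho_comp_perm:
  assumes "w permutes {1..a}"
  shows "rho (x \<circ> w) = rho x \<circ> w"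
proof
  fix k
  show "rho (x \<circ> w) k = (rho x \<circ> w) k"
    unfolding rho_def ht_comp_perm[OF assms] using permutes_in_image[OF assms, of k] by simp
qed

lemma funpow_rho_comp_perm:
  "w permutes {1..a} \<Longrightarrow> (rho ^^ t) (x \<circ> w) = (rho ^^ t) x \<circ> w"
  by (induction t) (simp_all add: rho_comp_perm)

text \<open>Crossings are a cyclic notion: the rotation by t takes i to position 1, and with it the
  window of length N starting at i to {1..N}, where the linear statement applies.\<close>

lemma lead_noncrossing:
  assumes x: "x \<in> parking" and ord: "i < j" "j < k" "k < l" "l < i + int N"
    and eq: "lead x i = lead x k" "lead x j = lead x l"
  shows "lead x i = lead x j"
proof -
  define t where "t = N + 1 - residue i"
  have t: "int t = int N + 1 - int (residue i)" using residue_range[of i] by (simp add: t_def)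
  define y where "y = (rho ^^ t) x"
  interpret path_heights a b N "ht y"
    unfolding y_def by (intro path_heights_ht funpow_rho_parking x)
  have "i + int t - 1 = int N - (int (residue i) - i)" using t by simp
  then have dvd: "int N dvd i + int t - 1"
    using dvd_residue[of i] by (metis dvd_diff dvd_refl)
  have lead_y: "lead y (m + int t) = leader (ht y) (Suc (nat (m - i)))" if "i \<le> m" "m < i + int N" for m
  proof -
    have "residue (m + int t) = Suc (nat (m - i))"
      by (rule residue_eqI) (use that dvd in \<open>auto simp: algebra_simps\<close>)
    then show ?thesis by (simp add: lead_def)
  qed
  have eq_iff: "leader (ht y) (Suc (nat (m - i))) = leader (ht y) (Suc (nat (n - i))) \<longleftrightarrow> lead x m = lead x n"
    if "i \<le> m" "m < i + int N" "i \<le> n" "n < i + int N" for m n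
    using lead_funpow_rho_eq_iff[OF x, of t "m + int t" "n + int t"] lead_y that
    by (simp add: y_def)
  have "leader (ht y) (Suc (nat (i - i))) = leader (ht y) (Suc (nat (k - i)))"
    by (rule eq_iff[THEN iffD2]) (use ord eq(1) in linarith)+
  moreover have "leader (ht y) (Suc (nat (j - i))) = leader (ht y) (Suc (nat (l - i)))"
    by (rule eq_iff[THEN iffD2]) (use ord eq(2) in linarith)+
  moreover have "1 \<le> Suc (nat (i - i))" "Suc (nat (i - i)) < Suc (nat (j - i))"
    "Suc (nat (j - i)) < Suc (nat (k - i))" "Suc (nat (k - i)) < Suc (nat (l - i))"
    "Suc (nat (l - i)) \<le> N"
    using ord by auto
  ultimately have "leader (ht y) (Suc (nat (i - i))) = leader (ht y) (Suc (nat (j - i)))"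
    by (intro leader_noncrossing[of "Suc (nat (i - i))" "Suc (nat (j - i))" "Suc (nat (k - i))" "Suc (nat (l - i))"])
  note eq_ij = this
  show ?thesis by (rule eq_iff[THEN iffD1]) (use ord eq_ij in linarith)+
qed

text \<open>The new minimum is at most the image of the old one, because that image lies in the
  rotated block. Conversely the new minimum is the image of a member m with x k \<le> m. By
  \<open>no_straddle\<close> m wraps around only if x k does, and if x k wraps so does the larger m;
  hence their order is preserved.\<close>

lemma funpow_rho_eq_residue:
  assumes x: "x \<in> parking" and k: "k \<in> {1..a}" and s: "s \<le> N"
    and no_straddle: "\<And>m. m \<in> {1..N} \<Longrightarrow> lead x (int m) = x k \<Longrightarrow> x k + s \<le> N \<Longrightarrow> m + s \<le> N"
  shows "(rho ^^ s) x k = residue (int (x k) + int s)"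
proof -
  let ?z = "(rho ^^ s) x"
  define u where "u = residue (int (x k) + int s)"
  define m where "m = residue (int (?z k) - int s)"
  have z: "?z \<in> parking" by (rule funpow_rho_parking[OF x])
  have xk: "x k \<in> {1..N}" and zk: "?z k \<in> {1..N}" using parking_in x z k by auto
  have m_range: "m \<in> {1..N}" unfolding m_def by (rule residue_range)
  have "lead x (int u - int s) = lead x (int (x k))"
    by (rule lead_cong) (use dvd_residue[of "int (x k) + int s"] in \<open>simp add: u_def algebra_simps\<close>)
  then have "lead ?z (int u) = ?z k"
    using lead_funpow_rho_eq_funpow_rho_iff[OF x k, of s "int u"] lead_parking[OF x k] by simp
  then have "?z k \<le> u" using lead_le[OF z, of u] residue_range by (simp add: u_def)
  have "lead x (int (?z k) - int s) = x k"
    using lead_funpow_rho_eq_funpow_rho_iff[OF x k, of s "int (?z k)"] lead_parking[OF z k] by simp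
  moreover have "lead x (int m) = lead x (int (?z k) - int s)"
    unfolding m_def by (rule lead_cong) (rule dvd_residue)
  ultimately have m: "lead x (int m) = x k" by simp
  then have "x k \<le> m" using lead_le[OF x m_range] by simp
  have "residue (int m + int s) = residue (int (?z k))"
    unfolding m_def residue_add_left by simp
  then have zk_eq: "?z k = residue (int m + int s)" using residue_of_nat[OF zk] by simp
  have "u \<le> ?z k"
  proof (cases "x k + s \<le> N")
    case True
    then have "m + s \<le> N" using no_straddle m_range m by blast
    then have "?z k = m + s" "u = x k + s"
      unfolding zk_eq u_def using True xk m_range by (auto intro!: residue_eqI)
    then show ?thesis using \<open>x k \<le> m\<close> by simp
  next
    case False
    then have "?z k = m + s - N" "u = x k + s - N"
      unfolding zk_eq u_def using xk m_range \<open>x k \<le> m\<close> s by (auto intro!: residue_eqI simp: of_nat_diff)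
    then show ?thesis using \<open>x k \<le> m\<close> by simp
  qed
  then show ?thesis using \<open>?z k \<le> u\<close> by (simp add: u_def)
qed

text \<open>A function into \<open>{0..N}\<close> describes a parking function with a distinguished block or gap: the
  value \<open>0\<close> stands for the distinguished block, which rotation leaves in place.\<close>

definition shift :: "nat \<Rightarrow> nat \<Rightarrow> nat" where
  "shift s v = (if v = 0 then 0 else residue (int v + int s))"

definition tau :: "nat \<Rightarrow> (nat \<Rightarrow> nat) \<Rightarrow> nat \<Rightarrow> nat" where
  "tau s y = (\<lambda>k\<in>{1..a}. shift s (y k))"

text \<open>In a frame the marked block contains the label 1, so the mark 0 stands for the minimum
  1; \<open>fill\<close> forgets the mark and \<open>unfill\<close> restores it.\<close>

definition fill :: "(nat \<Rightarrow> nat) \<Rightarrow> nat \<Rightarrow> nat" where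
  "fill y = (\<lambda>k\<in>{1..a}. if y k = 0 then 1 else y k)"

definition unfill :: "(nat \<Rightarrow> nat) \<Rightarrow> nat \<Rightarrow> nat" where
  "unfill x = (\<lambda>k\<in>{1..a}. if x k = 1 then 0 else x k)"

lemma shift_eq_0_iff [simp]: "shift s v = 0 \<longleftrightarrow> v = 0"
  using residue_range(2)[of "int v + int s"] by (auto simp: shift_def)

lemma shift_pos_iff [simp]: "0 < shift s v \<longleftrightarrow> 0 < v"
  using shift_eq_0_iff[of s v] by linarith

lemma shift_le: "shift s v \<le> N"
  using residue_range by (simp add: shift_def)

lemma shift_shift: "shift s (shift t v) = shift (s + t) v"
  using residue_range(2)[of "int v + int t"]
    residue_add_left[of "int v + int t" "int s"]
  by (simp add: shift_def add.assoc add.commute[of "int t"])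

lemma shift_eq:
  assumes "v \<le> N" "s \<le> N"
  shows "shift s v = (if v = 0 then 0 else if v + s \<le> N then v + s else v + s - N)"
  using assms by (auto simp: shift_def of_nat_diff intro!: residue_eqI)

lemma shift_N_mult: "v \<le> N \<Longrightarrow> N dvd s \<Longrightarrow> shift s v = v"
  by (auto simp: shift_def intro!: residue_eqI)

lemma tau_tau: "tau s (tau t y) = tau (s + t) y"
  by (auto simp: tau_def shift_shift)

lemma zero_in_tau_iff: "0 \<in> tau s y ` {1..a} \<longleftrightarrow> 0 \<in> y ` {1..a}"
  by (simp add: image_iff tau_def)

lemma tau_range: "tau s y \<in> {1..a} \<rightarrow>\<^sub>E {0..N}"
  by (auto simp: tau_def shift_le)

lemma tau_N_mult: "y \<in> {1..a} \<rightarrow>\<^sub>E {0..N} \<Longrightarrow> N dvd s \<Longrightarrow> tau s y = y"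
  by (rule extensionalityI[of _ "{1..a}"]) (auto simp: tau_def shift_N_mult PiE_iff)

lemma tau_comp_perm: "w permutes {1..a} \<Longrightarrow> tau s (y \<circ> w) = tau s y \<circ> w"
  using permutes_in_image[of w "{1..a}"] by (auto simp: tau_def fun_eq_iff)

lemma fill_comp_perm: "w permutes {1..a} \<Longrightarrow> fill (y \<circ> w) = fill y \<circ> w"
  using permutes_in_image[of w "{1..a}"] by (auto simp: fill_def fun_eq_iff)

lemma unfill_comp_perm: "w permutes {1..a} \<Longrightarrow> unfill (x \<circ> w) = unfill x \<circ> w"
  using permutes_in_image[of w "{1..a}"] by (auto simp: unfill_def fun_eq_iff)

lemma fill_unfill: "x \<in> parking \<Longrightarrow> fill (unfill x) = x"
  by (rule extensionalityI[OF _ parking_extensional])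
    (auto simp: fill_def unfill_def dest: parking_in)

lemma fill_nonzero: "y \<in> {1..a} \<rightarrow>\<^sub>E {0..N} \<Longrightarrow> 0 \<notin> y ` {1..a} \<Longrightarrow> fill y = y"
  by (rule extensionalityI[of _ "{1..a}"]) (auto simp: fill_def PiE_iff)

lemma unfill_fill:
  "y \<in> {1..a} \<rightarrow>\<^sub>E {0..N} \<Longrightarrow> 1 \<notin> y ` {1..a} \<Longrightarrow> unfill (fill y) = y"
  by (rule extensionalityI[of _ "{1..a}"]) (force simp: fill_def unfill_def PiE_iff)+

text \<open>The hypothesis puts N + 1 - s, which the rotation takes to 1, into the block of 1; so
  this block keeps the minimum 1. Any other block straddling the wrap-around would cross the pair 1,
  N + 1 - s.\<close>

lemma funpow_rho_central:
  assumes x: "x \<in> parking" and s: "0 < s" "s < N" and lead: "lead x (1 - int s) = lead x 1"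
  shows "(rho ^^ s) x = fill (tau s (unfill x))"
proof (rule extensionalityI[of _ "{1..a}"])
  interpret path_heights a b N "ht x" by (rule path_heights_ht[OF x])
  have z: "(rho ^^ s) x \<in> parking" by (rule funpow_rho_parking[OF x])
  then show "(rho ^^ s) x \<in> extensional {1..a}" by (rule parking_extensional)
  show "fill (tau s (unfill x)) \<in> extensional {1..a}" by (simp add: fill_def)
  have lead1: "lead x 1 = 1" using lead_of_nat[of 1 x] N_pos by simp
  fix k assume k: "k \<in> {1..a}"
  show "(rho ^^ s) x k = fill (tau s (unfill x)) k"
  proof (cases "x k = 1")
    case True
    then have "lead ((rho ^^ s) x) 1 = (rho ^^ s) x k"
      using lead_funpow_rho_eq_funpow_rho_iff[OF x k, of s 1] lead lead1 by simp
    then have "(rho ^^ s) x k \<le> 1" using lead_le[OF z, of 1] N_pos by simp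
    then have "(rho ^^ s) x k = 1" using parking_in[OF z k] by simp
    then show ?thesis using True k by (simp add: fill_def tau_def unfill_def)
  next
    case False
    have xk: "x k \<in> {1..N}" using parking_in x k by blast
    have "(rho ^^ s) x k = residue (int (x k) + int s)"
    proof (rule funpow_rho_eq_residue[OF x k])
      fix m assume m: "m \<in> {1..N}" "lead x (int m) = x k" "x k + s \<le> N"
      have t: "lead x (int N + 1 - int s) = 1"
        using lead lead1 lead_cong[of "int N + 1 - int s" "1 - int s" x] by simp
      show "m + s \<le> N"
      proof (rule ccontr)
        assume "\<not> m + s \<le> N"
        moreover have "int m \<noteq> int N + 1 - int s" using t m(2) False by auto
        ultimately have "int N + 1 - int s < int m" using s by auto
        then have "lead x 1 = lead x (int (x k))"
          using lead_noncrossing[OF x, of 1 "int (x k)" "int N + 1 - int s" "int m"]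
            m xk False t lead1 lead_parking[OF x k] by auto
        then show False using lead1 lead_parking[OF x k] False by simp
      qed
    qed (use s in simp)
    then show ?thesis using False k xk by (simp add: fill_def tau_def unfill_def) (simp add: shift_def)
  qed
qed

text \<open>A value 1 would come from a block with minimum N + 1 - s other than the block of 1, but
  by assumption that label belongs to the block of 1.\<close>

lemma one_notin_tau_unfill:
  assumes x: "x \<in> parking" and s: "0 < s" "s < N" and lead: "lead x (1 - int s) = lead x 1"
  shows "1 \<notin> tau s (unfill x) ` {1..a}"
proof
  interpret path_heights a b N "ht x" by (rule path_heights_ht[OF x])
  assume "1 \<in> tau s (unfill x) ` {1..a}"
  then obtain k where k: "k \<in> {1..a}" "shift s (unfill x k) = 1" by (auto simp: tau_def)
  then have xk: "x k \<noteq> 1" "residue (int (x k) + int s) = 1"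
    by (auto simp: shift_def unfill_def split: if_splits)
  then have "int N dvd int (x k) + int s - 1"
    using dvd_residue[of "int (x k) + int s"] by (simp add: dvd_diff_commute)
  then have "lead x (int (x k)) = lead x (1 - int s)"
    by (intro lead_cong) (simp add: algebra_simps)
  moreover have "lead x 1 = 1" using lead_of_nat[of 1 x] N_pos by simp
  ultimately show False using lead lead_parking[OF x k(1)] xk by simp
qed

definition short :: "nat \<Rightarrow> (nat \<Rightarrow> nat) \<Rightarrow> bool" where
  "short e x \<longleftrightarrow> (\<forall>i\<in>{1..N}. \<forall>j\<in>{1..N}. lead x (int i) = lead x (int j) \<longrightarrow> j < i + e)"

text \<open>Suppose that a later member m of a block wraps around and its minimum x k does not.
  Their distances before and after the rotation add up to N, but both are below e, against 2 * e
  \<le> N.\<close>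

lemma funpow_rho_short:
  assumes x: "x \<in> parking" and e: "2 * e \<le> N" and s: "s < N"
    and short: "short e x" "short e ((rho ^^ s) x)"
  shows "(rho ^^ s) x = tau s x"
proof (rule extensionalityI[of _ "{1..a}"])
  show "(rho ^^ s) x \<in> extensional {1..a}" by (intro parking_extensional funpow_rho_parking x)
  show "tau s x \<in> extensional {1..a}" by (simp add: tau_def)
  fix k assume k: "k \<in> {1..a}"
  have xk: "x k \<in> {1..N}" using parking_in x k by blast
  have "(rho ^^ s) x k = residue (int (x k) + int s)"
  proof (rule funpow_rho_eq_residue[OF x k])
    fix m assume m: "m \<in> {1..N}" "lead x (int m) = x k" "x k + s \<le> N"
    show "m + s \<le> N"
    proof (rule ccontr)
      assume straddle: "\<not> m + s \<le> N"
      have "lead x (int m) = lead x (int (x k))" using m lead_parking[OF x k] by simp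
      then have "m < x k + e" using short(1) m(1) xk by (simp add: short_def)
      have "lead x (int (m + s - N) - int s) = lead x (int m)"
        by (rule lead_cong) (use straddle in \<open>simp add: of_nat_diff\<close>)
      then have "lead ((rho ^^ s) x) (int (m + s - N)) = lead ((rho ^^ s) x) (int (x k + s))"
        using lead_funpow_rho_eq_iff[OF x, of s "int (m + s - N)" "int (x k + s)"]
          \<open>lead x (int m) = lead x (int (x k))\<close> by simp
      moreover have "m + s - N \<in> {1..N}" "x k + s \<in> {1..N}" using m straddle xk s by auto
      ultimately have "x k + s < m + s - N + e" using short(2) unfolding short_def by blast
      then show False using \<open>m < x k + e\<close> e straddle by linarith
    qed
  qed (use s in simp)
  then show "(rho ^^ s) x k = tau s x k" using k xk by (simp add: tau_def shift_def)
qed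

subsection \<open>Framings\<close>

definition poscount :: "(nat \<Rightarrow> nat) \<Rightarrow> nat \<Rightarrow> nat" where
  "poscount y m = card {k\<in>{1..a}. 0 < y k \<and> y k \<le> m}"

lemma poscount_0 [simp]: "poscount y 0 = 0"
proof -
  have "{k\<in>{1..a}. 0 < y k \<and> y k \<le> 0} = {}" by auto
  then show ?thesis by (simp add: poscount_def)
qed

lemma poscount_mono: "m \<le> n \<Longrightarrow> poscount y m \<le> poscount y n"
  unfolding poscount_def by (rule card_mono) auto

text \<open>A cyclic shift by s modulo M brings the values above M - s to the front. Up to position
  s only these are counted; from s on, all of them together with the positive values up to m - s.
  The modulus is general because \<open>tau\<close> needs N and \<open>turn\<close> needs b.\<close>

lemma poscount_wrap:
  assumes y: "\<And>k. k \<in> {1..a} \<Longrightarrow> y k \<le> M" and s: "s \<le> M"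
    and z: "\<And>k. k \<in> {1..a} \<Longrightarrow>
      z k = (if y k = 0 then 0 else if y k + s \<le> M then y k + s else y k + s - M)"
  shows poscount_wrap_low: "m \<le> s \<Longrightarrow> poscount z m + poscount y (M - s) = poscount y (M - s + m)"
    and poscount_wrap_high:
      "s \<le> m \<Longrightarrow> m \<le> M \<Longrightarrow> poscount z m + poscount y (M - s) = poscount y M + poscount y (m - s)"
proof -
  assume m: "m \<le> s"
  have "{k\<in>{1..a}. 0 < y k \<and> y k \<le> M - s + m} =
      {k\<in>{1..a}. 0 < z k \<and> z k \<le> m} \<union> {k\<in>{1..a}. 0 < y k \<and> y k \<le> M - s}"
    (is "?A = ?B \<union> ?C")
  proof (rule Set.set_eqI)
    fix k show "k \<in> ?A \<longleftrightarrow> k \<in> ?B \<union> ?C"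
      by (cases "k \<in> {1..a}") (use y[of k] z[of k] m s in \<open>auto split: if_splits\<close>)
  qed
  moreover have "?B \<inter> ?C = {}" using z m s by (auto split: if_splits)
  ultimately show "poscount z m + poscount y (M - s) = poscount y (M - s + m)"
    unfolding poscount_def by (simp add: card_Un_disjoint)
next
  assume m: "s \<le> m" "m \<le> M"
  have "{k\<in>{1..a}. 0 < z k \<and> z k \<le> m} =
      {k\<in>{1..a}. M - s < y k} \<union> {k\<in>{1..a}. 0 < y k \<and> y k \<le> m - s}"
    (is "?A = ?B \<union> ?C")
  proof (rule Set.set_eqI)
    fix k show "k \<in> ?A \<longleftrightarrow> k \<in> ?B \<union> ?C"
      by (cases "k \<in> {1..a}") (use y[of k] z[of k] m s in \<open>auto split: if_splits\<close>)
  qed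
  moreover have "?B \<inter> ?C = {}" using m s by auto
  ultimately have 1: "poscount z m = card ?B + poscount y (m - s)"
    unfolding poscount_def by (simp add: card_Un_disjoint)
  have "{k\<in>{1..a}. 0 < y k \<and> y k \<le> M} = ?B \<union> {k\<in>{1..a}. 0 < y k \<and> y k \<le> M - s}"
    using y by auto
  moreover have "?B \<inter> {k\<in>{1..a}. 0 < y k \<and> y k \<le> M - s} = {}" by auto
  ultimately have "poscount y M = card ?B + poscount y (M - s)"
    unfolding poscount_def by (simp add: card_Un_disjoint)
  with 1 show "poscount z m + poscount y (M - s) = poscount y M + poscount y (m - s)" by simp
qed

lemma ht_eq_poscount: "(\<And>k. k \<in> {1..a} \<Longrightarrow> 0 < x k) \<Longrightarrow> ht x m = poscount x m"
  unfolding ht_def poscount_def by (rule arg_cong[where f = card]) auto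

lemma card_zeros_poscount:
  assumes "\<And>k. k \<in> {1..a} \<Longrightarrow> y k \<le> M"
  shows "card {k\<in>{1..a}. y k = 0} + poscount y M = a"
proof -
  have "card ({k\<in>{1..a}. y k = 0} \<union> {k\<in>{1..a}. 0 < y k \<and> y k \<le> M}) = card {1..a}"
    by (rule arg_cong[where f = card]) (use assms in auto)
  then have "a = card ({k\<in>{1..a}. y k = 0} \<union> {k\<in>{1..a}. 0 < y k \<and> y k \<le> M})"
    unfolding card_atLeastAtMost by simp
  also have "\<dots> = card {k\<in>{1..a}. y k = 0} + poscount y M"
    unfolding poscount_def by (rule card_Un_disjoint) auto
  finally show ?thesis by simp
qed

lemma ht_fill:
  assumes "0 < m"
  shows "ht (fill y) m = card {k\<in>{1..a}. y k = 0} + poscount y m"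
proof -
  have "{k\<in>{1..a}. fill y k \<le> m} = {k\<in>{1..a}. y k = 0} \<union> {k\<in>{1..a}. 0 < y k \<and> y k \<le> m}"
    using assms by (auto simp: fill_def)
  moreover have "{k\<in>{1..a}. y k = 0} \<inter> {k\<in>{1..a}. 0 < y k \<and> y k \<le> m} = {}" by auto
  ultimately show ?thesis unfolding ht_def poscount_def by (simp add: card_Un_disjoint)
qed

lemma tau_eq:
  assumes "y \<in> {1..a} \<rightarrow>\<^sub>E {0..N}" "s \<le> N" "k \<in> {1..a}"
  shows "tau s y k = (if y k = 0 then 0 else if y k + s \<le> N then y k + s else y k + s - N)"
proof -
  have "y k \<le> N" using assms by (auto dest: PiE_mem)
  then show ?thesis using shift_eq[of "y k" s] assms by (simp add: tau_def)
qed

lemma zeros_tau: "{k\<in>{1..a}. tau s y k = 0} = {k\<in>{1..a}. y k = 0}"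
  by (auto simp: tau_def)

text \<open>If 0 marks the block containing 1, no second block may have minimum 1; otherwise
  \<open>fill\<close> would merge two values and \<open>unfill\<close> could not recover y.\<close>

definition framed :: "(nat \<Rightarrow> nat) set" where
  "framed = {y \<in> {1..a} \<rightarrow>\<^sub>E {0..N}. (0 \<in> y ` {1..a} \<longrightarrow> 1 \<notin> y ` {1..a}) \<and> fill y \<in> parking}"

text \<open>The shift takes t = N + 1 - s to 1, a value that \<open>tau s y\<close> does not have,
  so no vertical run precedes t. Comparing heights across the cut, the excess of
  \<open>fill (tau s y)\<close> at p + s is the excess of \<open>fill y\<close> at p minus that at
  t. Its positivity for 0 < p < t makes 0 the parent of t.\<close>

lemma framed_lead:
  assumes y: "y \<in> framed" "0 \<in> y ` {1..a}" and z: "tau s y \<in> framed" and s: "0 < s" "s < N"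
  shows "lead (fill y) (1 - int s) = lead (fill y) 1"
proof -
  let ?x = "fill y" and ?z = "tau s y" and ?H = "poscount y"
  define n0 where "n0 = card {k\<in>{1..a}. y k = 0}"
  define t where "t = N + 1 - s"
  have yr: "y \<in> {1..a} \<rightarrow>\<^sub>E {0..N}" and x: "?x \<in> parking" and zp: "fill ?z \<in> parking"
    using y z by (auto simp: framed_def)
  have y_le: "y k \<le> N" if "k \<in> {1..a}" for k using that yr by (auto dest: PiE_mem)
  interpret path_heights a b N "ht ?x" by (rule path_heights_ht[OF x])
  interpret z: path_heights a b N "ht (fill ?z)" by (rule path_heights_ht[OF zp])
  have "0 \<in> ?z ` {1..a}" using y(2) zero_in_tau_iff by simp
  then have "1 \<notin> ?z ` {1..a}" using z by (simp add: framed_def)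
  have "poscount ?z 1 = 0"
  proof -
    have "?z k \<noteq> 1" if "k \<in> {1..a}" for k using \<open>1 \<notin> ?z ` {1..a}\<close> that by (metis imageI)
    then have "{k\<in>{1..a}. 0 < ?z k \<and> ?z k \<le> 1} = {}" by force
    then show ?thesis by (simp add: poscount_def)
  qed
  then have Ht: "?H t = ?H (N - s)"
    using poscount_wrap_low[of y N s ?z 1] y_le tau_eq[OF yr] s by (simp add: t_def Suc_diff_le)
  have htx: "ht ?x m = n0 + ?H m" if "0 < m" for m using ht_fill[OF that] by (simp add: n0_def)
  have "parent (ht ?x) t = 0"
  proof (rule parent_eqI)
    show "0 < t" "t \<le> N" using s by (auto simp: t_def)
    then show "excess (ht ?x) 0 < excess (ht ?x) t" using excess_pos by simp
    fix p assume p: "0 < p" "p < t"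
    then have ps: "p + s \<le> N" by (simp add: t_def)
    have "poscount ?z (p + s) + ?H (N - s) = ?H N + ?H p"
      using poscount_wrap_high[of y N s ?z "p + s"] y_le tau_eq[OF yr] s ps by simp
    moreover have "n0 + ?H N = a" using card_zeros_poscount[OF y_le] by (simp add: n0_def)
    moreover have "ht (fill ?z) (p + s) = n0 + poscount ?z (p + s)"
      using ht_fill[of "p + s" ?z] p zeros_tau by (simp add: n0_def)
    ultimately have "ht (fill ?z) (p + s) + ht ?x t = a + ht ?x p"
      using Ht htx p \<open>0 < t\<close> by simp
    then have e1: "int (ht (fill ?z) (p + s)) = int a + int (ht ?x p) - int (ht ?x t)" by linarith
    \<comment> \<open>Since b = N + 1, the shift s equals b - t; so the summand a of the height and
      the summand b of the abscissa cancel in the excess.\<close>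
    have e2: "int (p + s) = int p + int b - int t" using s b_eq by (simp add: t_def of_nat_diff)
    have "excess (ht (fill ?z)) (p + s) = excess (ht ?x) p - excess (ht ?x) t"
      unfolding excess_def e1 e2 by (simp add: algebra_simps)
    then show "excess (ht ?x) t < excess (ht ?x) p"
      using z.excess_pos[of "p + s"] ps p by simp
  qed
  moreover have "residue (1 - int s) = t"
    by (rule residue_eqI) (use s in \<open>auto simp: t_def of_nat_diff\<close>)
  moreover have "residue 1 = 1" using residue_of_nat[of 1] N_pos by simp
  ultimately show ?thesis by (simp add: lead_def leader_def[of _ t])
qed

text \<open>The excess of \<open>tau s x\<close> at n is the excess of x at N - s + n minus that at
  N - s. Its positivity makes N - s a candidate for the parent of every later label, so no block
  reaches across the cut.\<close>

lemma cut_leader: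
  assumes x: "x \<in> parking" and z: "tau s x \<in> parking" and s: "0 < s" "s < N"
    and m: "m \<le> N" "N - s < m"
  shows "N - s < leader (ht x) m"
proof -
  interpret path_heights a b N "ht x" by (rule path_heights_ht[OF x])
  interpret z: path_heights a b N "ht (tau s x)" by (rule path_heights_ht[OF z])
  have xr: "x \<in> {1..a} \<rightarrow>\<^sub>E {0..N}" using x by (auto simp: parking_def PiE_iff)
  have pos: "0 < x k" "x k \<le> N" "0 < tau s x k" if "k \<in> {1..a}" for k
    using parking_in[OF x that] parking_in[OF z that] by auto
  define n where "n = m - (N - s)"
  have mn: "m = N - s + n" using m by (simp add: n_def)
  have n: "n \<le> s" "0 < n" using m s by (auto simp: n_def)
  have "poscount (tau s x) n + poscount x (N - s) = poscount x m"
    using poscount_wrap_low[of x N s "tau s x" n] pos tau_eq[OF xr] s n mn by simp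
  then have "ht (tau s x) n + ht x (N - s) = ht x m"
    using ht_eq_poscount[of x] ht_eq_poscount[of "tau s x"] pos by simp
  then have e1: "int (ht (tau s x) n) = int (ht x m) - int (ht x (N - s))" by linarith
  have e2: "int n = int m - int (N - s)" using mn by simp
  have "excess (ht (tau s x)) n = excess (ht x) m - excess (ht x) (N - s)"
    unfolding excess_def e1 e2 by (simp add: algebra_simps)
  then have less: "excess (ht x) (N - s) < excess (ht x) m"
    using z.excess_pos[of n] n s by simp
  have m0: "0 < m" using m by simp
  have "\<not> parent (ht x) m < N - s"
    using excess_after_parent[OF m0 m(1), of "N - s"] less m by linarith
  then show ?thesis by (simp add: leader_def)
qed

text \<open>With a marked block, \<open>framed_lead\<close> puts the preimage of 1 into it; without
  one, \<open>cut_leader\<close> shows that no block straddles the cut. Either way the rotation is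
  the plain shift on the unmarked minima. Both operations have period N, so s may be reduced modulo
  N.\<close>

lemma funpow_rho_fill:
  assumes y: "y \<in> framed" and z: "tau s y \<in> framed"
  shows "(rho ^^ s) (fill y) = fill (tau s y)"
proof -
  have yr: "y \<in> {1..a} \<rightarrow>\<^sub>E {0..N}" and x: "fill y \<in> parking" using y by (auto simp: framed_def)
  have small: "(rho ^^ s) (fill y) = fill (tau s y)" if z: "tau s y \<in> framed" and s: "s < N" for s
  proof (cases "s = 0")
    case True
    then show ?thesis using tau_N_mult[OF yr, of 0] by simp
  next
    case False
    show ?thesis
    proof (cases "0 \<in> y ` {1..a}")
      case True
      then have "unfill (fill y) = y" using unfill_fill[OF yr] y by (simp add: framed_def)
      then show ?thesis
        using funpow_rho_central[OF x, of s] framed_lead[OF y True z] False s by simp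
    next
      case no_zero: False
      have fy: "fill y = y" using fill_nonzero[OF yr no_zero] .
      have "0 \<notin> tau s y ` {1..a}" using no_zero zero_in_tau_iff by simp
      then have fz: "fill (tau s y) = tau s y" using fill_nonzero[OF tau_range] by blast
      have yp: "y \<in> parking" and zp: "tau s y \<in> parking" using x z fy fz by (auto simp: framed_def)
      have "(rho ^^ s) y = tau s y"
      proof (rule extensionalityI[of _ "{1..a}"])
        show "(rho ^^ s) y \<in> extensional {1..a}" by (intro parking_extensional funpow_rho_parking yp)
        show "tau s y \<in> extensional {1..a}" by (simp add: tau_def)
        fix k assume k: "k \<in> {1..a}"
        have "(rho ^^ s) y k = residue (int (y k) + int s)"
        proof (rule funpow_rho_eq_residue[OF yp k])
          fix m assume m: "m \<in> {1..N}" "lead y (int m) = y k" "y k + s \<le> N"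
          then show "m + s \<le> N"
            using cut_leader[OF yp zp, of m] False s lead_of_nat[of m y] by force
        qed (use s in simp)
        then show "(rho ^^ s) y k = tau s y k"
          using k parking_in[OF yp k] by (simp add: tau_def shift_def)
      qed
      then show ?thesis using fy fz by simp
    qed
  qed
  have "tau s y = tau (s mod N) (tau (N * (s div N)) y)"
    by (simp add: tau_tau add.commute)
  then have eq: "tau s y = tau (s mod N) y" using tau_N_mult[OF yr] by simp
  have "(rho ^^ s) (fill y) = (rho ^^ (s mod N)) (fill y)"
    using funpow_mod_eq[OF funpow_rho_N[OF x], of s] by simp
  then show ?thesis using small[of "s mod N"] z eq N_pos by simp
qed

lemma obtain_argmin:
  fixes f :: "nat \<Rightarrow> int"
  assumes "finite S" "S \<noteq> {}"
  obtains m where "m \<in> S" "\<And>n. n \<in> S \<Longrightarrow> f m \<le> f n"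
  using arg_min_if_finite[OF assms, of f] arg_min_least[OF assms, of _ f] by blast

text \<open>A cycle lemma argument: C is the excess of the walk that ignores zeros, and the cut is
  placed by a minimum of C. The total increment C N = a - b * n0 is positive without zeros and
  negative with them, so the two cases need different cuts.\<close>

lemma ex_framed:
  assumes yr: "y \<in> {1..a} \<rightarrow>\<^sub>E {0..N}"
  shows "\<exists>t\<le>N. tau t y \<in> framed"
proof -
  let ?H = "poscount y"
  define n0 where "n0 = card {k\<in>{1..a}. y k = 0}"
  define C where "C m = int b * int (?H m) - int a * int m" for m
  have y_le: "y k \<le> N" if "k \<in> {1..a}" for k using that yr by (auto dest: PiE_mem)
  have total: "n0 + ?H N = a" using card_zeros_poscount[OF y_le] by (simp add: n0_def)
  have bN: "int b = int N + 1" using b_eq by simp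
  have C0: "C 0 = 0" by (simp add: C_def)
  have HN: "int (?H N) = int a - int n0" using total by linarith
  have CN: "C N = int a - int b * int n0"
    unfolding C_def HN bN by (simp add: algebra_simps)
  \<comment> \<open>The zeros add n0 to every height of \<open>fill (tau s y)\<close> at a positive
    position. The assumptions \<open>low\<close> and \<open>high\<close> are the Dyck inequalities
    at positions up to s and beyond s, expressed through C.\<close>
  have parkingI: "fill (tau s y) \<in> parking"
    if s: "s \<le> N" and low: "\<And>m. 0 < m \<Longrightarrow> m \<le> s \<Longrightarrow> 0 \<le> int b * int n0 + C (N - s + m) - C (N - s)"
      and high: "\<And>m. 0 < m \<Longrightarrow> m \<le> N - s \<Longrightarrow> 0 \<le> int a + C m - C (N - s)" for s
  proof -
    have "fill (tau s y) \<in> {1..a} \<rightarrow>\<^sub>E {1..N}"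
      using N_pos by (auto simp: fill_def tau_def shift_le Suc_le_eq)
    moreover have "a * m \<le> b * ht (fill (tau s y)) m" if m: "m \<le> N" for m
    proof (cases "m = 0")
      case False
      have h: "ht (fill (tau s y)) m = n0 + poscount (tau s y) m"
        using ht_fill[of m "tau s y"] False zeros_tau by (simp add: n0_def)
      have "int (a * m) \<le> int (b * ht (fill (tau s y)) m)"
      proof (cases "m \<le> s")
        case True
        have "poscount (tau s y) m + ?H (N - s) = ?H (N - s + m)"
          using poscount_wrap_low[of y N s "tau s y" m] y_le s tau_eq[OF yr s] True by simp
        then have e: "int (n0 + poscount (tau s y) m) = int n0 + int (?H (N - s + m)) - int (?H (N - s))"
          by linarith
        have "int b * int (n0 + poscount (tau s y) m) - int a * int m
            = int b * int n0 + C (N - s + m) - C (N - s)"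
          unfolding e C_def by (simp add: algebra_simps)
        then show ?thesis using low[of m] False True unfolding h of_nat_mult by linarith
      next
        case 2: False
        have "poscount (tau s y) m + ?H (N - s) = ?H N + ?H (m - s)"
          using poscount_wrap_high[of y N s "tau s y" m] y_le s tau_eq[OF yr s] 2 m by simp
        then have e: "int (n0 + poscount (tau s y) m) = int a + int (?H (m - s)) - int (?H (N - s))"
          using total by linarith
        have "int b * int (n0 + poscount (tau s y) m) - int a * int m
            = int a * (int b - int m + int (m - s) - int (N - s)) + C (m - s) - C (N - s)"
          unfolding e C_def by (simp add: algebra_simps)
        also have "int b - int m + int (m - s) - int (N - s) = 1"
          using 2 s m bN by (simp add: of_nat_diff)
        finally have "int b * int (n0 + poscount (tau s y) m) - int a * int m
            = int a + C (m - s) - C (N - s)" by simp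
        moreover have "0 < m - s" "m - s \<le> N - s" using 2 m by auto
        ultimately show ?thesis using high[of "m - s"] unfolding h of_nat_mult by linarith
      qed
      then show ?thesis by (simp only: of_nat_le_iff)
    qed simp
    ultimately show ?thesis by (simp add: parking_def)
  qed
  show ?thesis
  proof (cases "0 \<in> y ` {1..a}")
    case False
    then have "{k\<in>{1..a}. y k = 0} = {}" by auto
    then have n0: "n0 = 0" by (simp add: n0_def)
    obtain q where q: "q \<in> {..<N}" and min: "\<And>n. n \<in> {..<N} \<Longrightarrow> C q \<le> C n"
      using obtain_argmin[of "{..<N}" C] N_pos by auto
    define s where "s = N - q"
    have s: "s \<le> N" "N - s = q" using q by (auto simp: s_def)
    have "C q \<le> C N" using min[of 0] N_pos CN C0 n0 by simp
    then have "C q \<le> C m" if "m \<le> N" for m using min[of m] that by (cases "m = N") auto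
    then have "fill (tau s y) \<in> parking"
      by (intro parkingI) (use s n0 q in \<open>auto simp: add_increasing\<close>)
    moreover have "0 \<notin> tau s y ` {1..a}" using False zero_in_tau_iff by simp
    ultimately show ?thesis using s(1) tau_range by (auto simp: framed_def)
  next
    case True
    then have "{k\<in>{1..a}. y k = 0} \<noteq> {}" by auto
    then have n0: "1 \<le> n0" using card_gt_0_iff[of "{k\<in>{1..a}. y k = 0}"] by (simp add: n0_def Suc_le_eq)
    then have "int b * 1 \<le> int b * int n0" by (intro mult_left_mono) auto
    then have bn0: "int a < int b * int n0" using a_less by linarith
    \<comment> \<open>With zeros the minimum itself must be taken to position 1, so the cut is at q
      = t - 1. Minimality forbids a rise of C at t, hence no value equals t and after the shift no
      value equals 1.\<close>
    obtain t where t: "t \<in> {1..N}" and min: "\<And>n. n \<in> {1..N} \<Longrightarrow> C t \<le> C n"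
      using obtain_argmin[of "{1..N}" C] N_pos by auto
    obtain q where q: "t = Suc q" using t by (cases t) auto
    have C_t: "C t = C q + int b * (int (?H t) - int (?H q)) - int a"
      by (simp add: C_def q algebra_simps)
    have "?H q \<le> ?H t" by (rule poscount_mono) (simp add: q)
    have "?H t = ?H q"
    proof (rule ccontr)
      assume "?H t \<noteq> ?H q"
      then have "1 \<le> int (?H t) - int (?H q)" using \<open>?H q \<le> ?H t\<close> by linarith
      then have "int b * 1 \<le> int b * (int (?H t) - int (?H q))" by (intro mult_left_mono) auto
      then have "C q < C t" unfolding C_t using a_less by linarith
      moreover have "C t \<le> C q" if "q \<noteq> 0" using min[of q] that t q by simp
      ultimately have "q = 0" by linarith
      \<comment> \<open>For q = 0 minimality over {1..N} says nothing about C 0, but C N < 0 = C 0 <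
        C t contradicts it at N.\<close>
      then show False using min[of N] \<open>C q < C t\<close> C0 CN bn0 N_pos by simp
    qed
    then have Cq: "C q = C t + int a" unfolding C_t by simp
    define s where "s = N - q"
    have s: "s \<le> N" "N - s = q" "0 < s" using q t by (auto simp: s_def)
    have "fill (tau s y) \<in> parking"
    proof (rule parkingI)
      fix m assume m: "0 < m" "m \<le> s"
      then have "C t \<le> C (N - s + m)" using s by (intro min) auto
      then show "0 \<le> int b * int n0 + C (N - s + m) - C (N - s)" using Cq s bn0 by simp
    next
      fix m assume m: "0 < m" "m \<le> N - s"
      then have "C t \<le> C m" using s by (intro min) auto
      then show "0 \<le> int a + C m - C (N - s)" using Cq s by simp
    qed (rule s)
    moreover have "1 \<notin> tau s y ` {1..a}"
    proof
      assume "1 \<in> tau s y ` {1..a}"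
      then obtain k where "k \<in> {1..a}" "tau s y k = 1" by auto
      then have "{k\<in>{1..a}. 0 < tau s y k \<and> tau s y k \<le> 1} \<noteq> {}" by auto
      then have "0 < poscount (tau s y) 1" unfolding poscount_def by (simp add: card_gt_0_iff)
      moreover have "poscount (tau s y) 1 + ?H q = ?H t"
        using poscount_wrap_low[of y N s "tau s y" 1] y_le tau_eq[OF yr s(1)] s q by simp
      ultimately show False using \<open>?H t = ?H q\<close> by simp
    qed
    ultimately show ?thesis using s(1) tau_range by (auto simp: framed_def)
  qed
qed

subsection \<open>The centre of a rotation-invariant parking function\<close>

text \<open>Within {1..N} a label and its cyclic translate by e have distance e or N - e, and both
  are at least e.\<close>

lemma short_not_central:
  assumes "short e x" "0 < e" "2 * e \<le> N"
  shows "lead x t \<noteq> lead x (t + int e)"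
proof
  assume eq: "lead x t = lead x (t + int e)"
  define i where "i = residue t"
  define j where "j = residue (t + int e)"
  have ij: "i \<in> {1..N}" "j \<in> {1..N}" unfolding i_def j_def by (rule residue_range)+
  have "lead x (int i) = lead x (int j)"
    using eq residue_of_nat[OF ij(1)] residue_of_nat[OF ij(2)] by (simp add: lead_def i_def j_def)
  then have near: "j < i + e" "i < j + e" using assms(1) ij by (auto simp: short_def)
  have "j = residue (int i + int e)" unfolding i_def j_def by (simp add: residue_add_left)
  also have "\<dots> = (if i + e \<le> N then i + e else i + e - N)"
    using ij assms by (auto simp: of_nat_diff intro!: residue_eqI)
  finally show False using near assms by (auto split: if_splits)
qed

lemma central_iterate:
  assumes per: "\<And>i j. lead x (i + int e) = lead x (j + int e) \<longleftrightarrow> lead x i = lead x j"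
    and s: "lead x s = lead x (s + int e)"
  shows "lead x s = lead x (s + int e * int n)"
proof (induction n)
  case (Suc n)
  have "lead x (s + int e * int (Suc n)) = lead x ((s + int e * int n) + int e)"
    by (simp add: algebra_simps)
  also have "\<dots> = lead x (s + int e)" using per[of "s + int e * int n" s] Suc by simp
  finally show ?case using s by simp
qed simp

text \<open>Moving along multiples of N and of e brings the two points to s' \<le> t' < s' + e.
  Unless they coincide, s' < t' < s' + e < t' + e interleave, and the absence of crossings
  identifies their blocks.\<close>

lemma central_unique:
  assumes x: "x \<in> parking" and e: "0 < e" "2 * e \<le> N"
    and per: "\<And>i j. lead x (i + int e) = lead x (j + int e) \<longleftrightarrow> lead x i = lead x j"
    and s: "lead x s = lead x (s + int e)" and t: "lead x t = lead x (t + int e)"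
  shows "lead x s = lead x t"
proof -
  note iterate = central_iterate[where x = x, OF per s]
  \<comment> \<open>The multiple of N leaves the residue of t unchanged and makes the difference
    nonnegative, so that its quotient by e can serve as an iteration count.\<close>
  define n where "n = (t - s + int N * \<bar>t - s\<bar>) div int e"
  define r where "r = (t - s + int N * \<bar>t - s\<bar>) mod int e"
  have "\<bar>t - s\<bar> \<le> int N * \<bar>t - s\<bar>" using N_pos by (simp add: mult_le_cancel_right1)
  then have "0 \<le> n" using e unfolding n_def by (intro div_int_pos_iff[THEN iffD2]) auto
  define s' where "s' = s + int e * n"
  define t' where "t' = t + int N * \<bar>t - s\<bar>"
  have "t - s + int N * \<bar>t - s\<bar> = int e * n + r" unfolding n_def r_def by simp
  then have t': "t' = s' + r" unfolding s'_def t'_def by linarith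
  have r: "0 \<le> r" "r < int e" using e by (auto simp: r_def)
  have s': "lead x s = lead x s'" using iterate[of "nat n"] \<open>0 \<le> n\<close> by (simp add: s'_def)
  have s'e: "lead x s' = lead x (s' + int e)" using per s s' iterate[of "Suc (nat n)"] \<open>0 \<le> n\<close>
    by (simp add: s'_def algebra_simps)
  have tt': "lead x t' = lead x t" "lead x (t' + int e) = lead x (t + int e)"
    by (rule lead_cong; simp add: t'_def)+
  have "lead x s' = lead x t'"
  proof (cases "r = 0")
    case False
    then show ?thesis
      using lead_noncrossing[OF x, of s' t' "s' + int e" "t' + int e"] s'e tt' t t' r e by auto
  qed (use t' in simp)
  then show ?thesis using s' tt' by simp
qed

text \<open>A cut at the start of a longest related pair at distance less than \<open>e\<close> separates no other such pair:
  a pair straddling it would, with its translate by \<open>e\<close>, contradict the absence of crossings.\<close>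

lemma centre_exists:
  assumes x: "x \<in> parking" and e: "0 < e" "2 * e \<le> N"
    and per: "\<And>i j. lead x (i + int e) = lead x (j + int e) \<longleftrightarrow> lead x i = lead x j"
    and no_central: "\<And>t. lead x t \<noteq> lead x (t + int e)"
  obtains t where "\<And>i j. t \<le> i \<Longrightarrow> i \<le> j \<Longrightarrow> j < t + int N \<Longrightarrow> lead x i = lead x j \<Longrightarrow> j < i + int e"
proof -
  \<comment> \<open>Related labels whose cyclic distance exceeds e would cross their translates by
    e; distance exactly e is ruled out by \<open>no_central\<close>.\<close>
  have near: "j - i < int e \<or> int N - int e < j - i"
    if ij: "i < j" "j < i + int N" "lead x i = lead x j" for i j
  proof (rule ccontr)
    assume far: "\<not> ?thesis"
    have "j \<noteq> i + int e" using no_central[of i] ij(3) by auto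
    moreover have "j - i \<noteq> int N - int e"
    proof
      assume "j - i = int N - int e"
      then have "lead x (j + int e) = lead x i" by (intro lead_cong) (simp add: algebra_simps)
      then show False using no_central[of j] ij(3) by simp
    qed
    ultimately have "lead x i = lead x (i + int e)"
      using lead_noncrossing[OF x, of i "i + int e" j "j + int e"] per[of i j] ij e far by auto
    then show False using no_central by simp
  qed
  define L where "L = {n. n < e \<and> (\<exists>i. lead x i = lead x (i + int n))}"
  have finL: "finite L" by (simp add: L_def)
  have "0 \<in> L" using e by (simp add: L_def)
  then have "Max L \<in> L" using finL Max_in by blast
  then obtain t where len: "Max L < e" and t: "lead x t = lead x (t + int (Max L))"
    by (auto simp: L_def)
  define u where "u = t + int (Max L)"
  have tu: "lead x t = lead x u" "t \<le> u" "u - t < int e" using t len by (auto simp: u_def)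
  have maximal: "j - i \<le> u - t" if "i \<le> j" "j - i < int e" "lead x i = lead x j" for i j
  proof -
    have "nat (j - i) \<in> L" using that by (auto simp: L_def intro!: exI[of _ i])
    then have "nat (j - i) \<le> Max L" using finL by simp
    then show ?thesis using that by (simp add: u_def)
  qed
  have clean: "lead x i \<noteq> lead x j" if ij: "i < t" "t \<le> j" "j < i + int e" for i j
  proof
    assume eq: "lead x i = lead x j"
    have "lead x i = lead x t" "j < u"
    proof -
      have len_ij: "j - i \<le> u - t" using maximal[of i j] ij eq by simp
      then show "j < u" using ij by simp
      show "lead x i = lead x t"
      proof (cases "j = t")
        case False
        then show ?thesis
          using lead_noncrossing[OF x, of i t j u] ij \<open>j < u\<close> eq tu e by auto
      qed (use eq in simp)
    qed
    then have "t < u" "t - i < int e" using ij by auto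
    have iu: "lead x i = lead x u" using \<open>lead x i = lead x t\<close> tu by simp
    \<comment> \<open>The related pair i, u is longer than the maximal length u - t among pairs at
      distance below e.\<close>
    have "int e \<le> u - i"
    proof (rule ccontr)
      assume "\<not> int e \<le> u - i"
      then show False using maximal[of i u] iu ij tu by simp
    qed
    moreover have "u \<noteq> i + int e" using no_central[of i] iu by auto
    ultimately have "i + int e < u" by simp
    have "lead x (i + int e) = lead x (t + int e)" using per \<open>lead x i = lead x t\<close> by simp
    then have "lead x t = lead x (i + int e)"
      using lead_noncrossing[OF x, of t "i + int e" u "t + int e"] tu \<open>i + int e < u\<close> ij
        \<open>t - i < int e\<close> e by auto
    then show False using \<open>lead x (i + int e) = lead x (t + int e)\<close> no_central[of t] by simp
  qed
  show thesis
  proof (rule that[of t])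
    fix i j assume ij: "t \<le> i" "i \<le> j" "j < t + int N" "lead x i = lead x j"
    show "j < i + int e"
    proof (rule ccontr)
      assume "\<not> j < i + int e"
      \<comment> \<open>Moving j back by N turns such a long pair into one at distance below e that
        straddles the cut.\<close>
      then have "int N - int e < j - i" using near[of i j] ij e by auto
      moreover have "lead x (j - int N) = lead x j" by (rule lead_cong) simp
      ultimately show False using clean[of "j - int N" i] ij by auto
    qed
  qed
qed

text \<open>By \<open>funpow_rho_fill\<close> the result does not depend on the frame chosen.\<close>

definition cut :: "(nat \<Rightarrow> nat) \<Rightarrow> nat \<Rightarrow> nat" where
  "cut y = (let t = SOME t. t \<le> N \<and> tau t y \<in> framed in (rho ^^ (N - t)) (fill (tau t y)))"

lemma funpow_rho_inj:
  assumes "x \<in> parking" "y \<in> parking" "(rho ^^ s) x = (rho ^^ s) y"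
  shows "x = y"
proof -
  have "(rho ^^ (N * s - s)) ((rho ^^ s) x) = x" if "x \<in> parking" for x
  proof -
    have "(rho ^^ (N * s - s)) ((rho ^^ s) x) = (rho ^^ (N * s)) x"
      using N_pos by (simp add: funpow_add[symmetric, unfolded comp_def, THEN fun_cong])
    also have "\<dots> = x" using funpow_mod_eq[OF funpow_rho_N[OF that], of "N * s"] by simp
    finally show ?thesis .
  qed
  then show ?thesis using assms by metis
qed

lemma cut_spec:
  assumes yr: "y \<in> {1..a} \<rightarrow>\<^sub>E {0..N}"
  shows cut_parking: "cut y \<in> parking"
    and funpow_rho_cut: "tau t y \<in> framed \<Longrightarrow> (rho ^^ t) (cut y) = fill (tau t y)"
proof -
  define s where "s = (SOME t. t \<le> N \<and> tau t y \<in> framed)"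
  have s: "s \<le> N" "tau s y \<in> framed"
    using someI_ex[OF ex_framed[OF yr, unfolded Bex_def]] unfolding s_def by auto
  have cut: "cut y = (rho ^^ (N - s)) (fill (tau s y))" by (simp add: cut_def s_def Let_def)
  then show "cut y \<in> parking" using s by (simp add: funpow_rho_parking framed_def)
  assume t: "tau t y \<in> framed"
  have "tau (t + (N - s)) (tau s y) = tau t (tau N y)" using s by (simp add: tau_tau)
  then have eq: "tau (t + (N - s)) (tau s y) = tau t y" using tau_N_mult[OF yr] by simp
  have "(rho ^^ t) (cut y) = (rho ^^ (t + (N - s))) (fill (tau s y))" by (simp add: cut funpow_add)
  also have "\<dots> = fill (tau t y)" using funpow_rho_fill[OF s(2), of "t + (N - s)"] eq t by simp
  finally show "(rho ^^ t) (cut y) = fill (tau t y)" .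
qed

text \<open>Rotated into a frame of \<open>tau s y\<close>, both sides become the same filled
  function, and \<open>rho\<close> is injective on parking functions.\<close>

lemma cut_tau:
  assumes yr: "y \<in> {1..a} \<rightarrow>\<^sub>E {0..N}"
  shows "cut (tau s y) = (rho ^^ s) (cut y)"
proof -
  obtain t where t: "tau t (tau s y) \<in> framed" using ex_framed[OF tau_range] by blast
  have "(rho ^^ t) (cut (tau s y)) = fill (tau t (tau s y))"
    using funpow_rho_cut[OF tau_range t] .
  also have "\<dots> = (rho ^^ (t + s)) (cut y)" using funpow_rho_cut[OF yr, of "t + s"] t tau_tau by simp
  also have "\<dots> = (rho ^^ t) ((rho ^^ s) (cut y))" by (simp add: funpow_add)
  finally show ?thesis
    using funpow_rho_inj[OF cut_parking[OF tau_range] funpow_rho_parking[OF cut_parking[OF yr]]] by blast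
qed

lemma framed_comp_perm:
  assumes w: "w permutes {1..a}" and y: "y \<in> framed"
  shows "y \<circ> w \<in> framed"
proof -
  have "(y \<circ> w) ` {1..a} = y ` {1..a}" unfolding image_comp[symmetric] permutes_image[OF w] ..
  then show ?thesis
    using y PiE_comp_perm[OF w, of y "{0..N}"] parking_comp_perm[OF w, of "fill y"]
    by (simp add: framed_def fill_comp_perm[OF w])
qed

lemma cut_comp_perm:
  assumes w: "w permutes {1..a}" and yr: "y \<in> {1..a} \<rightarrow>\<^sub>E {0..N}"
  shows "cut (y \<circ> w) = cut y \<circ> w"
proof -
  have yw: "y \<circ> w \<in> {1..a} \<rightarrow>\<^sub>E {0..N}" by (rule PiE_comp_perm[OF w yr])
  obtain t where t: "tau t y \<in> framed" using ex_framed[OF yr] by blast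
  have t': "tau t (y \<circ> w) = tau t y \<circ> w" by (rule tau_comp_perm[OF w])
  have "(rho ^^ t) (cut (y \<circ> w)) = fill (tau t y) \<circ> w"
    using funpow_rho_cut[OF yw, of t] framed_comp_perm[OF w t] t' fill_comp_perm[OF w] by simp
  also have "\<dots> = (rho ^^ t) (cut y \<circ> w)"
    using funpow_rho_cut[OF yr t] funpow_rho_comp_perm[OF w] by simp
  finally show ?thesis
    using funpow_rho_inj[OF cut_parking[OF yw] parking_comp_perm[OF w cut_parking[OF yr]]] by blast
qed

section \<open>Fixed parking functions of a nontrivial rotation\<close>

context
  fixes w :: "nat \<Rightarrow> nat" and d e :: nat
  assumes w: "w permutes {1..a}" and d: "\<not> N dvd d" and e_def: "e = gcd d N"
begin

text \<open>The steps e and d generate the same rotations. As N does not divide d, e is a proper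
  divisor of N and so at most N / 2; the crossing arguments rest on this bound.\<close>

lemma e_facts: "0 < e" "2 * e \<le> N" "e dvd N" "e dvd d"
proof -
  show "0 < e" "e dvd N" "e dvd d" using N_pos by (auto simp: e_def)
  have "e \<noteq> N" using d \<open>e dvd d\<close> by auto
  moreover obtain q where q: "N = e * q" using \<open>e dvd N\<close> by blast
  ultimately have "q \<noteq> 1" "q \<noteq> 0" using N_pos by auto
  then have "e * 2 \<le> e * q" by (intro mult_le_mono) auto
  then show "2 * e \<le> N" using q by simp
qed

lemma e_bezout: obtains n y where "d * n = N * y + e"
proof -
  have "d \<noteq> 0" using d dvd_0_right by metis
  from bezout_nat[OF this, of N] show thesis using that unfolding e_def by blast
qed

text \<open>Relabelling by w does not change the path, so the partition of a fixed x is invariant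
  under translation by d, hence by multiples of d, one of which is e modulo N.\<close>

lemma fixed_period:
  assumes x: "x \<in> parking" and fixed: "(rho ^^ d) x = x \<circ> w"
  shows "lead x (i + int e) = lead x (j + int e) \<longleftrightarrow> lead x i = lead x j"
proof -
  have "lead (x \<circ> w) = lead x" by (simp add: lead_def fun_eq_iff ht_comp_perm[OF w])
  then have per_d: "lead x (i + int d) = lead x (j + int d) \<longleftrightarrow> lead x i = lead x j" for i j
    using lead_funpow_rho_eq_iff[OF x, of d "i + int d" "j + int d"] fixed by simp
  have per_dn: "lead x (i + int (d * n)) = lead x (j + int (d * n)) \<longleftrightarrow> lead x i = lead x j" for i j n
  proof (induction n)
    case (Suc n)
    have step: "i + int (d * Suc n) = (i + int (d * n)) + int d" for i by (simp add: algebra_simps)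
    show ?case unfolding step using per_d Suc by simp
  qed simp
  obtain n y where n: "d * n = N * y + e" by (rule e_bezout)
  have "lead x (i + int (d * n)) = lead x (i + int e)" for i
    by (rule lead_cong) (simp add: n)
  then show ?thesis using per_dn[of i n j] by simp
qed

lemma framed_fixed:
  assumes u: "u \<in> framed" "u \<circ> w = tau d u"
  shows "(rho ^^ d) (fill u) = fill u \<circ> w"
  using funpow_rho_fill[OF u(1), of d] framed_comp_perm[OF w u(1)] u(2) fill_comp_perm[OF w, of u] by simp

text \<open>The labels with value 0 are permuted by w, so the rotation by d preserves the block of
  1. Iterating it and reducing modulo N gives the translate by e.\<close>

lemma framed_zero_central:
  assumes u: "u \<in> framed" "u \<circ> w = tau d u" and zero: "0 \<in> u ` {1..a}"
  shows "lead (fill u) 1 = lead (fill u) (1 + int e)"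
proof -
  let ?x = "fill u"
  have x: "?x \<in> parking" using u by (simp add: framed_def)
  interpret path_heights a b N "ht ?x" by (rule path_heights_ht[OF x])
  have fixed: "(rho ^^ d) ?x = ?x \<circ> w" by (rule framed_fixed[OF u])
  obtain k where k: "k \<in> {1..a}" "u k = 0" using zero by auto
  have wk: "w k \<in> {1..a}" using permutes_in_image[OF w] k by simp
  have "u (w k) = tau d u k" using u(2) by (metis comp_apply)
  then have "u (w k) = 0" using k by (simp add: tau_def)
  then have "?x k = 1" "?x (w k) = 1" using k wk by (auto simp: fill_def)
  have lead1: "lead ?x 1 = 1" using lead_of_nat[of 1 ?x] N_pos by simp
  have "lead (?x \<circ> w) = lead ?x" by (simp add: lead_def fun_eq_iff ht_comp_perm[OF w])
  then have d1: "lead ?x (1 + int d) = 1"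
    using lead_funpow_rho_eq_funpow_rho_iff[OF x k(1), of d "1 + int d"] fixed lead1
      \<open>?x k = 1\<close> \<open>?x (w k) = 1\<close> by simp
  have iter: "lead ?x (1 + int (d * n)) = 1" for n
  proof (induction n)
    case (Suc n)
    have "lead (?x \<circ> w) = lead ?x" by (simp add: lead_def fun_eq_iff ht_comp_perm[OF w])
    then have "lead ?x (1 + int (d * n) + int d) = lead ?x (1 + int d)"
      using lead_funpow_rho_eq_iff[OF x, of d "1 + int (d * n) + int d" "1 + int d"] fixed Suc lead1
      by simp
    moreover have step: "1 + int (d * Suc n) = 1 + int (d * n) + int d" by (simp add: algebra_simps)
    ultimately show ?case unfolding step using d1 by simp
  qed (use lead1 in simp)
  obtain n y where n: "d * n = N * y + e" by (rule e_bezout)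
  have "lead ?x (1 + int (d * n)) = lead ?x (1 + int e)" by (rule lead_cong) (simp add: n)
  then show ?thesis using iter[of n] lead1 by simp
qed

text \<open>Since \<open>tau d u\<close> is a relabelling of u, all shifts of u by multiples of e
  are parking functions, and \<open>cut_leader\<close> applies at multiples of e. A block with two
  labels at distance at least e would reach across such a cut.\<close>

lemma framed_nonzero_short:
  assumes u: "u \<in> framed" "u \<circ> w = tau d u" and nonzero: "0 \<notin> u ` {1..a}"
  shows "short e u"
proof -
  have ur: "u \<in> {1..a} \<rightarrow>\<^sub>E {0..N}" using u by (simp add: framed_def)
  have up: "u \<in> parking" using u fill_nonzero[OF ur nonzero] by (simp add: framed_def)
  interpret path_heights a b N "ht u" by (rule path_heights_ht[OF up])
  have tau_dn: "tau (d * n) u \<in> parking" for n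
  proof (induction n)
    case (Suc n)
    have "tau (d * Suc n) u = tau (d * n) (tau d u)" by (simp add: tau_tau add.commute)
    also have "\<dots> = tau (d * n) u \<circ> w" using u(2) tau_comp_perm[OF w] by metis
    finally show ?case using parking_comp_perm[OF w Suc] by (simp only:)
  qed (use tau_N_mult[OF ur, of 0] up in simp)
  have tau_e: "tau (e * r) u \<in> parking" for r
  proof -
    obtain n y where n: "d * n = N * y + e" by (rule e_bezout)
    have "tau (d * (n * r)) u = tau (e * r) (tau (N * (y * r)) u)"
      unfolding tau_tau mult.assoc[symmetric] n by (simp add: algebra_simps)
    then show ?thesis using tau_dn[of "n * r"] tau_N_mult[OF ur, of "N * (y * r)"] by simp
  qed
  show ?thesis unfolding short_def
  proof (intro ballI impI)
    fix i j assume i: "i \<in> {1..N}" and j: "j \<in> {1..N}" and eq: "lead u (int i) = lead u (int j)"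
    show "j < i + e"
    proof (rule ccontr)
      assume far: "\<not> j < i + e"
      \<comment> \<open>The least multiple of e that is at least i; it is below i + e and so
        separates i from j, up to the case M = i.\<close>
      define M where "M = e * ((i - 1) div e + 1)"
      have "i - 1 < M" "M \<le> i - 1 + e"
        using e_facts(1) by (auto simp: M_def dividend_less_times_div)
      then have M: "i \<le> M" "M < i + e" using i by auto
      obtain r where r: "N = e * r" using e_facts by blast
      have "N - M = e * (r - ((i - 1) div e + 1))" by (simp add: r M_def diff_mult_distrib2)
      then have "tau (N - M) u \<in> parking" using tau_e by simp
      then have "N - (N - M) < leader (ht u) j"
        by (rule cut_leader[OF up]) (use M far i j in auto)
      then have "M < leader (ht u) j" using M far j by simp
      moreover have "leader (ht u) i \<le> i" using leader_bounds(2)[OF i] .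
      ultimately show False using eq i j M by (simp add: lead_of_nat)
    qed
  qed
qed

text \<open>A marked block is central and a short parking function has no central block, so u and v
  are both marked or both unmarked. In the marked case \<open>central_unique\<close> identifies the
  marked blocks; in the unmarked case both are short. Either way the rotation is the plain
  shift.\<close>

lemma framed_fixed_unique:
  assumes u: "u \<in> framed" "u \<circ> w = tau d u" and v: "v \<in> framed" "v \<circ> w = tau d v"
    and s: "s < N" and eq: "(rho ^^ s) (fill u) = fill v"
  shows "v = tau s u"
proof -
  let ?x = "fill u"
  have ur: "u \<in> {1..a} \<rightarrow>\<^sub>E {0..N}" and vr: "v \<in> {1..a} \<rightarrow>\<^sub>E {0..N}" and x: "?x \<in> parking"
    using u v by (auto simp: framed_def)
  have per: "lead ?x (i + int e) = lead ?x (j + int e) \<longleftrightarrow> lead ?x i = lead ?x j" for i j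
    by (rule fixed_period[OF x framed_fixed[OF u]])
  have lead_v: "lead (fill v) (i + int s) = lead (fill v) (j + int s) \<longleftrightarrow> lead ?x i = lead ?x j" for i j
    using lead_funpow_rho_eq_iff[OF x, of s "i + int s" "j + int s"] eq by simp
  consider (both) "0 \<in> u ` {1..a}" "0 \<in> v ` {1..a}" | (left) "0 \<in> u ` {1..a}" "0 \<notin> v ` {1..a}"
    | (right) "0 \<notin> u ` {1..a}" "0 \<in> v ` {1..a}" | (none) "0 \<notin> u ` {1..a}" "0 \<notin> v ` {1..a}"
    by blast
  then show ?thesis
  proof cases
    case both
    have uu: "unfill ?x = u" and vv: "unfill (fill v) = v"
      using unfill_fill[OF ur] unfill_fill[OF vr] both u v by (auto simp: framed_def)
    show ?thesis
    proof (cases "s = 0")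
      case True
      then have "fill u = fill v" using eq by simp
      then have "v = u" using uu vv by metis
      then show ?thesis unfolding True using tau_N_mult[OF ur, of 0] by simp
    next
      case False
      have "lead ?x (1 - int s) = lead ?x (1 - int s + int e)"
        using lead_v[of "1 - int s" "1 - int s + int e"] framed_zero_central[OF v both(2)]
        by (simp add: algebra_simps)
      then have c: "lead ?x (1 - int s) = lead ?x 1"
        using central_unique[OF x e_facts(1,2) per] framed_zero_central[OF u both(1)] by blast
      have s0: "0 < s" using False by simp
      have "fill v = fill (tau s u)" using funpow_rho_central[OF x s0 s c] unfolding eq uu .
      then have "v = unfill (fill (tau s u))" using vv by metis
      also have "\<dots> = tau s u"
        by (rule unfill_fill[OF tau_range]) (use one_notin_tau_unfill[OF x s0 s c] uu in metis)
      finally show ?thesis .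
    qed
  next
    case left
    have "short e (fill v)"
      using framed_nonzero_short[OF v left(2)] fill_nonzero[OF vr left(2)] by simp
    then have "lead (fill v) (1 + int s) \<noteq> lead (fill v) (1 + int s + int e)"
      using short_not_central e_facts by blast
    then show ?thesis
      using lead_v[of 1 "1 + int e"] framed_zero_central[OF u left(1)] by (simp add: algebra_simps)
  next
    case right
    have "short e ?x"
      using framed_nonzero_short[OF u right(1)] fill_nonzero[OF ur right(1)] by simp
    then have "lead ?x (1 - int s) \<noteq> lead ?x (1 - int s + int e)"
      using short_not_central e_facts by blast
    then show ?thesis
      using lead_v[of "1 - int s" "1 - int s + int e"] framed_zero_central[OF v right(2)]
      by (simp add: algebra_simps)
  next
    case none
    then show ?thesis
      using funpow_rho_short[OF x e_facts(2) s] framed_nonzero_short[OF u none(1)]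
        framed_nonzero_short[OF v none(2)] fill_nonzero[OF ur none(1)] fill_nonzero[OF vr none(2)] eq
      by simp
  qed
qed

text \<open>If some label is related to its translate by e, it is rotated to 1 and its block is
  marked. Otherwise the cut supplied by \<open>centre_exists\<close> is rotated to the boundary,
  which makes all blocks short.\<close>

lemma framed_preimage:
  assumes x: "x \<in> parking" and fixed: "(rho ^^ d) x = x \<circ> w"
  obtains s u where "u \<in> framed" "u \<circ> w = tau d u" "fill u = (rho ^^ s) x"
proof -
  have per: "lead x (i + int e) = lead x (j + int e) \<longleftrightarrow> lead x i = lead x j" for i j
    by (rule fixed_period[OF x fixed])
  have fixed_s: "(rho ^^ d) ((rho ^^ s) x) = (rho ^^ s) x \<circ> w" for s
  proof -
    have "(rho ^^ d) ((rho ^^ s) x) = (rho ^^ s) ((rho ^^ d) x)"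
      by (simp add: funpow_add[symmetric, unfolded comp_def, THEN fun_cong] add.commute)
    then show ?thesis by (simp add: fixed funpow_rho_comp_perm[OF w])
  qed
  \<comment> \<open>The lemmas comparing \<open>rho\<close> with \<open>tau\<close> need a shift
    below N; it stays positive because N does not divide d.\<close>
  define d' where "d' = d mod N"
  have d': "0 < d'" "d' < N" using d N_pos by (auto simp: d'_def mod_greater_zero_iff_not_dvd)
  have rho_d': "(rho ^^ d') z = (rho ^^ d) z" if "z \<in> parking" for z
    using funpow_mod_eq[OF funpow_rho_N[OF that], of d] by (simp add: d'_def)
  have tau_d': "tau d' y = tau d y" if "y \<in> {1..a} \<rightarrow>\<^sub>E {0..N}" for y
  proof -
    have "tau d y = tau d' (tau (N * (d div N)) y)" by (simp add: tau_tau d'_def)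
    then show ?thesis using tau_N_mult[OF that] by simp
  qed
  have rotate: "\<exists>s. int N dvd int s + t - 1" for t
  proof (intro exI)
    show "int N dvd int (nat ((1 - t) mod int N)) + t - 1"
      using N_pos dvd_minus_mod[of "int N" "1 - t"] by (simp add: algebra_simps dvd_diff_commute)
  qed
  show thesis
  proof (cases "\<exists>t. lead x t = lead x (t + int e)")
    case True
    then obtain t where t: "lead x t = lead x (t + int e)" by blast
    obtain s where s: "int N dvd int s + t - 1" using rotate by blast
    define z where "z = (rho ^^ s) x"
    have z: "z \<in> parking" unfolding z_def by (rule funpow_rho_parking[OF x])
    have zfixed: "(rho ^^ d) z = z \<circ> w" using fixed_s by (simp add: z_def)
    have "lead x (1 - int s) = lead x t" "lead x (1 + int e - int s) = lead x (t + int e)"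
      using s by (auto intro!: lead_cong simp: dvd_diff_commute algebra_simps)
    then have c: "lead z 1 = lead z (1 + int e)"
      using lead_funpow_rho_eq_iff[OF x, of s 1 "1 + int e"] t by (simp add: z_def)
    have perz: "lead z (i + int e) = lead z (j + int e) \<longleftrightarrow> lead z i = lead z j" for i j
      by (rule fixed_period[OF z zfixed])
    \<comment> \<open>Modulo N the point 1 - d' is reached from 1 by steps of e, so it belongs to
      the central block as well.\<close>
    have "e dvd N - d'" using e_facts by (simp add: d'_def dvd_mod dvd_diff_nat)
    then obtain n where n: "N - d' = e * n" by blast
    then have "int e * int n = int N - int d'" using d' by (simp flip: of_nat_mult add: of_nat_diff)
    then have "lead z (1 + int e * int n) = lead z (1 - int d')" by (intro lead_cong) simp
    then have cd: "lead z (1 - int d') = lead z 1" using central_iterate[where x = z, OF perz c, of n] by simp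
    have ur: "unfill z \<in> {1..a} \<rightarrow>\<^sub>E {0..N}" using parking_in[OF z] by (auto simp: unfill_def)
    have "unfill z \<circ> w = unfill ((rho ^^ d') z)"
      using unfill_comp_perm[OF w] zfixed rho_d'[OF z] by simp
    also have "\<dots> = tau d' (unfill z)"
      using funpow_rho_central[OF z d' cd] unfill_fill[OF tau_range one_notin_tau_unfill[OF z d' cd]] by simp
    finally have "unfill z \<circ> w = tau d (unfill z)" using tau_d'[OF ur] by simp
    moreover have "1 \<notin> unfill z ` {1..a}" by (auto simp: unfill_def)
    then have "unfill z \<in> framed" using ur z fill_unfill[OF z] by (simp add: framed_def)
    ultimately show thesis using that[of "unfill z" s] fill_unfill[OF z] by (simp add: z_def)
  next
    case False
    then obtain t where t: "\<And>i j. t \<le> i \<Longrightarrow> i \<le> j \<Longrightarrow> j < t + int N \<Longrightarrow> lead x i = lead x j \<Longrightarrow> j < i + int e"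
      using centre_exists[OF x e_facts(1,2) per] by blast
    obtain s where s: "int N dvd int s + t - 1" using rotate by blast
    define z where "z = (rho ^^ s) x"
    have z: "z \<in> parking" unfolding z_def by (rule funpow_rho_parking[OF x])
    have zfixed: "(rho ^^ d) z = z \<circ> w" using fixed_s by (simp add: z_def)
    have short: "short e z" unfolding short_def
    proof (intro ballI impI)
      fix i j assume i: "i \<in> {1..N}" and j: "j \<in> {1..N}" and eq: "lead z (int i) = lead z (int j)"
      have shifted: "lead x (int m - int s) = lead x (t + int m - 1)" for m
        using s by (intro lead_cong) (simp add: dvd_diff_commute algebra_simps)
      have "lead x (t + int i - 1) = lead x (t + int j - 1)"
        using eq lead_funpow_rho_eq_iff[OF x, of s "int i" "int j"] shifted by (simp add: z_def)
      then show "j < i + e"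
        using t[of "t + int i - 1" "t + int j - 1"] i j e_facts(1) by (cases "i \<le> j") auto
    qed
    have "lead (z \<circ> w) = lead z" by (simp add: lead_def fun_eq_iff ht_comp_perm[OF w])
    then have "short e ((rho ^^ d') z)" using short zfixed rho_d'[OF z] by (simp add: short_def)
    then have "(rho ^^ d') z = tau d' z" using funpow_rho_short[OF z e_facts(2) d'(2) short] by simp
    moreover have zr: "z \<in> {1..a} \<rightarrow>\<^sub>E {0..N}" using z by (auto simp: parking_def PiE_iff)
    ultimately have "z \<circ> w = tau d z" using zfixed rho_d'[OF z] tau_d' by simp
    moreover have "0 \<notin> z ` {1..a}" using parking_in[OF z] by force
    then have "z \<in> framed" "fill z = z" using fill_nonzero[OF zr] z zr by (auto simp: framed_def)
    ultimately show thesis using that[of z s] by (simp add: z_def)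
  qed
qed

text \<open>For injectivity both functions are moved into frames, where
  \<open>framed_fixed_unique\<close> recovers the shift between them. For surjectivity a framed
  solution for a rotated copy of x is shifted back.\<close>

lemma bij_betw_cut:
  "bij_betw cut {y \<in> {1..a} \<rightarrow>\<^sub>E {0..N}. y \<circ> w = tau d y} {x \<in> parking. (rho ^^ d) x = x \<circ> w}"
proof (rule bij_betwI')
  fix y assume y: "y \<in> {y \<in> {1..a} \<rightarrow>\<^sub>E {0..N}. y \<circ> w = tau d y}"
  then have "(rho ^^ d) (cut y) = cut y \<circ> w"
    using cut_tau[of y d] cut_comp_perm[OF w, of y] by simp
  then show "cut y \<in> {x \<in> parking. (rho ^^ d) x = x \<circ> w}" using y cut_parking by simp
  fix y' assume y': "y' \<in> {y \<in> {1..a} \<rightarrow>\<^sub>E {0..N}. y \<circ> w = tau d y}"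
  show "cut y = cut y' \<longleftrightarrow> y = y'"
  proof
    assume eq: "cut y = cut y'"
    have yr: "y \<in> {1..a} \<rightarrow>\<^sub>E {0..N}" "y' \<in> {1..a} \<rightarrow>\<^sub>E {0..N}" using y y' by auto
    obtain t where t: "t \<le> N" "tau t y \<in> framed" using ex_framed[OF yr(1)] by blast
    obtain t' where t': "t' \<le> N" "tau t' y' \<in> framed" using ex_framed[OF yr(2)] by blast
    have inv: "tau r u \<circ> w = tau d (tau r u)" if "u \<circ> w = tau d u" for r u
      unfolding tau_comp_perm[OF w, symmetric] that tau_tau by (simp only: add.commute)
    define s where "s = (t' + (N - t)) mod N"
    have fill_t: "fill (tau t y) \<in> parking" using t by (simp add: framed_def)
    have "(rho ^^ s) (fill (tau t y)) = (rho ^^ (t' + (N - t))) (fill (tau t y))"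
      using funpow_mod_eq[OF funpow_rho_N[OF fill_t]] by (simp add: s_def)
    also have "\<dots> = (rho ^^ (t' + (N - t))) ((rho ^^ t) (cut y))"
      using funpow_rho_cut[OF yr(1) t(2)] by simp
    also have "\<dots> = (rho ^^ t') ((rho ^^ N) (cut y))"
      using t(1) by (simp add: funpow_add[symmetric, unfolded comp_def, THEN fun_cong])
    also have "\<dots> = fill (tau t' y')"
      using funpow_rho_N[OF cut_parking[OF yr(1)]] eq funpow_rho_cut[OF yr(2) t'(2)] by simp
    finally have "(rho ^^ s) (fill (tau t y)) = fill (tau t' y')" .
    moreover have "s < N" using N_pos by (simp add: s_def)
    moreover have "tau t y \<circ> w = tau d (tau t y)" "tau t' y' \<circ> w = tau d (tau t' y')"
      using y y' inv by blast+
    ultimately have "tau t' y' = tau s (tau t y)"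
      using framed_fixed_unique[OF t(2) _ t'(2)] by blast
    also have "\<dots> = tau s (tau (N * ((t' + (N - t)) div N)) (tau t y))"
      using tau_N_mult[OF tau_range] by simp
    also have "\<dots> = tau (t' + N) y"
      using t(1) by (simp add: tau_tau s_def)
    also have "\<dots> = tau t' (tau N y)" by (simp add: tau_tau)
    finally have "tau t' y' = tau t' y" using tau_N_mult[OF yr(1)] by simp
    then have "tau (N - t') (tau t' y') = tau (N - t') (tau t' y)" by simp
    then show "y = y'" using t'(1) tau_N_mult[of _ N] yr by (simp add: tau_tau)
  qed simp
next
  fix x assume x: "x \<in> {x \<in> parking. (rho ^^ d) x = x \<circ> w}"
  then obtain s u where u: "u \<in> framed" "u \<circ> w = tau d u" "fill u = (rho ^^ s) x"
    using framed_preimage[of x] by blast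
  have ur: "u \<in> {1..a} \<rightarrow>\<^sub>E {0..N}" using u by (simp add: framed_def)
  \<comment> \<open>\<open>N * s - s\<close> is a natural number representing -s modulo N.\<close>
  define y where "y = tau (N * s - s) u"
  have ys: "tau s y = u" using N_pos tau_N_mult[OF ur, of "N * s"] by (simp add: y_def tau_tau)
  have yr: "y \<in> {1..a} \<rightarrow>\<^sub>E {0..N}" unfolding y_def by (rule tau_range)
  have "y \<circ> w = tau (N * s - s) (u \<circ> w)" unfolding y_def tau_comp_perm[OF w] ..
  also have "\<dots> = tau d y" unfolding u(2) y_def tau_tau by (simp only: add.commute)
  finally have "y \<circ> w = tau d y" .
  moreover have "(rho ^^ s) (cut y) = (rho ^^ s) x"
    using funpow_rho_cut[OF yr, of s] ys u by simp
  then have "cut y = x" using funpow_rho_inj[OF cut_parking[OF yr]] x by blast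
  ultimately show "\<exists>y\<in>{y \<in> {1..a} \<rightarrow>\<^sub>E {0..N}. y \<circ> w = tau d y}. x = cut y" using yr by auto
qed

end

end

subsection \<open>Counting equivariant functions\<close>

text \<open>One representative, the least element, for each cycle of w whose length is divisible by
  q; the lengths enter through the l with \<open>(w ^^ l) k = k\<close>.\<close>

definition cycle_reps :: "(nat \<Rightarrow> nat) \<Rightarrow> nat set \<Rightarrow> nat \<Rightarrow> nat set" where
  "cycle_reps w S q = {k\<in>S. (\<forall>n. k \<le> (w ^^ n) k) \<and> (\<forall>l. (w ^^ l) k = k \<longrightarrow> q dvd l)}"

lemma permutes_funpow_in: "w permutes S \<Longrightarrow> k \<in> S \<Longrightarrow> (w ^^ n) k \<in> S"
  by (induction n) (auto simp: permutes_in_image)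

lemma permutes_funpow_cycle:
  assumes "finite S" "w permutes S" "k \<in> S"
  obtains n where "0 < n" "(w ^^ n) k = k"
proof -
  have "{y. \<exists>n. y = (w ^^ n) k} \<subseteq> S" using permutes_funpow_in assms by auto
  then have "finite {y. \<exists>n. y = (w ^^ n) k}" using assms(1) finite_subset by blast
  then show thesis using funpow_inj_finite[OF permutes_inj[OF assms(2)]] that by metis
qed

lemma permutes_funpow_back:
  assumes "finite S" "w permutes S" "k \<in> S" "j = (w ^^ m) k"
  obtains n where "k = (w ^^ n) j"
proof -
  obtain c where c: "0 < c" "(w ^^ c) k = k" using permutes_funpow_cycle assms by metis
  have "(w ^^ (c * m)) k = k" using funpow_mod_eq[OF c(2), of "c * m"] by simp
  moreover have "c * m = (c * m - m) + m" using c by simp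
  ultimately have "(w ^^ (c * m - m)) j = k" unfolding assms(4)
    by (metis comp_apply funpow_add)
  then show thesis using that by metis
qed

lemma cycle_min:
  fixes w :: "nat \<Rightarrow> nat"
  assumes "finite S" "w permutes S" "j \<in> S"
  obtains t n where "t \<in> S" "j = (w ^^ n) t" "\<And>m. t \<le> (w ^^ m) t"
proof -
  define t where "t = (LEAST x. \<exists>n. x = (w ^^ n) j)"
  have "\<exists>n. t = (w ^^ n) j" unfolding t_def by (rule LeastI_ex[of "\<lambda>x. \<exists>n. x = (w ^^ n) j"]) blast
  then obtain m where m: "t = (w ^^ m) j" by blast
  then have "t \<in> S" using permutes_funpow_in assms by metis
  moreover obtain n where "j = (w ^^ n) t" using permutes_funpow_back[OF assms m] by blast
  moreover have "t \<le> (w ^^ r) t" for r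
  proof -
    have "(w ^^ r) t = (w ^^ (r + m)) j" by (simp add: m funpow_add)
    then show ?thesis unfolding t_def by (intro Least_le) blast
  qed
  ultimately show thesis using that by blast
qed

text \<open>On a cycle of length l, y is determined by its value v at one point, and closing up
  requires \<open>(\<sigma> ^^ l) v = v\<close>. By \<open>free\<close> this forces v = z unless q
  divides l; by \<open>ord\<close> it always holds if q divides l. General A and \<sigma> serve the
  counts in {0..N} and {1..b} as well as complex eigenvectors.\<close>

lemma bij_betw_equivariant_restrict:
  assumes S: "finite S" "w permutes S"
    and \<sigma>: "\<And>v. v \<in> A \<Longrightarrow> \<sigma> v \<in> A" "z \<in> A" "\<sigma> z = z"
    and ord: "\<And>v. v \<in> A \<Longrightarrow> (\<sigma> ^^ q) v = v"
    and free: "\<And>v l. v \<in> A \<Longrightarrow> (\<sigma> ^^ l) v = v \<Longrightarrow> v = z \<or> q dvd l"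
  shows "bij_betw (\<lambda>y. restrict y (cycle_reps w S q))
    {y \<in> S \<rightarrow>\<^sub>E A. \<forall>k\<in>S. y (w k) = \<sigma> (y k)} (cycle_reps w S q \<rightarrow>\<^sub>E A)"
proof -
  let ?T = "cycle_reps w S q"
  have \<sigma>n: "(\<sigma> ^^ n) v \<in> A" if "v \<in> A" for n v using that by (induction n) (auto intro: \<sigma>)
  have zn: "(\<sigma> ^^ n) z = z" for n by (induction n) (auto simp: \<sigma>)
  have \<sigma>_cong: "(\<sigma> ^^ n) v = (\<sigma> ^^ m) v" if "v \<in> A" "n mod q = m mod q" for n m v
    using funpow_mod_eq[OF ord[OF that(1)]] that(2) by metis
  have iter: "y ((w ^^ n) k) = (\<sigma> ^^ n) (y k)"
    if "\<forall>k\<in>S. y (w k) = \<sigma> (y k)" "k \<in> S" for y :: "nat \<Rightarrow> 'a" and k n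
    using that permutes_funpow_in[OF S(2)] by (induction n) auto
  have T_min: "t = t'" if "t \<in> ?T" "t' \<in> ?T" "(w ^^ n) t = (w ^^ m) t'" for t t' n m
  proof -
    have tS: "t \<in> S" "t' \<in> S" using that by (auto simp: cycle_reps_def)
    obtain r where r: "t = (w ^^ r) ((w ^^ n) t)" using permutes_funpow_back[OF S tS(1) refl] by metis
    obtain r' where r': "t' = (w ^^ r') ((w ^^ m) t')" using permutes_funpow_back[OF S tS(2) refl] by metis
    have "t = (w ^^ (r + m)) t'" using r that(3) by (simp add: funpow_add)
    moreover have "t' = (w ^^ (r' + n)) t" using r' that(3) by (simp add: funpow_add)
    ultimately show ?thesis using that(1,2) unfolding cycle_reps_def
      by (metis (mono_tags, lifting) le_antisym mem_Collect_eq)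
  qed
  have T_mod: "n mod q = m mod q" if "t \<in> ?T" "(w ^^ n) t = (w ^^ m) t" for t n m
  proof -
    have *: "n mod q = m mod q" if "m \<le> n" "(w ^^ n) t = (w ^^ m) t" for n m
    proof -
      have "(w ^^ m) ((w ^^ (n - m)) t) = (w ^^ m) t"
        using that by (metis comp_apply funpow_add le_add_diff_inverse)
      moreover have "inj (w ^^ m)" using permutes_inj[OF S(2)] by (rule inj_fn)
      ultimately have "(w ^^ (n - m)) t = t" by (metis injD)
      then have "q dvd n - m" using \<open>t \<in> ?T\<close> by (auto simp: cycle_reps_def)
      then show ?thesis using that by (simp add: mod_eq_dvd_iff_nat)
    qed
    show ?thesis using *[of m n] *[of n m] that by (cases "m \<le> n") auto
  qed
  show ?thesis
  proof (rule bij_betwI')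
    fix y y' assume y: "y \<in> {y \<in> S \<rightarrow>\<^sub>E A. \<forall>k\<in>S. y (w k) = \<sigma> (y k)}"
      and y': "y' \<in> {y \<in> S \<rightarrow>\<^sub>E A. \<forall>k\<in>S. y (w k) = \<sigma> (y k)}"
    show "restrict y ?T = restrict y' ?T \<longleftrightarrow> y = y'"
    proof
      assume eq: "restrict y ?T = restrict y' ?T"
      show "y = y'"
      proof (rule PiE_ext[of _ S "\<lambda>_. A"])
        fix j assume "j \<in> S"
        then obtain t n where t: "t \<in> S" "j = (w ^^ n) t" "\<And>m. t \<le> (w ^^ m) t"
          using cycle_min[OF S] by metis
        have "y t = y' t"
        proof (cases "t \<in> ?T")
          case True
          then show ?thesis using fun_cong[OF eq, of t] by simp
        next
          case False
          then obtain l where l: "(w ^^ l) t = t" "\<not> q dvd l" using t by (auto simp: cycle_reps_def)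
          have vanish: "u t = z" if "u \<in> {y \<in> S \<rightarrow>\<^sub>E A. \<forall>k\<in>S. y (w k) = \<sigma> (y k)}" for u
          proof -
            have "u t \<in> A" "(\<sigma> ^^ l) (u t) = u t" using that t(1) iter[of u t l] l(1) by auto
            then show ?thesis using free l(2) by blast
          qed
          show ?thesis using vanish[OF y] vanish[OF y'] by simp
        qed
        then show "y j = y' j" using iter[of y t n] iter[of y' t n] y y' t by simp
      qed (use y y' in auto)
    qed simp
  next
    fix y assume "y \<in> {y \<in> S \<rightarrow>\<^sub>E A. \<forall>k\<in>S. y (w k) = \<sigma> (y k)}"
    then show "restrict y ?T \<in> ?T \<rightarrow>\<^sub>E A" by (auto simp: cycle_reps_def)
  next
    fix u assume u: "u \<in> ?T \<rightarrow>\<^sub>E A"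
    \<comment> \<open>The relation \<open>P j v\<close> says that u forces the value v at j; cycles
      without a representative receive z.\<close>
    define P where "P j v \<longleftrightarrow> (\<exists>t\<in>?T. \<exists>n. j = (w ^^ n) t \<and> v = (\<sigma> ^^ n) (u t))" for j v
    have P_unique: "v = v'" if PP: "P j v" "P j v'" for j v v'
    proof -
      obtain t n where t: "t \<in> ?T" "j = (w ^^ n) t" "v = (\<sigma> ^^ n) (u t)"
        using PP(1) unfolding P_def by blast
      obtain t' n' where t': "t' \<in> ?T" "j = (w ^^ n') t'" "v' = (\<sigma> ^^ n') (u t')"
        using PP(2) unfolding P_def by blast
      have "t = t'" using T_min t t' by metis
      moreover then have "n mod q = n' mod q" using T_mod t t' by metis
      ultimately show ?thesis using \<sigma>_cong[of "u t" n n'] t t' u by auto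
    qed
    define y where "y = (\<lambda>j\<in>S. if \<exists>v. P j v then THE v. P j v else z)"
    have y_P: "y j = v" if "P j v" "j \<in> S" for j v
    proof -
      have "(THE v. P j v) = v" using that P_unique by blast
      then show ?thesis using that by (auto simp: y_def)
    qed
    have y_z: "y j = z" if "\<nexists>v. P j v" "j \<in> S" for j
      unfolding y_def restrict_apply'[OF that(2)] using that(1) by (rule if_not_P)
    have PA: "v \<in> A" if "P j v" for j v using that u \<sigma>n by (auto simp: P_def)
    have P_step: "P (w j) (\<sigma> v)" if Pj: "P j v" for j v
    proof -
      obtain t n where "t \<in> ?T" "j = (w ^^ n) t" "v = (\<sigma> ^^ n) (u t)"
        using Pj unfolding P_def by blast
      then have "t \<in> ?T" "w j = (w ^^ Suc n) t" "\<sigma> v = (\<sigma> ^^ Suc n) (u t)" by auto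
      then show ?thesis unfolding P_def by blast
    qed
    have P_back: "\<exists>v. P j v" if Pw: "P (w j) v" "j \<in> S" for j v
    proof -
      obtain t n where t: "t \<in> ?T" "w j = (w ^^ n) t" using Pw(1) unfolding P_def by blast
      have "w j = (w ^^ 1) j" by simp
      then obtain r where "j = (w ^^ r) (w j)" using permutes_funpow_back[OF S Pw(2)] by blast
      then have "j = (w ^^ (r + n)) t" using t by (simp add: funpow_add)
      then show ?thesis using t by (auto simp: P_def)
    qed
    have "y \<in> S \<rightarrow>\<^sub>E A"
    proof (rule PiE_I)
      fix j assume j: "j \<in> S"
      show "y j \<in> A"
        by (cases "\<exists>v. P j v") (use y_P[OF _ j] PA \<sigma>(2) j in \<open>auto simp: y_def\<close>)
    qed (simp add: y_def)
    moreover have "\<forall>k\<in>S. y (w k) = \<sigma> (y k)"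
    proof
      fix j assume j: "j \<in> S"
      then have wj: "w j \<in> S" using permutes_in_image[OF S(2)] by simp
      show "y (w j) = \<sigma> (y j)"
      proof (cases "\<exists>v. P j v")
        case True
        then obtain v where "P j v" by blast
        then show ?thesis using y_P[OF _ j] y_P[OF P_step wj] by simp
      next
        case False
        then have "\<nexists>v. P (w j) v" using P_back[OF _ j] by blast
        then show ?thesis using y_z[OF False j] y_z[OF _ wj] \<sigma>(3) by simp
      qed
    qed
    moreover have "u = restrict y ?T"
    proof (rule PiE_ext[OF u])
      show "restrict y ?T \<in> ?T \<rightarrow>\<^sub>E A" using \<open>y \<in> S \<rightarrow>\<^sub>E A\<close> by (auto simp: cycle_reps_def)
      fix t assume t: "t \<in> ?T"
      then have "P t (u t)" unfolding P_def by (intro bexI[of _ t] exI[of _ 0]) auto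
      then show "u t = restrict y ?T t" using y_P[of t "u t"] t by (simp add: cycle_reps_def)
    qed
    ultimately show "\<exists>y\<in>{y \<in> S \<rightarrow>\<^sub>E A. \<forall>k\<in>S. y (w k) = \<sigma> (y k)}. u = restrict y ?T" by blast
  qed
qed

lemma dvd_mult_iff_div_gcd:
  fixes N d l :: nat
  assumes "0 < N"
  shows "N dvd d * l \<longleftrightarrow> N div gcd d N dvd l"
proof -
  have g: "gcd d N \<noteq> 0" using assms by simp
  have "N dvd d * l \<longleftrightarrow> gcd d N * (N div gcd d N) dvd gcd d N * ((d div gcd d N) * l)"
    by (simp add: mult.assoc[symmetric])
  also have "\<dots> \<longleftrightarrow> N div gcd d N dvd (d div gcd d N) * l"
    using g by (intro nat_mult_dvd_cancel1) simp
  also have "\<dots> \<longleftrightarrow> N div gcd d N dvd l"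
    using div_gcd_coprime[of d N] assms
    by (intro coprime_dvd_mult_right_iff) (auto simp: coprime_commute)
  finally show ?thesis .
qed

lemma equivariant_iff_comp:
  assumes w: "w permutes S" and y: "y \<in> S \<rightarrow>\<^sub>E A"
  shows "(\<forall>k\<in>S. y (w k) = \<sigma> (y k)) \<longleftrightarrow> y \<circ> w = (\<lambda>k\<in>S. \<sigma> (y k))"
proof -
  have "y (w k) = undefined" if "k \<notin> S" for k using that y permutes_not_in[OF w that] by auto
  then show ?thesis by (auto simp: fun_eq_iff)
qed

context rational_slope
begin

lemma funpow_shift: "v \<le> N \<Longrightarrow> (shift d ^^ n) v = shift (d * n) v"
  by (induction n) (auto simp: shift_shift shift_N_mult)

lemma shift_eq_self_iff: "v \<le> N \<Longrightarrow> 0 < v \<Longrightarrow> shift s v = v \<longleftrightarrow> N dvd s"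
proof
  assume v: "v \<le> N" "0 < v" "shift s v = v"
  then have "residue (int v + int s) = residue (int v)" using residue_of_nat[of v] by (simp add: shift_def)
  then show "N dvd s" by (simp add: residue_eq_iff)
qed (rule shift_N_mult)

text \<open>Under \<open>shift d\<close> the value 0 is fixed and nonzero values have orbits of
  length \<open>N div gcd d N\<close>, so each representative may take any of the N + 1
  values.\<close>

lemma card_equivariant:
  assumes w: "w permutes {1..a}"
  shows "card {y \<in> {1..a} \<rightarrow>\<^sub>E {0..N}. y \<circ> w = tau d y} = b ^ card (cycle_reps w {1..a} (N div gcd d N))"
proof -
  let ?q = "N div gcd d N"
  have dvd: "N dvd d * l \<longleftrightarrow> ?q dvd l" for l by (rule dvd_mult_iff_div_gcd[OF N_pos])
  have bij: "bij_betw (\<lambda>y. restrict y (cycle_reps w {1..a} ?q))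
    {y \<in> {1..a} \<rightarrow>\<^sub>E {0..N}. \<forall>k\<in>{1..a}. y (w k) = shift d (y k)} (cycle_reps w {1..a} ?q \<rightarrow>\<^sub>E {0..N})"
  proof (rule bij_betw_equivariant_restrict[where z = 0])
    fix v assume v: "v \<in> {0..N}"
    then show "(shift d ^^ ?q) v = v" using dvd[of ?q] by (simp add: funpow_shift shift_N_mult)
    fix l assume "(shift d ^^ l) v = v"
    then show "v = 0 \<or> ?q dvd l" using v shift_eq_self_iff[of v "d * l"] dvd[of l] by (auto simp: funpow_shift)
  qed (use w shift_le in auto)
  have eq: "{y \<in> {1..a} \<rightarrow>\<^sub>E {0..N}. \<forall>k\<in>{1..a}. y (w k) = shift d (y k)} =
      {y \<in> {1..a} \<rightarrow>\<^sub>E {0..N}. y \<circ> w = tau d y}"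
    unfolding tau_def by (rule Collect_cong) (use equivariant_iff_comp[OF w, of _ "{0..N}" "shift d"] in blast)
  have "card {y \<in> {1..a} \<rightarrow>\<^sub>E {0..N}. y \<circ> w = tau d y} = card (cycle_reps w {1..a} ?q \<rightarrow>\<^sub>E {0..N})"
    using bij_betw_same_card[OF bij] unfolding eq .
  also have "\<dots> = b ^ card (cycle_reps w {1..a} ?q)"
    by (subst card_PiE) (auto simp: cycle_reps_def b_eq)
  finally show ?thesis .
qed

section \<open>The cycle lemma modulo \<open>b\<close>\<close>

definition turn :: "nat \<Rightarrow> (nat \<Rightarrow> nat) \<Rightarrow> nat \<Rightarrow> nat" where
  "turn s x = (\<lambda>k\<in>{1..a}. if x k + s \<le> b then x k + s else x k + s - b)"

text \<open>The height of \<open>turn s x\<close> at s and that of x at b - s add up to a, so their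
  excesses add up to 0; for s > 0 one is positive and the other nonnegative.\<close>

lemma turn_parking_unique:
  assumes x: "x \<in> parking" and z: "turn s x \<in> parking" and s: "s < b"
  shows "s = 0"
proof (rule ccontr)
  assume "s \<noteq> 0"
  interpret path_heights a b N "ht x" by (rule path_heights_ht[OF x])
  interpret z: path_heights a b N "ht (turn s x)" by (rule path_heights_ht[OF z])
  have pos: "0 < x k" "x k \<le> b" "0 < turn s x k" if "k \<in> {1..a}" for k
    using parking_in[OF x that] parking_in[OF z that] b_eq by auto
  have "poscount (turn s x) s + poscount x (b - s) = poscount x (b - s + s)"
  proof (rule poscount_wrap_low[OF pos(2)])
    fix k assume "k \<in> {1..a}"
    then show "turn s x k = (if x k = 0 then 0 else if x k + s \<le> b then x k + s else x k + s - b)"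
      using pos(1)[of k] by (simp add: turn_def)
  qed (use s in auto)
  then have "ht (turn s x) s + ht x (b - s) = ht x b"
    using ht_eq_poscount[of x] ht_eq_poscount[of "turn s x"] pos s by simp
  moreover have "ht x b = a" using h_N[of b] b_eq by simp
  ultimately have e1: "int (ht (turn s x) s) = int a - int (ht x (b - s))" by linarith
  have e2: "int (b - s) = int b - int s" using s by simp
  have "excess (ht (turn s x)) s + excess (ht x) (b - s) = 0"
    unfolding excess_def e1 e2 by (simp add: algebra_simps)
  moreover have "0 < excess (ht x) (b - s)" using excess_pos[of "b - s"] s \<open>s \<noteq> 0\<close> b_eq by auto
  moreover have "0 \<le> excess (ht (turn s x)) s" using z.excess_nonneg[of s] s by simp
  ultimately show False by linarith
qed

text \<open>The walk C returns to 0 after b steps, and cutting it at a minimum makes the partial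
  sums nonnegative. No value is then b, since the Dyck condition at N forces height a there.\<close>

lemma ex_turn_parking:
  assumes zr: "z \<in> {1..a} \<rightarrow>\<^sub>E {1..b}"
  obtains q x where "q < b" "x \<in> parking" "z = turn q x" "x = turn (b - q) z"
proof -
  let ?H = "poscount z"
  define C where "C m = int b * int (?H m) - int a * int m" for m
  have zk: "0 < z k" "z k \<le> b" if "k \<in> {1..a}" for k using that zr by (auto dest: PiE_mem simp: Suc_le_eq)
  have "{k\<in>{1..a}. z k = 0} = {}" using zk by force
  then have Hb: "?H b = a" using card_zeros_poscount[of z b, OF zk(2)] by (simp only: card.empty add_0)
  obtain q where q: "q \<in> {..<b}" and min: "\<And>n. n \<in> {..<b} \<Longrightarrow> C q \<le> C n"
    using obtain_argmin[of "{..<b}" C] b_eq by auto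
  have "C b = C 0" by (simp add: C_def Hb)
  then have C_min: "C q \<le> C m" if "m \<le> b" for m
    using min[of m] min[of 0] that q by (cases "m = b") auto
  define x where "x = turn (b - q) z"
  have xk: "x k = (if z k = 0 then 0 else if z k + (b - q) \<le> b then z k + (b - q) else z k + (b - q) - b)"
    if "k \<in> {1..a}" for k using that zk(1)[OF that] by (simp add: x_def turn_def)
  have xpos: "0 < x k" "x k \<le> b" if "k \<in> {1..a}" for k
    using xk[OF that] zk[OF that] q by (auto split: if_splits)
  have ht_x: "ht x m = poscount x m" for m using ht_eq_poscount xpos by blast
  have dyck: "a * m \<le> b * ht x m" if m: "m \<le> b" for m
  proof -
    have "int b * int (ht x m) - int a * int m \<ge> 0"
    proof (cases "m \<le> b - q")
      case True
      have "poscount x m + ?H (b - (b - q)) = ?H (b - (b - q) + m)"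
        by (rule poscount_wrap_low[OF zk(2) _ xk True]) auto
      then have "poscount x m + ?H q = ?H (q + m)" using q by (simp add: add.commute)
      then have e: "int (ht x m) = int (?H (q + m)) - int (?H q)" unfolding ht_x by linarith
      have "int b * int (ht x m) - int a * int m = C (q + m) - C q"
        unfolding e C_def by (simp add: algebra_simps)
      then show ?thesis using C_min[of "q + m"] True q by simp
    next
      case False
      have "poscount x m + ?H (b - (b - q)) = ?H b + ?H (m - (b - q))"
        by (rule poscount_wrap_high[OF zk(2) _ xk _ m]) (use False in auto)
      then have "poscount x m + ?H q = a + ?H (m - (b - q))" using q Hb by simp
      then have e: "int (ht x m) = int a + int (?H (m - (b - q))) - int (?H q)" unfolding ht_x by linarith
      have e2: "int (m - (b - q)) = int m - int b + int q" using False q by simp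
      have "int b * int (ht x m) - int a * int m = C (m - (b - q)) - C q"
        unfolding e C_def e2 by (simp add: algebra_simps)
      then show ?thesis using C_min[of "m - (b - q)"] m by simp
    qed
    then have "int (a * m) \<le> int (b * ht x m)" by simp
    then show ?thesis by (simp only: of_nat_le_iff)
  qed
  have "card {k\<in>{1..a}. x k \<le> N} \<le> card {1..a}" by (rule card_mono) auto
  then have le: "ht x N \<le> a" by (simp add: ht_def)
  have "\<not> ht x N < a"
  proof
    assume "ht x N < a"
    then have "b * Suc (ht x N) \<le> b * a" by (intro mult_le_mono) auto
    moreover have "b * a = a * N + a" by (subst b_eq) simp
    ultimately have "b * ht x N + b \<le> a * N + a" by simp
    moreover have "a * N \<le> b * ht x N" using dyck[of N] b_eq by linarith
    ultimately show False using a_less by linarith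
  qed
  then have "card {k\<in>{1..a}. x k \<le> N} = card {1..a}" using le by (simp add: ht_def)
  then have full: "{k\<in>{1..a}. x k \<le> N} = {1..a}" by (intro card_subset_eq) auto
  have "x \<in> {1..a} \<rightarrow>\<^sub>E {1..N}"
  proof (rule PiE_I)
    fix k assume k: "k \<in> {1..a}"
    then have "x k \<le> N" using full by blast
    then show "x k \<in> {1..N}" using xpos(1)[OF k] by simp
  qed (auto simp: x_def turn_def)
  moreover have "a * m \<le> b * ht x m" if "m \<le> N" for m using dyck[of m] that b_eq by linarith
  ultimately have "x \<in> parking" by (simp add: parking_def)
  moreover have "z = turn q x"
  proof (rule extensionalityI[of _ "{1..a}"])
    show "z \<in> extensional {1..a}" using zr by (simp add: PiE_def)
    show "turn q x \<in> extensional {1..a}" by (simp add: turn_def)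
    fix k assume k: "k \<in> {1..a}"
    have "turn q x k = (if x k + q \<le> b then x k + q else x k + q - b)" using k by (simp add: turn_def)
    moreover have "q < b" using q by simp
    ultimately show "z k = turn q x k"
      using xk[OF k] zk(1)[OF k] zk(2)[OF k] by (simp split: if_splits)
  qed
  moreover have "q < b" using q by simp
  ultimately show thesis using that[of q x] x_def by blast
qed

lemma turn_comp_perm: "w permutes {1..a} \<Longrightarrow> turn s (y \<circ> w) = turn s y \<circ> w"
  using permutes_in_image[of w "{1..a}"] by (auto simp: turn_def fun_eq_iff)

text \<open>Each function into {1..b} is in exactly one way a cyclic translate of a parking
  function, and translation commutes with relabelling.\<close>

lemma card_fixed_parking:
  assumes w: "w permutes {1..a}"
  shows "b * card {x \<in> parking. x \<circ> w = x} = b ^ card (cycle_reps w {1..a} 1)"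
proof -
  let ?X = "{x \<in> parking. x \<circ> w = x}" and ?Z = "{z \<in> {1..a} \<rightarrow>\<^sub>E {1..b}. z \<circ> w = z}"
  have "bij_betw (\<lambda>(s, x). turn s x) ({..<b} \<times> ?X) ?Z"
  proof (rule bij_betwI')
    fix p p' assume p: "p \<in> {..<b} \<times> ?X" and p': "p' \<in> {..<b} \<times> ?X"
    obtain s x s' x' where [simp]: "p = (s, x)" "p' = (s', x')" by (cases p, cases p')
    \<comment> \<open>Turning back by s reduces injectivity to the uniqueness of the parking
      translate.\<close>
    have main: "s = s' \<and> x = x'" if s: "s \<le> s'" "s' < b" and x: "x \<in> parking" "x' \<in> parking"
      and eq: "turn s x = turn s' x'" for s s' x x'
    proof -
      have "x = turn (s' - s) x'"
      proof (rule extensionalityI[OF parking_extensional[OF x(1)]])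
        fix k assume k: "k \<in> {1..a}"
        have "(if x k + s \<le> b then x k + s else x k + s - b) =
            (if x' k + s' \<le> b then x' k + s' else x' k + s' - b)"
          using fun_cong[OF eq, of k] k by (simp add: turn_def)
        moreover have "0 < x k" "x k \<le> b" "0 < x' k" "x' k \<le> b"
          using parking_in[OF x(1) k] parking_in[OF x(2) k] b_eq by auto
        ultimately show "x k = turn (s' - s) x' k"
          using k s by (auto simp: turn_def split: if_splits)
      qed (simp add: turn_def)
      then have "s' - s = 0" using turn_parking_unique[OF x(2), of "s' - s"] x(1) s by simp
      moreover have "turn 0 x' = x'"
      proof (rule extensionalityI[OF _ parking_extensional[OF x(2)]])
        fix k assume k: "k \<in> {1..a}"
        then have "x' k \<le> b" using parking_in[OF x(2) k] b_eq by auto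
        then show "turn 0 x' k = x' k" using k by (simp add: turn_def)
      qed (simp add: turn_def)
      ultimately show ?thesis using \<open>x = turn (s' - s) x'\<close> s by simp
    qed
    show "(case p of (s, x) \<Rightarrow> turn s x) = (case p' of (s, x) \<Rightarrow> turn s x) \<longleftrightarrow> p = p'"
    proof
      assume "(case p of (s, x) \<Rightarrow> turn s x) = (case p' of (s, x) \<Rightarrow> turn s x)"
      then have eq: "turn s x = turn s' x'" by simp
      have mem: "s < b" "s' < b" "x \<in> parking" "x' \<in> parking" using p p' by simp_all
      have "s = s' \<and> x = x'"
      proof (cases "s \<le> s'")
        case True
        show ?thesis by (rule main[OF True mem(2,3,4) eq])
      next
        case False
        then have "s' \<le> s" by simp
        from main[OF this mem(1,4,3) eq[symmetric]] show ?thesis by simp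
      qed
      then show "p = p'" by simp
    qed simp
  next
    fix p assume p: "p \<in> {..<b} \<times> ?X"
    obtain s x where [simp]: "p = (s, x)" by (cases p)
    have x: "x \<in> parking" "x \<circ> w = x" "s < b" using p by auto
    have "turn s x \<in> {1..a} \<rightarrow>\<^sub>E {1..b}"
    proof (rule PiE_I)
      fix k assume k: "k \<in> {1..a}"
      have "0 < x k" "x k \<le> b" using parking_in[OF x(1) k] b_eq by auto
      then show "turn s x k \<in> {1..b}" using k x(3) by (auto simp: turn_def)
    qed (auto simp: turn_def)
    moreover have "turn s x \<circ> w = turn s x" using turn_comp_perm[OF w, of s x] x(2) by simp
    ultimately show "(case p of (s, x) \<Rightarrow> turn s x) \<in> ?Z" by simp
  next
    fix z assume z: "z \<in> ?Z"
    obtain q x where q: "q < b" "x \<in> parking" "z = turn q x" "x = turn (b - q) z"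
      using ex_turn_parking[of z] z by blast
    have "z \<circ> w = z" using z by simp
    then have "x \<circ> w = x" using q(4) turn_comp_perm[OF w, of "b - q" z] by metis
    then have "(q, x) \<in> {..<b} \<times> ?X" using q(1,2) by simp
    moreover have "z = (case (q, x) of (s, x) \<Rightarrow> turn s x)" unfolding prod.case by (rule q(3))
    ultimately show "\<exists>p\<in>{..<b} \<times> ?X. z = (case p of (s, x) \<Rightarrow> turn s x)" by blast
  qed
  then have "card ({..<b} \<times> ?X) = card ?Z" by (rule bij_betw_same_card)
  then have 1: "b * card ?X = card ?Z" unfolding card_cartesian_product card_lessThan .
  have bij: "bij_betw (\<lambda>y. restrict y (cycle_reps w {1..a} 1))
      {y \<in> {1..a} \<rightarrow>\<^sub>E {1..b}. \<forall>k\<in>{1..a}. y (w k) = id (y k)} (cycle_reps w {1..a} 1 \<rightarrow>\<^sub>E {1..b})"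
    by (rule bij_betw_equivariant_restrict[where z = 1]) (use w b_eq in auto)
  have eq: "{y \<in> {1..a} \<rightarrow>\<^sub>E {1..b}. \<forall>k\<in>{1..a}. y (w k) = id (y k)} = ?Z"
  proof -
    have "(\<lambda>k\<in>{1..a}. id (y k)) = y" if "y \<in> {1..a} \<rightarrow>\<^sub>E {1..b}" for y
      using PiE_restrict[OF that] by simp
    then show ?thesis using equivariant_iff_comp[OF w, of _ "{1..b}" id]
      by (intro Collect_cong conj_cong refl) metis
  qed
  have "b * card ?X = card (cycle_reps w {1..a} 1 \<rightarrow>\<^sub>E {1..b})"
    unfolding 1 using bij_betw_same_card[OF bij] unfolding eq .
  also have "\<dots> = b ^ card (cycle_reps w {1..a} 1)"
    by (subst card_PiE) (auto simp: cycle_reps_def)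
  finally show ?thesis .
qed

subsection \<open>Blocks and ranks\<close>

lemma b_minus_1: "b - 1 = N"
  using b_eq by simp

definition fibre :: "(nat \<Rightarrow> nat) \<Rightarrow> nat \<Rightarrow> nat set" where
  "fibre h v = {j\<in>{1..N}. leader h j = v}"

definition blocks :: "(nat \<Rightarrow> nat) \<Rightarrow> nat set set" where
  "blocks h = fibre h ` leader h ` {1..N}"

end

context path_heights
begin

lemma finite_fibre: "finite (fibre h v)"
  by (simp add: fibre_def)

lemma leader_in_fibre:
  assumes "v \<in> leader h ` {1..N}"
  shows "v \<in> fibre h v"
  using assms leader_leader leader_bounds(3) by (auto simp: fibre_def)

lemma Min_fibre:
  assumes "v \<in> leader h ` {1..N}"
  shows "Min (fibre h v) = v"
proof (rule Min_eqI[OF finite_fibre _ leader_in_fibre[OF assms]])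
  fix m assume "m \<in> fibre h v"
  then show "v \<le> m" using leader_bounds(2)[of m] by (simp add: fibre_def)
qed

lemma fibre_eq_iff:
  "u \<in> leader h ` {1..N} \<Longrightarrow> v \<in> leader h ` {1..N} \<Longrightarrow> fibre h u = fibre h v \<longleftrightarrow> u = v"
  using Min_fibre by metis

lemma leader_image_iff: "v \<in> leader h ` {1..N} \<longleftrightarrow> v \<in> {1..N} \<and> h (v - 1) < h v"
proof
  assume "v \<in> leader h ` {1..N}"
  then obtain m where m: "m \<in> {1..N}" "v = leader h m" by blast
  then have "v \<in> {1..N}" "leader h v = v" using leader_leader leader_bounds(3) by auto
  then show "v \<in> {1..N} \<and> h (v - 1) < h v" using leader_eq_self_iff by blast
next
  assume "v \<in> {1..N} \<and> h (v - 1) < h v"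
  then show "v \<in> leader h ` {1..N}" using leader_eq_self_iff[of v] by (metis imageI)
qed

text \<open>Positions that are not leaders contribute 0, so the sum telescopes over all positions
  from i to m.\<close>

lemma sum_leaders:
  assumes "i \<le> Suc m" "0 < i" "m \<le> N"
  shows "(\<Sum>v | v \<in> leader h ` {1..N} \<and> i \<le> v \<and> v \<le> m. int (h v) - int (h (v - 1)))
    = int (h m) - int (h (i - 1))"
proof -
  have "(\<Sum>v | v \<in> leader h ` {1..N} \<and> i \<le> v \<and> v \<le> m. int (h v) - int (h (v - 1)))
      = (\<Sum>v\<in>{i..m}. int (h v) - int (h (v - 1)))"
  proof (rule sum.mono_neutral_left)
    show "\<forall>v\<in>{i..m} - {v. v \<in> leader h ` {1..N} \<and> i \<le> v \<and> v \<le> m}. int (h v) - int (h (v - 1)) = 0"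
    proof
      fix v assume v: "v \<in> {i..m} - {v. v \<in> leader h ` {1..N} \<and> i \<le> v \<and> v \<le> m}"
      then have "\<not> h (v - 1) < h v" using leader_image_iff[of v] assms by auto
      moreover have "h (v - 1) \<le> h v" by (rule h_mono) simp
      ultimately show "int (h v) - int (h (v - 1)) = 0" by simp
    qed
  qed auto
  also have "\<dots> = int (h m) - int (h (i - 1))"
    using assms(1)
  proof (induction m)
    case 0
    then show ?case using assms(2) by (cases "i = 1") auto
  next
    case (Suc m)
    show ?case
    proof (cases "i = Suc (Suc m)")
      case False
      then have "{i..Suc m} = insert (Suc m) {i..m}" using Suc.prems by auto
      then show ?thesis using Suc False by simp
    qed simp
  qed
  finally show ?thesis .
qed

text \<open>The first label after \<open>J\<close> with smaller excess loses at most \<open>a\<close>; if its excess were still above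
  that of the parent it would belong to the block.\<close>

lemma excess_last_in_block:
  assumes J: "J \<in> {1..N}" and last: "\<And>m. m \<in> {1..N} \<Longrightarrow> leader h m = leader h J \<Longrightarrow> m \<le> J"
  shows "excess h J - excess h (leader h J - 1) \<le> int a"
proof (rule ccontr)
  assume far: "\<not> ?thesis"
  have J': "0 < J" "J \<le> N" using J by auto
  define p where "p = parent h J"
  have p: "leader h J = Suc p" by (simp add: leader_def p_def)
  have pb: "p \<le> b" using parent_less[OF J'] J' b_eq by (simp add: p_def)
  define m where "m = (LEAST m. J < m \<and> excess h m < excess h J)"
  have "J < b" "excess h b < excess h J" using J' b_eq excess_b excess_pos[OF J'] by auto
  then have ex: "J < b \<and> excess h b < excess h J" by simp
  have m: "J < m" "excess h m < excess h J" "m \<le> b"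
    using LeastI[of "\<lambda>m. J < m \<and> excess h m < excess h J", OF ex]
      Least_le[of "\<lambda>m. J < m \<and> excess h m < excess h J", OF ex] by (auto simp: m_def)
  have between: "excess h J \<le> excess h q" if "J < q" "q < m" for q
    using not_less_Least[of q "\<lambda>m. J < m \<and> excess h m < excess h J"] that by (auto simp: m_def)
  obtain q where q: "m = Suc q" using m by (cases m) auto
  have "excess h J \<le> excess h q" using between[of q] m q by (cases "q = J") auto
  then have pm: "excess h p < excess h m" using excess_Suc_ge[of q] far p q by simp
  then have "m \<noteq> b" using excess_b excess_nonneg[OF pb] by auto
  then have mN: "m \<le> N" using m(3) b_eq by simp
  have "parent h m = p"
  proof (rule parent_eqI)
    show "p < m" using parent_less[OF J'] m by (simp add: p_def)
    fix r assume r: "p < r" "r < m"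
    then consider "r < J" | "r = J" | "J < r" by linarith
    then show "excess h m < excess h r"
    proof cases
      case 1
      then show ?thesis using excess_after_parent[OF J', of r] r m by (simp add: p_def)
    next
      case 2
      then show ?thesis using m by simp
    next
      case 3
      then show ?thesis using between[of r] r m by simp
    qed
  qed (rule mN pm)+
  then have "leader h m = leader h J" by (simp add: leader_def p_def)
  then show False using last[of m] m mN by simp
qed

text \<open>A block whose minimum lies within the span of another cannot extend beyond it without a
  crossing, so nesting can be tested on minima.\<close>

lemma block_le_iff:
  assumes u: "u \<in> leader h ` {1..N}" and v: "v \<in> leader h ` {1..N}"
  shows "fibre h u \<preceq> fibre h v \<longleftrightarrow> v \<le> u \<and> u \<le> Max (fibre h v)"
proof -
  have mu: "u \<in> fibre h u" and mv: "v \<in> fibre h v" using leader_in_fibre u v by auto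
  have Mu: "Max (fibre h u) \<in> fibre h u" and Mv: "Max (fibre h v) \<in> fibre h v"
    using finite_fibre mu mv Max_in by blast+
  have uM: "u \<le> Max (fibre h u)" "v \<le> Max (fibre h v)" using finite_fibre mu mv Max_ge by blast+
  have "Max (fibre h u) \<le> Max (fibre h v)" if vu: "v \<le> u" "u \<le> Max (fibre h v)"
  proof (rule ccontr)
    define J where "J = Max (fibre h v)"
    define K where "K = Max (fibre h u)"
    assume "\<not> Max (fibre h u) \<le> Max (fibre h v)"
    then have JK: "J < K" by (simp add: J_def K_def)
    have J: "J \<in> {1..N}" "leader h J = v" using Mv by (auto simp: J_def fibre_def)
    have K: "K \<in> {1..N}" "leader h K = u" using Mu by (auto simp: K_def fibre_def)
    have "u \<noteq> v" using JK by (auto simp: J_def K_def)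
    have pu: "u = Suc (parent h K)" "v = Suc (parent h J)" using J K by (auto simp: leader_def)
    have J': "0 < J" "J \<le> N" and K': "0 < K" "K \<le> N" using J K by auto
    have lt: "parent h J < parent h K" "parent h K < J" 
      using vu \<open>u \<noteq> v\<close> pu unfolding J_def[symmetric] by linarith+
    have "excess h K < excess h J" using excess_after_parent[OF K', of J] lt JK by simp
    moreover have "excess h J < excess h (parent h K)" using excess_after_parent[OF J'] lt by simp
    ultimately show False using excess_parent[OF K'] by simp
  qed
  then show ?thesis using uM unfolding block_le_def Min_fibre[OF u] Min_fibre[OF v] by auto
qed

text \<open>Run lengths over the nested blocks telescope to n = h J - h (v - 1), with J the last
  label of the block. For l = J - v + 1 the number b * n - a * l is the excess of J minus that of
  its parent, hence positive and at most a < b; so n is the ceiling of l * a / b.\<close>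

lemma block_rank_fibre:
  assumes v: "v \<in> leader h ` {1..N}"
  shows "block_rank a b (blocks h) (fibre h v) = int (h v) - int (h (v - 1))"
proof -
  define r where "r B = (if B \<in> blocks h then int (h (Min B)) - int (h (Min B - 1)) else 0)" for B
  have r_fibre: "r (fibre h v) = int (h v) - int (h (v - 1))" if "v \<in> leader h ` {1..N}" for v
    using that Min_fibre by (simp add: r_def blocks_def)
  have "is_block_rank a b (blocks h) r" unfolding is_block_rank_def
  proof (intro conjI ballI allI impI)
    fix B assume "B \<in> blocks h"
    then obtain v where v: "v \<in> leader h ` {1..N}" and B: "B = fibre h v" by (auto simp: blocks_def)
    define J where "J = Max B"
    have J_in: "J \<in> fibre h v" unfolding J_def B using finite_fibre leader_in_fibre[OF v] Max_in by blast
    then have J: "J \<in> {1..N}" "leader h J = v" by (auto simp: fibre_def)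
    have last: "m \<le> J" if "m \<in> {1..N}" "leader h m = leader h J" for m
      unfolding J_def B by (rule Max_ge[OF finite_fibre]) (use that J in \<open>simp add: fibre_def\<close>)
    have vJ: "v \<le> J" "0 < v" using leader_bounds[OF J(1)] J by auto
    have "{B'. B' \<in> blocks h \<and> B' \<preceq> B} = fibre h ` {u. u \<in> leader h ` {1..N} \<and> v \<le> u \<and> u \<le> J}"
      unfolding blocks_def B J_def using block_le_iff[OF _ v] by blast
    moreover have "inj_on (fibre h) {u. u \<in> leader h ` {1..N} \<and> v \<le> u \<and> u \<le> J}"
      using fibre_eq_iff by (intro inj_onI) blast
    ultimately have "(\<Sum>B' | B' \<in> blocks h \<and> B' \<preceq> B. r B')
        = (\<Sum>u | u \<in> leader h ` {1..N} \<and> v \<le> u \<and> u \<le> J. r (fibre h u))"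
      by (simp only: sum.reindex comp_def)
    also have "\<dots> = (\<Sum>u | u \<in> leader h ` {1..N} \<and> v \<le> u \<and> u \<le> J. int (h u) - int (h (u - 1)))"
      using r_fibre by (intro sum.cong) auto
    also have "\<dots> = int (h J) - int (h (v - 1))"
      by (rule sum_leaders) (use vJ J in auto)
    also have "\<dots> = \<lceil>real (Max B - Min B + 1) * (real a / real b)\<rceil>"
    proof (rule ceiling_unique[symmetric])
      define n where "n = int (h J) - int (h (v - 1))"
      define l where "l = J - v + 1"
      have Bl: "Max B - Min B + 1 = l" using Min_fibre[OF v] by (simp add: l_def J_def B)
      have lJ: "int l = int J - int (v - 1)" using vJ by (simp add: l_def of_nat_diff)
      have ex: "excess h J - excess h (v - 1) = int b * n - int a * int l"
        unfolding excess_def n_def lJ by (simp add: algebra_simps)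
      have J0: "0 < J" "J \<le> N" using J by auto
      have "excess h (v - 1) < excess h J" using excess_parent[OF J0] J(2) by (auto simp: leader_def)
      then have low: "int a * int l < int b * n" using ex by simp
      have "excess h J - excess h (v - 1) \<le> int a" using excess_last_in_block[OF J(1) last] J(2) by simp
      then have "int b * n - int a * int l < int b" using ex a_less by linarith
      then have high: "int b * (n - 1) < int a * int l" by (simp add: algebra_simps)
      have b: "real b > 0" using b_eq by simp
      have "real_of_int (int b * (n - 1)) < real_of_int (int a * int l)" using high by (simp only: of_int_less_iff)
      then have "(of_int n - 1) * real b < real l * real a" by (simp add: algebra_simps)
      then have "of_int n - 1 < real l * real a / real b" using b by (simp only: pos_less_divide_eq)
      then show "of_int (int (h J) - int (h (v - 1))) - 1 < real (Max B - Min B + 1) * (real a / real b)"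
        unfolding Bl n_def[symmetric] by simp
      have "real_of_int (int a * int l) < real_of_int (int b * n)" using low by (simp only: of_int_less_iff)
      then have "real l * real a \<le> of_int n * real b" by (simp add: algebra_simps)
      then have "real l * real a / real b \<le> of_int n" using b by (simp only: pos_divide_le_eq)
      then show "real (Max B - Min B + 1) * (real a / real b) \<le> of_int (int (h J) - int (h (v - 1)))"
        unfolding Bl n_def[symmetric] by simp
    qed
    finally show "(\<Sum>B' | B' \<in> blocks h \<and> B' \<preceq> B. r B') = \<lceil>real (Max B - Min B + 1) * (real a / real b)\<rceil>" .
  qed (simp add: r_def)
  moreover have "\<exists>!r. is_block_rank a b (blocks h) r"
  proof (rule ex1_is_block_rank)
    show "finite (blocks h)" by (simp add: blocks_def)
    show "disjoint (blocks h)" by (auto simp: blocks_def fibre_def disjoint_def)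
    show "finite B \<and> B \<noteq> {}" if "B \<in> blocks h" for B
      using that finite_fibre leader_in_fibre by (auto simp: blocks_def)
  qed
  ultimately have "block_rank a b (blocks h) = r" unfolding block_rank_def by (rule the1_equality[rotated])
  then show ?thesis using r_fibre[OF v] by simp
qed

end

context rational_slope
begin

section \<open>Noncrossing parking functions as classical parking functions\<close>

definition park_of :: "(nat \<Rightarrow> nat) \<Rightarrow> nat set set \<times> (nat set \<Rightarrow> nat set)" where
  "park_of x = (blocks (ht x), \<lambda>B\<in>blocks (ht x). {k\<in>{1..a}. x k = Min B})"

lemma card_eq_ht_diff:
  assumes "0 < v"
  shows "int (card {k\<in>{1..a}. x k = v}) = int (ht x v) - int (ht x (v - 1))"
proof -
  have "{k\<in>{1..a}. v - 1 < x k \<and> x k \<le> v - 1 + 1} = {k\<in>{1..a}. x k = v}" using assms by auto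
  then show ?thesis using ht_add[of x "v - 1" 1] assms by simp
qed

lemma parking_in_leaders: "x \<in> parking \<Longrightarrow> k \<in> {1..a} \<Longrightarrow> x k \<in> leader (ht x) ` {1..N}"
  using leader_parking parking_in by (metis imageI)

lemma park_of_in:
  assumes NC: "\<And>h. heights h \<Longrightarrow> blocks h \<in> NC a b" and x: "x \<in> parking"
  shows "park_of x \<in> Park_NC a b"
proof -
  interpret path_heights a b N "ht x" by (rule path_heights_ht[OF x])
  let ?\<pi> = "blocks (ht x)" and ?f = "\<lambda>B\<in>blocks (ht x). {k\<in>{1..a}. x k = Min B}"
  have "?\<pi> \<in> NC a b" by (rule NC[OF heights])
  moreover have "?f \<in> ?\<pi> \<rightarrow>\<^sub>E Pow {1..a}" by auto
  moreover have "disjoint_family_on ?f ?\<pi>"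
    using Min_fibre by (auto simp: disjoint_family_on_def blocks_def)
  moreover have "(\<Union>B\<in>?\<pi>. ?f B) = {1..a}"
  proof (intro subset_antisym subsetI)
    fix k assume k: "k \<in> {1..a}"
    have v: "x k \<in> leader (ht x) ` {1..N}" by (rule parking_in_leaders[OF x k])
    then have "fibre (ht x) (x k) \<in> ?\<pi>" by (auto simp: blocks_def)
    then show "k \<in> (\<Union>B\<in>?\<pi>. ?f B)" using k Min_fibre[OF v] by force
  qed auto
  moreover have "int (card (?f B)) = block_rank a b ?\<pi> B" if B: "B \<in> ?\<pi>" for B
  proof -
    obtain v where v: "v \<in> leader (ht x) ` {1..N}" "B = fibre (ht x) v" using B by (auto simp: blocks_def)
    have "?f B = {k\<in>{1..a}. x k = v}" using B v Min_fibre by simp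
    moreover have "0 < v" using v(1) leader_image_iff[of v] by simp
    ultimately show ?thesis using card_eq_ht_diff[of v x] block_rank_fibre[OF v(1)] v(2) by simp
  qed
  ultimately show ?thesis by (simp add: park_of_def Park_NC_def)
qed

lemma inj_on_park_of: "inj_on park_of parking"
proof (rule inj_onI)
  fix x y assume x: "x \<in> parking" and y: "y \<in> parking" and eq: "park_of x = park_of y"
  interpret path_heights a b N "ht x" by (rule path_heights_ht[OF x])
  show "x = y"
  proof (rule extensionalityI[OF parking_extensional[OF x] parking_extensional[OF y]])
    fix k assume k: "k \<in> {1..a}"
    have v: "x k \<in> leader (ht x) ` {1..N}" by (rule parking_in_leaders[OF x k])
    define B where "B = fibre (ht x) (x k)"
    have B: "B \<in> blocks (ht x)" using v by (auto simp: blocks_def B_def)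
    have MB: "Min B = x k" using Min_fibre[OF v] by (simp add: B_def)
    have "blocks (ht x) = blocks (ht y)" using eq by (simp add: park_of_def)
    moreover have "snd (park_of x) B = snd (park_of y) B" using eq by simp
    ultimately have same: "{j\<in>{1..a}. x j = Min B} = {j\<in>{1..a}. y j = Min B}" using B by (simp add: park_of_def)
    have "k \<in> {j\<in>{1..a}. x j = Min B}" using k MB by simp
    then have "k \<in> {j\<in>{1..a}. y j = Min B}" unfolding same .
    then show "x k = y k" using MB by simp
  qed
qed

text \<open>The preimage x sends k to the minimum of the block whose label set contains k. By the
  rank condition each minimum is hit as often as the run of h there is long, which gives
  \<open>ht x = h\<close>.\<close>

lemma park_of_surj:
  assumes NC: "\<And>\<pi>. \<pi> \<in> NC a b \<Longrightarrow> \<exists>h. heights h \<and> \<pi> = blocks h" and p: "p \<in> Park_NC a b"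
  shows "p \<in> park_of ` parking"
proof -
  obtain \<pi> f where pf: "p = (\<pi>, f)" by (cases p)
  have f: "\<pi> \<in> NC a b" "f \<in> \<pi> \<rightarrow>\<^sub>E Pow {1..a}" "disjoint_family_on f \<pi>" "(\<Union>B\<in>\<pi>. f B) = {1..a}"
    "\<And>B. B \<in> \<pi> \<Longrightarrow> int (card (f B)) = block_rank a b \<pi> B"
    using p by (auto simp: pf Park_NC_def)
  obtain h where h: "heights h" and \<pi>: "\<pi> = blocks h" using NC[OF f(1)] by blast
  interpret path_heights a b N h
    by (intro path_heights.intro path_heights_axioms.intro rational_slope_axioms h)
  define x where "x = (\<lambda>k\<in>{1..a}. Min (THE B. B \<in> \<pi> \<and> k \<in> f B))"
  have x_eq: "x k = Min B" if "B \<in> \<pi>" "k \<in> f B" for k B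
  proof -
    have "(THE B. B \<in> \<pi> \<and> k \<in> f B) = B"
      using that f(3) by (intro the_equality) (auto simp: disjoint_family_on_def)
    moreover have "k \<in> {1..a}" using that f(4) by blast
    ultimately show ?thesis by (simp add: x_def)
  qed
  have in_block: "\<exists>v\<in>leader h ` {1..N}. k \<in> f (fibre h v)" if "k \<in> {1..a}" for k
    using that f(4) \<pi> by (auto simp: blocks_def)
  have x_fibre: "x k = v" if "v \<in> leader h ` {1..N}" "k \<in> f (fibre h v)" for v k
    using x_eq[of "fibre h v" k] that Min_fibre by (simp add: \<pi> blocks_def)
  have fib: "f (fibre h v) = {k\<in>{1..a}. x k = v}" if v: "v \<in> leader h ` {1..N}" for v
  proof (intro subset_antisym subsetI)
    fix k assume k: "k \<in> f (fibre h v)"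
    then have "k \<in> {1..a}" using f(4) v by (auto simp: \<pi> blocks_def)
    then show "k \<in> {k\<in>{1..a}. x k = v}" using x_fibre[OF v k] by simp
  next
    fix k assume k: "k \<in> {k\<in>{1..a}. x k = v}"
    then obtain u where u: "u \<in> leader h ` {1..N}" "k \<in> f (fibre h u)" using in_block by blast
    then have "u = v" using x_fibre[OF u] k by simp
    then show "k \<in> f (fibre h v)" using u by simp
  qed
  have xr: "x \<in> {1..a} \<rightarrow>\<^sub>E {1..N}"
  proof (rule PiE_I)
    fix k assume "k \<in> {1..a}"
    then obtain v where v: "v \<in> leader h ` {1..N}" "x k = v" using in_block x_fibre by blast
    then show "x k \<in> {1..N}" using leader_image_iff[of v] by simp
  qed (auto simp: x_def)
  have card_f: "int (card {k\<in>{1..a}. x k = v}) = int (h v) - int (h (v - 1))"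
    if "v \<in> leader h ` {1..N}" for v
    using f(5)[of "fibre h v"] block_rank_fibre[OF that] fib[OF that] that by (simp add: \<pi> blocks_def)
  have ht_x: "ht x = h"
  proof
    fix m
    show "ht x m = h m"
    proof (cases "m \<le> N")
      case True
      have "{k\<in>{1..a}. x k \<le> m} = (\<Union>v\<in>{v. v \<in> leader h ` {1..N} \<and> 1 \<le> v \<and> v \<le> m}. {k\<in>{1..a}. x k = v})"
      proof (intro subset_antisym subsetI)
        fix k assume k: "k \<in> {k\<in>{1..a}. x k \<le> m}"
        then obtain v where v: "v \<in> leader h ` {1..N}" "x k = v" using in_block x_fibre by blast
        have v1: "1 \<le> v" using v(1) leader_image_iff[of v] by simp
        have vm: "v \<le> m" using k v(2) by simp
        have kv: "k \<in> {k\<in>{1..a}. x k = v}" using k v(2) by simp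
        show "k \<in> (\<Union>v\<in>{v. v \<in> leader h ` {1..N} \<and> 1 \<le> v \<and> v \<le> m}. {k\<in>{1..a}. x k = v})"
          by (rule UN_I[of v]) (intro CollectI conjI v(1) v1 vm, rule kv)
      qed auto
      then have "ht x m = card (\<Union>v\<in>{v. v \<in> leader h ` {1..N} \<and> 1 \<le> v \<and> v \<le> m}. {k\<in>{1..a}. x k = v})"
        by (simp only: ht_def)
      also have "\<dots> = (\<Sum>v | v \<in> leader h ` {1..N} \<and> 1 \<le> v \<and> v \<le> m. card {k\<in>{1..a}. x k = v})"
      proof (rule card_UN_disjoint)
        show "finite {v. v \<in> leader h ` {1..N} \<and> 1 \<le> v \<and> v \<le> m}" by simp
      qed (simp, blast)
      finally have "ht x m = (\<Sum>v | v \<in> leader h ` {1..N} \<and> 1 \<le> v \<and> v \<le> m. card {k\<in>{1..a}. x k = v})" .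
      then have "int (ht x m) = (\<Sum>v | v \<in> leader h ` {1..N} \<and> 1 \<le> v \<and> v \<le> m. int (card {k\<in>{1..a}. x k = v}))"
        by simp
      also have "\<dots> = (\<Sum>v | v \<in> leader h ` {1..N} \<and> 1 \<le> v \<and> v \<le> m. int (h v) - int (h (v - 1)))"
        using card_f by (intro sum.cong) auto
      also have "\<dots> = int (h m) - int (h (1 - 1))" by (rule sum_leaders) (use True in auto)
      finally show ?thesis by simp
    next
      case False
      then show ?thesis using ht_top[OF xr, of m] h_N[of m] by simp
    qed
  qed
  have "a * m \<le> b * h m" if "m \<le> N" for m
  proof -
    have "m \<le> b" using that b_eq by linarith
    then show ?thesis using h by (simp add: heights_def)
  qed
  then have "x \<in> parking" using xr ht_x by (simp add: parking_def)
  moreover have "park_of x = p"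
  proof -
    have "f = (\<lambda>B\<in>\<pi>. {k\<in>{1..a}. x k = Min B})"
    proof (rule extensionalityI[of _ \<pi>])
      fix B assume "B \<in> \<pi>"
      then obtain v where "v \<in> leader h ` {1..N}" "B = fibre h v" by (auto simp: \<pi> blocks_def)
      then show "f B = (\<lambda>B\<in>\<pi>. {k\<in>{1..a}. x k = Min B}) B" using fib Min_fibre \<open>B \<in> \<pi>\<close> by simp
    qed (use f(2) in \<open>auto simp: PiE_iff\<close>)
    then show ?thesis by (simp add: park_of_def pf ht_x \<pi>)
  qed
  ultimately show ?thesis by blast
qed

lemma rot_eq_residue: "m \<in> {1..N} \<Longrightarrow> rot b m = residue (int m + 1)"
  unfolding rot_def b_minus_1 using residue_Suc[of "int m"] residue_of_nat[of m] by auto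

text \<open>\<open>rot_act\<close> takes preimages in all of the naturals, so injectivity is shown
  there, by an explicit left inverse.\<close>

lemma inj_rot: "inj (rot b)"
proof (rule inj_on_inverseI)
  fix i
  show "(\<lambda>j. if 1 < j \<and> j \<le> N then j - 1 else if j = 1 then N else j) (rot b i) = i"
    using N_pos unfolding rot_def b_minus_1 by (cases "i = N"; cases "i < N"; cases "i = 0") simp_all
qed

lemma rot_image: "rot b ` {1..N} = {1..N}"
proof (rule endo_inj_surj)
  show "rot b ` {1..N} \<subseteq> {1..N}" using rot_eq_residue residue_range by auto
qed (use inj_rot in \<open>auto intro: inj_on_subset\<close>)

lemma rot_fibre:
  assumes x: "x \<in> parking" and v: "v \<in> leader (ht x) ` {1..N}"
  shows "rot b ` fibre (ht x) v = fibre (ht (rho x)) (if v = leader (ht x) N then 1 else Suc v)"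
proof -
  have v0: "0 < v" using v by (auto simp: leader_def)
  have lead: "leader (ht (rho x)) (rot b m) = (if leader (ht x) m = leader (ht x) N then 1 else Suc (leader (ht x) m))"
    if "m \<in> {1..N}" for m
    using lead_rho[OF x, of "int m"] residue_of_nat[OF that] rot_eq_residue[OF that] by (simp add: lead_def)
  have "fibre (ht (rho x)) (if v = leader (ht x) N then 1 else Suc v) =
      {j \<in> rot b ` {1..N}. leader (ht (rho x)) j = (if v = leader (ht x) N then 1 else Suc v)}"
    unfolding rot_image fibre_def ..
  also have "\<dots> = rot b ` {m\<in>{1..N}. leader (ht (rho x)) (rot b m) = (if v = leader (ht x) N then 1 else Suc v)}"
    by auto
  also have "{m\<in>{1..N}. leader (ht (rho x)) (rot b m) = (if v = leader (ht x) N then 1 else Suc v)} = fibre (ht x) v"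
  proof -
    have "leader (ht (rho x)) (rot b m) = (if v = leader (ht x) N then 1 else Suc v) \<longleftrightarrow> leader (ht x) m = v"
      if "m \<in> {1..N}" for m
    proof -
      have "0 < leader (ht x) m" by (simp add: leader_def)
      then show ?thesis unfolding lead[OF that] using v0 by simp
    qed
    then show ?thesis by (auto simp: fibre_def)
  qed
  finally show ?thesis ..
qed

lemma rot_act_park_of:
  assumes x: "x \<in> parking"
  shows "rot_act b (park_of x) = park_of (rho x)"
proof -
  interpret path_heights a b N "ht x" by (rule path_heights_ht[OF x])
  interpret rho: path_heights a b N "ht (rho x)" by (rule path_heights_ht[OF rho_parking[OF x]])
  define g where "g v = (if v = leader (ht x) N then 1 else Suc v)" for v
  have lead: "leader (ht (rho x)) (rot b m) = g (leader (ht x) m)" if "m \<in> {1..N}" for m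
    using lead_rho[OF x, of "int m"] residue_of_nat[OF that] rot_eq_residue[OF that]
    by (simp add: lead_def g_def)
  have leaders: "leader (ht (rho x)) ` {1..N} = g ` leader (ht x) ` {1..N}"
  proof -
    have "leader (ht (rho x)) ` {1..N} = leader (ht (rho x)) ` rot b ` {1..N}" by (simp only: rot_image)
    also have "\<dots> = g ` leader (ht x) ` {1..N}" unfolding image_image using lead by (intro image_cong) auto
    finally show ?thesis .
  qed
  have fib: "rot b ` fibre (ht x) v = fibre (ht (rho x)) (g v)" if "v \<in> leader (ht x) ` {1..N}" for v
    using rot_fibre[OF x that] by (simp only: g_def)
  have blocks: "(\<lambda>B. rot b ` B) ` blocks (ht x) = blocks (ht (rho x))"
    unfolding blocks_def leaders image_image[of "\<lambda>B. rot b ` B"] image_image[of "fibre (ht (rho x))"]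
    using fib by (intro image_cong) auto
  have "(\<lambda>B\<in>blocks (ht (rho x)). snd (park_of x) (rot b -` B)) =
      (\<lambda>B\<in>blocks (ht (rho x)). {k\<in>{1..a}. rho x k = Min B})"
  proof (rule restrict_ext)
    fix B' assume "B' \<in> blocks (ht (rho x))"
    then obtain v where v: "v \<in> leader (ht x) ` {1..N}" and B': "B' = fibre (ht (rho x)) (g v)"
      unfolding blocks_def leaders by blast
    have MB': "Min B' = g v" unfolding B' by (rule rho.Min_fibre) (use v leaders in blast)
    have "rot b -` B' = fibre (ht x) v"
      unfolding B' fib[OF v, symmetric] by (rule inj_vimage_image_eq[OF inj_rot])
    then have "snd (park_of x) (rot b -` B') = {k\<in>{1..a}. x k = v}"
      using v Min_fibre[OF v] by (auto simp: park_of_def blocks_def)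
    also have "\<dots> = {k\<in>{1..a}. rho x k = g v}"
    proof -
      have "x k = v \<longleftrightarrow> rho x k = g v" if "k \<in> {1..a}" for k
        using that parking_in[OF x that] v leader_image_iff[of v] by (simp add: rho_def g_def)
      then show ?thesis by blast
    qed
    finally show "snd (park_of x) (rot b -` B') = {k\<in>{1..a}. rho x k = Min B'}" unfolding MB' .
  qed
  moreover have "fst (park_of x) = blocks (ht x)" by (simp add: park_of_def)
  ultimately show ?thesis unfolding rot_act_def Let_def by (simp only: blocks) (simp add: park_of_def)
qed

lemma funpow_rot_act_park_of:
  "x \<in> parking \<Longrightarrow> (rot_act b ^^ d) (park_of x) = park_of ((rho ^^ d) x)"
  by (induction d) (simp_all add: rot_act_park_of funpow_rho_parking)

text \<open>\<open>perm_act\<close> pushes labels forward, so the block now carrying k carried the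
  preimage of k under w before.\<close>

lemma perm_act_park_of:
  assumes w: "w permutes {1..a}"
  shows "perm_act w (park_of x) = park_of (x \<circ> inv_into UNIV w)"
proof -
  have wi: "inv_into UNIV w permutes {1..a}" by (rule permutes_inv[OF w])
  have "w ` {k\<in>{1..a}. x k = v} = {k\<in>{1..a}. x (inv_into UNIV w k) = v}" for v
  proof (intro subset_antisym subsetI)
    fix k assume "k \<in> {k\<in>{1..a}. x (inv_into UNIV w k) = v}"
    then show "k \<in> w ` {k\<in>{1..a}. x k = v}"
      using permutes_inverses(1)[OF w, of k] permutes_in_image[OF wi, of k]
      by (intro image_eqI[of _ _ "inv_into UNIV w k"]) auto
  qed (use permutes_inverses(2)[OF w] permutes_in_image[OF w] in auto)
  then show ?thesis
    by (simp add: perm_act_def park_of_def ht_comp_perm[OF wi] restrict_def fun_eq_iff)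
qed

text \<open>The description of \<open>NC a b\<close> by height functions enters as a hypothesis,
  which keeps the geometry of lasers separate; \<open>NC_eq_blocks\<close> supplies it.\<close>

lemma park_char_eq:
  assumes NC: "NC a b = blocks ` {h. heights h}" and w: "w permutes {1..a}"
  shows "park_char a b w d = card {x \<in> parking. (rho ^^ d) x = x \<circ> w}"
proof -
  have Park: "Park_NC a b = park_of ` parking"
  proof (intro subset_antisym subsetI)
    have NC': "\<exists>h. heights h \<and> \<pi> = blocks h" if "\<pi> \<in> NC a b" for \<pi>
      using that unfolding NC by blast
    fix p assume "p \<in> Park_NC a b"
    then show "p \<in> park_of ` parking" by (rule park_of_surj[rotated]) (erule NC')
  next
    have NC': "blocks h \<in> NC a b" if "heights h" for h
      using that unfolding NC by blast
    fix p assume "p \<in> park_of ` parking"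
    then show "p \<in> Park_NC a b" using park_of_in[OF NC'] by blast
  qed
  have "perm_act w ((rot_act b ^^ d) (park_of x)) = park_of x \<longleftrightarrow> (rho ^^ d) x = x \<circ> w"
    if x: "x \<in> parking" for x
  proof -
    have z: "(rho ^^ d) x \<in> parking" by (rule funpow_rho_parking[OF x])
    have "perm_act w ((rot_act b ^^ d) (park_of x)) = park_of ((rho ^^ d) x \<circ> inv_into UNIV w)"
      by (simp only: funpow_rot_act_park_of[OF x] perm_act_park_of[OF w])
    then have "perm_act w ((rot_act b ^^ d) (park_of x)) = park_of x \<longleftrightarrow> (rho ^^ d) x \<circ> inv_into UNIV w = x"
      using inj_on_eq_iff[OF inj_on_park_of parking_comp_perm[OF permutes_inv[OF w] z] x] by simp
    also have "\<dots> \<longleftrightarrow> (rho ^^ d) x = x \<circ> w"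
    proof
      assume "(rho ^^ d) x \<circ> inv_into UNIV w = x"
      then have "x \<circ> w = ((rho ^^ d) x \<circ> inv_into UNIV w) \<circ> w" by (simp only:)
      also have "\<dots> = (rho ^^ d) x \<circ> (inv_into UNIV w \<circ> w)" by (rule comp_assoc)
      finally have "x \<circ> w = (rho ^^ d) x \<circ> (inv_into UNIV w \<circ> w)" .
      then show "(rho ^^ d) x = x \<circ> w" by (simp only: permutes_inv_o(2)[OF w] comp_id)
    next
      assume "(rho ^^ d) x = x \<circ> w"
      then have "(rho ^^ d) x \<circ> inv_into UNIV w = x \<circ> (w \<circ> inv_into UNIV w)" by (simp only: comp_assoc)
      then show "(rho ^^ d) x \<circ> inv_into UNIV w = x" by (simp only: permutes_inv_o(1)[OF w] comp_id)
    qed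
    finally show ?thesis .
  qed
  then have "{p \<in> Park_NC a b. perm_act w ((rot_act b ^^ d) p) = p} = park_of ` {x \<in> parking. (rho ^^ d) x = x \<circ> w}"
    unfolding Park by blast
  then show ?thesis
    unfolding park_char_def by (simp add: card_image inj_on_subset[OF inj_on_park_of])
qed

end

subsection \<open>Lasers of Dyck paths\<close>

lemma path_pt_0 [simp]: "path_pt D 0 = (0, 0)"
  by (simp add: path_pt_def)

lemma path_pt_Suc:
  assumes "k < length D"
  shows "path_pt D (Suc k) =
    (if D ! k = East then (Suc (fst (path_pt D k)), snd (path_pt D k))
     else (fst (path_pt D k), Suc (snd (path_pt D k))))"
  using assms by (cases "D ! k") (auto simp: path_pt_def take_Suc_conv_app_nth)

lemma path_pt_mono:
  assumes "j \<le> k" "k \<le> length D"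
  shows "fst (path_pt D j) \<le> fst (path_pt D k) \<and> snd (path_pt D j) \<le> snd (path_pt D k)"
  using assms
proof (induction k)
  case (Suc k)
  show ?case
  proof (cases "j = Suc k")
    case False
    then show ?thesis using Suc path_pt_Suc[of k D] by auto
  qed simp
qed simp

lemma ex_east_step:
  assumes "0 < i" "i \<le> fst (path_pt D (length D))"
  obtains k where "k < length D" "D ! k = East" "fst (path_pt D k) = i - 1"
proof -
  define k where "k = (LEAST k. i \<le> fst (path_pt D k))"
  have k: "i \<le> fst (path_pt D k)" unfolding k_def by (rule LeastI[of _ "length D"]) (rule assms)
  have le: "k \<le> length D" unfolding k_def by (rule Least_le) (rule assms)
  have "k \<noteq> 0" using k assms(1) by (intro notI) simp
  then obtain j where j: "k = Suc j" by (cases k) auto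
  have "\<not> i \<le> fst (path_pt D j)"
    using not_less_Least[of j "\<lambda>k. i \<le> fst (path_pt D k)"] j by (simp add: k_def)
  then have "D ! j = East \<and> fst (path_pt D j) = i - 1"
    using k path_pt_Suc[of j D] le j by (cases "D ! j = East") auto
  then show thesis using that[of j] le j by simp
qed

lemma east_step_unique:
  assumes "j < length D" "D ! j = East" "k < length D" "D ! k = East"
    and "fst (path_pt D j) = fst (path_pt D k)"
  shows "j = k"
proof -
  have "\<not> j < k" if "j < length D" "D ! j = East" "k < length D" "fst (path_pt D j) = fst (path_pt D k)" for j k
    using path_pt_mono[of "Suc j" k D] path_pt_Suc[of j D] that by auto
  then show ?thesis using assms by (metis linorder_neqE_nat)
qed

lemma east_height_eq:
  assumes "k < length D" "D ! k = East"
  shows "east_height D (Suc (fst (path_pt D k))) = snd (path_pt D k)"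
  unfolding east_height_def
proof (rule the_equality)
  show "\<exists>j<length D. D ! j = East \<and> path_pt D (Suc j) = (Suc (fst (path_pt D k)), snd (path_pt D k))"
    using assms path_pt_Suc[of k D] by (intro exI[of _ k]) simp
  fix y assume "\<exists>j<length D. D ! j = East \<and> path_pt D (Suc j) = (Suc (fst (path_pt D k)), y)"
  then obtain j where j: "j < length D" "D ! j = East" "path_pt D (Suc j) = (Suc (fst (path_pt D k)), y)" by blast
  then have "fst (path_pt D j) = fst (path_pt D k)" "snd (path_pt D j) = y"
    using path_pt_Suc[of j D] by auto
  then show "y = snd (path_pt D k)" using east_step_unique[OF j(1,2) assms] by simp
qed

section \<open>The height function of a Dyck path and its lasers\<close>

context rational_slope
begin

context
  fixes D
  assumes D: "D \<in> dyck_paths a b"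
begin

lemma D_end: "path_pt D (length D) = (b, a)"
  and D_above: "k \<le> length D \<Longrightarrow> real a / real b * real (fst (path_pt D k)) \<le> real (snd (path_pt D k))"
  using D by (auto simp: dyck_paths_def)

definition profile :: "nat \<Rightarrow> nat" where
  "profile m = (if m = 0 then 0 else if m \<le> b then east_height D m else a)"

lemma path_pt_le: "k \<le> length D \<Longrightarrow> fst (path_pt D k) \<le> b \<and> snd (path_pt D k) \<le> a"
  using path_pt_mono[of k "length D" D] D_end by simp

lemma profile_east:
  assumes "k < length D" "D ! k = East"
  shows "profile (Suc (fst (path_pt D k))) = snd (path_pt D k)" "Suc (fst (path_pt D k)) \<le> b"
proof -
  show "Suc (fst (path_pt D k)) \<le> b" using path_pt_le[of "Suc k"] path_pt_Suc[of k D] assms by simp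
  then show "profile (Suc (fst (path_pt D k))) = snd (path_pt D k)"
    using east_height_eq[OF assms] by (simp add: profile_def)
qed

lemma obtain_east:
  assumes "0 < m" "m \<le> b"
  obtains k where "k < length D" "D ! k = East" "path_pt D k = (m - 1, profile m)"
proof -
  obtain k where k: "k < length D" "D ! k = East" "fst (path_pt D k) = m - 1"
    using ex_east_step[of m D] assms D_end by auto
  then have "snd (path_pt D k) = profile m" using profile_east(1)[of k] assms by simp
  then show thesis using that[OF k(1,2)] k(3) by (metis prod.collapse)
qed

lemma profile_le_height:
  assumes k: "k \<le> length D"
  shows "profile (fst (path_pt D k)) \<le> snd (path_pt D k)"
proof (cases "fst (path_pt D k) = 0")
  case False
  define m where "m = fst (path_pt D k)"
  obtain j where j: "j < length D" "D ! j = East" "path_pt D j = (m - 1, profile m)"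
    using obtain_east[of m] False path_pt_le[OF k] by (auto simp: m_def)
  have "\<not> k \<le> j"
  proof
    assume "k \<le> j"
    then have "fst (path_pt D k) \<le> fst (path_pt D j)" using path_pt_mono[of k j D] j(1) by simp
    then show False using j(3) False by (simp add: m_def)
  qed
  then show ?thesis using path_pt_mono[of j k D] k j(3) by (simp add: m_def)
qed (simp add: profile_def)

lemma height_less_profile:
  assumes k: "k < length D" "D ! k = North" and m: "fst (path_pt D k) < b"
  shows "snd (path_pt D k) < profile (Suc (fst (path_pt D k)))"
proof -
  let ?m = "fst (path_pt D k)"
  obtain j where j: "j < length D" "D ! j = East" "path_pt D j = (?m, profile (Suc ?m))"
    using obtain_east[of "Suc ?m"] m by auto
  have "\<not> j < k"
  proof
    assume "j < k"
    then show False using path_pt_mono[of "Suc j" k D] path_pt_Suc[of j D] j k by simp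
  qed
  moreover have "j \<noteq> k" using j k by auto
  ultimately show ?thesis
    using path_pt_mono[of "Suc k" j D] path_pt_Suc[of k D] j k by simp
qed

lemma heights_profile: "heights profile"
proof -
  have le: "profile m \<le> a" for m
  proof (cases "0 < m \<and> m \<le> b")
    case True
    then obtain k where "k < length D" "path_pt D k = (m - 1, profile m)" using obtain_east[of m] by blast
    then show ?thesis using path_pt_le[of k] by simp
  qed (auto simp: profile_def)
  moreover have "profile m \<le> profile (Suc m)" for m
  proof (cases "m < b")
    case True
    then obtain k where "k < length D" "path_pt D k = (m, profile (Suc m))"
      using obtain_east[of "Suc m"] by auto
    then show ?thesis using profile_le_height[of k] by simp
  next
    case False
    then show ?thesis using le[of m] by (simp add: profile_def)
  qed
  then have "mono profile" by (simp add: mono_iff_le_Suc)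
  moreover have "a * m \<le> b * profile m" if mb: "m \<le> b" for m
  proof (cases "m = 0")
    case False
    then obtain k where k: "k < length D" "D ! k = East" "path_pt D k = (m - 1, profile m)"
      using obtain_east[of m] mb by auto
    then have "path_pt D (Suc k) = (m, profile m)" using path_pt_Suc[of k D] False by simp
    then have "real a / real b * real m \<le> real (profile m)" using D_above[of "Suc k"] k by simp
    moreover have "0 < real b" using b_eq by simp
    ultimately have "real a * real m \<le> real b * real (profile m)" by (simp add: field_simps)
    then show ?thesis by (simp flip: of_nat_mult)
  qed simp
  ultimately show ?thesis by (simp add: heights_def profile_def)
qed

interpretation path_heights a b N profile
  by (intro path_heights.intro path_heights_axioms.intro rational_slope_axioms heights_profile)

text \<open>After the east step ending at abscissa p < b the path goes north exactly if the next
  east step is higher. At p = b it has already reached height a, so no north step can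
  follow.\<close>

lemma valleys_eq: "valleys D = {(p, profile p) | p. p \<in> {1..N} \<and> profile p < profile (Suc p)}"
proof (intro subset_antisym subsetI)
  fix P assume "P \<in> valleys D"
  then obtain k where k: "P = path_pt D k" "0 < k" "k < length D" "D ! (k - 1) = East" "D ! k = North"
    by (auto simp: valleys_def)
  obtain j where j: "k = Suc j" using k(2) by (cases k) auto
  have P: "P = (Suc (fst (path_pt D j)), profile (Suc (fst (path_pt D j))))"
    using path_pt_Suc[of j D] profile_east(1)[of j] k j by simp
  define p where "p = Suc (fst (path_pt D j))"
  have "p \<le> b" using profile_east(2)[of j] k j by (simp add: p_def)
  moreover have "p \<noteq> b"
  proof
    assume "p = b"
    then have "snd (path_pt D k) = a" using P k(1) h_N[of b] b_eq by (simp add: p_def)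
    then show False using path_pt_le[of "Suc k"] path_pt_Suc[of k D] k by simp
  qed
  ultimately have pN: "p < b" by simp
  then have "profile p < profile (Suc p)" using height_less_profile[OF k(3,5)] P k(1) by (simp add: p_def)
  moreover have "p \<in> {1..N}" using pN b_eq by (simp add: p_def)
  ultimately show "P \<in> {(p, profile p) | p. p \<in> {1..N} \<and> profile p < profile (Suc p)}"
    using P by (auto simp: p_def)
next
  fix P assume "P \<in> {(p, profile p) | p. p \<in> {1..N} \<and> profile p < profile (Suc p)}"
  then obtain p where p: "P = (p, profile p)" "p \<in> {1..N}" "profile p < profile (Suc p)" by blast
  have "0 < p" "p < b" using p(2) b_eq by auto
  then obtain j where j: "j < length D" "D ! j = East" "path_pt D j = (p - 1, profile p)"
    using obtain_east[of p] by auto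
  have pt: "path_pt D (Suc j) = (p, profile p)" using path_pt_Suc[of j D] j \<open>0 < p\<close> by simp
  have "Suc j \<noteq> length D" using pt D_end \<open>p < b\<close> by auto
  then have lt: "Suc j < length D" using j by simp
  have "D ! Suc j \<noteq> East"
  proof
    assume "D ! Suc j = East"
    then show False using profile_east(1)[OF lt] pt p(3) by simp
  qed
  then have "D ! Suc j = North" by (cases "D ! Suc j") auto
  then show "P \<in> valleys D"
    unfolding valleys_def using pt p(1) lt j(2) by (intro CollectI exI[of _ "Suc j"]) simp
qed

text \<open>For points on vertical steps only a lower bound is kept; a ray strictly below the path
  at integer abscissas misses them already for that reason.\<close>

lemma in_path_curveD:
  assumes "(u, v) \<in> path_curve D"
  shows "(\<exists>m. real m \<le> u \<and> u \<le> real (Suc m) \<and> v = real (profile (Suc m))) \<or>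
    (\<exists>m. u = real m \<and> real (profile m) \<le> v)"
proof -
  obtain k t where k: "k < length D" and t: "0 \<le> t" "t \<le> 1"
    and uv: "(u, v) = (1 - t) *\<^sub>R plane_pt (path_pt D k) + t *\<^sub>R plane_pt (path_pt D (Suc k))"
    using assms by (auto simp: path_curve_def in_segment)
  define m where "m = fst (path_pt D k)"
  define y where "y = snd (path_pt D k)"
  show ?thesis
  proof (cases "D ! k = East")
    case True
    have "u = real m + t" "v = real y"
      using uv path_pt_Suc[OF k] True by (auto simp: plane_pt_def m_def y_def algebra_simps)
    then have "real m \<le> u \<and> u \<le> real (Suc m) \<and> v = real (profile (Suc m))"
      using profile_east(1)[OF k True] t by (simp add: m_def y_def)
    then show ?thesis by blast
  next
    case False
    have "u = real m" "v = real y + t"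
      using uv path_pt_Suc[OF k] False by (auto simp: plane_pt_def m_def y_def algebra_simps)
    then have "u = real m \<and> real (profile m) \<le> v"
      using profile_le_height[of k] k t by (simp add: m_def y_def)
    then show ?thesis by blast
  qed
qed

lemma in_path_curveI:
  assumes "Suc m \<le> b" "real m \<le> u" "u \<le> real (Suc m)"
  shows "(u, real (profile (Suc m))) \<in> path_curve D"
proof -
  obtain k where k: "k < length D" "D ! k = East" "path_pt D k = (m, profile (Suc m))"
    using obtain_east[of "Suc m"] assms(1) by auto
  have "path_pt D (Suc k) = (Suc m, profile (Suc m))" using path_pt_Suc[OF k(1)] k by simp
  then have "(u, real (profile (Suc m))) \<in> closed_segment (plane_pt (path_pt D k)) (plane_pt (path_pt D (Suc k)))"
    unfolding in_segment k(3) plane_pt_def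
    using assms(2,3) by (intro exI[of _ "u - real m"]) (auto simp: algebra_simps)
  then show ?thesis using k(1) by (auto simp: path_curve_def)
qed

lemma excess_less_iff_line:
  assumes "p \<le> m"
  shows "excess profile p < excess profile m \<longleftrightarrow>
    real (profile p) + (real m - real p) / real b * real a < real (profile m)"
proof -
  have b: "0 < real b" using b_eq by simp
  have "excess profile p < excess profile m \<longleftrightarrow> real_of_int (excess profile p) < real_of_int (excess profile m)"
    by (simp only: of_int_less_iff)
  also have "\<dots> \<longleftrightarrow> real b * real (profile p) + (real m - real p) * real a < real b * real (profile m)"
    by (auto simp: excess_def algebra_simps)
  also have "\<dots> \<longleftrightarrow> real b * (real (profile p) + (real m - real p) / real b * real a) < real b * real (profile m)"
  proof -
    have "real b * (real (profile p) + (real m - real p) / real b * real a) =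
        real b * real (profile p) + (real m - real p) * real a"
      using b by (simp add: field_simps)
    then show ?thesis by simp
  qed
  also have "\<dots> \<longleftrightarrow> real (profile p) + (real m - real p) / real b * real a < real (profile m)"
    using b by (simp only: mult_less_cancel_left_pos)
  finally show ?thesis .
qed

text \<open>From a valley the line starts below the next east step, and it could get above the path
  only by meeting an east step. So a clear way to abscissa i means that the line stays below the
  east endpoints before i, and the label condition adds the endpoint i itself.\<close>

lemma label_above_iff:
  assumes p: "p \<in> {1..N}" "profile p < profile (Suc p)" and i: "i \<in> {1..N}"
  shows "label_above D (laser a b D (p, profile p)) i \<longleftrightarrow> lasered profile p i"
proof -
  let ?h = "\<lambda>m. real (profile m)"
  have b: "0 < real b" and a: "0 < real a" using b_eq a_pos by auto
  have "0 < i" "i \<le> b" using i b_eq by auto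
  then have east: "east_height D i = profile i" by (simp add: profile_def)
  define q where "q u = ?h p + (u - real p) / real b * real a" for u
  have q_mono: "u \<le> v \<Longrightarrow> q u \<le> q v" for u v
    using a b by (auto simp: q_def divide_right_mono mult_right_mono)
  have below: "excess profile p < excess profile m \<longleftrightarrow> q (real m) < ?h m" if "p \<le> m" for m
    using excess_less_iff_line[OF that] by (simp add: q_def)
  have ray: "plane_pt (p, profile p) + s *\<^sub>R (real b, real a) = (real p + s * real b, q (real p + s * real b))" for s
    using b by (simp add: plane_pt_def q_def)
  have in_laser: "(real i, y) \<in> laser a b D (p, profile p) \<longleftrightarrow>
      p \<le> i \<and> y = q (real i) \<and> (\<forall>u. real p < u \<and> u < real i \<longrightarrow> (u, q u) \<notin> path_curve D)" for y
  proof
    assume "(real i, y) \<in> laser a b D (p, profile p)"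
    then obtain t where t: "(real i, y) = plane_pt (p, profile p) + t *\<^sub>R (real b, real a)" "0 \<le> t"
      and clear: "\<And>s. 0 < s \<Longrightarrow> s < t \<Longrightarrow> plane_pt (p, profile p) + s *\<^sub>R (real b, real a) \<notin> path_curve D"
      unfolding laser_def by blast
    have it: "real i = real p + t * real b" "y = q (real i)" using t(1) unfolding ray by auto
    have "(u, q u) \<notin> path_curve D" if "real p < u" "u < real i" for u
    proof -
      have "u = real p + ((u - real p) / real b) * real b" using b by simp
      moreover have "(u - real p) / real b < t" using that it b by (simp add: pos_divide_less_eq)
      ultimately show ?thesis using clear[of "(u - real p) / real b"] that b unfolding ray by simp
    qed
    moreover have "real p \<le> real i" using it t(2) b by simp
    ultimately show "p \<le> i \<and> y = q (real i) \<and> (\<forall>u. real p < u \<and> u < real i \<longrightarrow> (u, q u) \<notin> path_curve D)"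
      using it by simp
  next
    assume r: "p \<le> i \<and> y = q (real i) \<and> (\<forall>u. real p < u \<and> u < real i \<longrightarrow> (u, q u) \<notin> path_curve D)"
    define t where "t = (real i - real p) / real b"
    have tb: "t * real b = real i - real p" using b by (simp add: t_def)
    have t0: "0 \<le> t" using r b by (simp add: t_def)
    have "plane_pt (p, profile p) + s *\<^sub>R (real b, real a) \<notin> path_curve D" if "0 < s" "s < t" for s
    proof -
      have "s * real b < t * real b" using that b by simp
      then show ?thesis unfolding ray using r that b tb by auto
    qed
    moreover have "(real i, y) = plane_pt (p, profile p) + t *\<^sub>R (real b, real a)" unfolding ray using r tb by simp
    ultimately show "(real i, y) \<in> laser a b D (p, profile p)" unfolding laser_def using t0 by blast
  qed
  show ?thesis
  proof
    assume "label_above D (laser a b D (p, profile p)) i"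
    \<comment> \<open>Positivity of \<epsilon> is added so that a single sample already yields a
      strict inequality at i.\<close>
    then have "\<forall>\<^sub>F \<epsilon> in at_right 0. (\<exists>y. (real i, y) \<in> laser a b D (p, profile p) \<and> y < ?h i - \<epsilon>) \<and> 0 < \<epsilon>"
      unfolding label_above_def east by (intro eventually_conj eventually_at_right_less)
    then obtain \<epsilon> y where "(real i, y) \<in> laser a b D (p, profile p)" "y < ?h i - \<epsilon>" "(0::real) < \<epsilon>"
      using eventually_happens'[OF trivial_limit_at_right_real] by blast
    then have pi: "p \<le> i" and qi: "q (real i) < ?h i"
      and clear: "\<And>u. real p < u \<Longrightarrow> u < real i \<Longrightarrow> (u, q u) \<notin> path_curve D"
      unfolding in_laser by auto
    have "p \<noteq> i" using qi by (auto simp: q_def)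
    have "q (real m) < ?h m" if "p < m" "m \<le> i" for m
      using that
    proof (induction m rule: less_induct)
      case (less m)
      obtain n where n: "m = Suc n" using less.prems by (cases m) auto
      have "q (real n) < ?h m"
      proof (cases "n = p")
        case True
        then show ?thesis using p(2) n by (simp add: q_def)
      next
        case False
        then have "q (real n) < ?h n" using less n by simp
        moreover have "?h n \<le> ?h m" using h_mono[of n m] n by simp
        ultimately show ?thesis by simp
      qed
      show ?case
      proof (cases "m = i")
        case False
        show ?thesis
        proof (rule ccontr)
          assume not_below: "\<not> q (real m) < ?h m"
          \<comment> \<open>The abscissa at which the line attains the height of the m-th east step;
            it lies on that step, so the laser would stop there before reaching i.\<close>
          define u where "u = real p + (?h m - ?h p) / real a * real b"
          have qu: "q u = ?h m" using a b by (simp add: q_def u_def)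
          have "real n < u" using q_mono[of u "real n"] qu \<open>q (real n) < ?h m\<close> by linarith
          have "\<not> real m < u"
          proof
            assume "real m < u"
            then have "(real m - real p) / real b * real a < (u - real p) / real b * real a"
              using a b by (simp add: divide_strict_right_mono)
            then show False using qu not_below by (simp add: q_def)
          qed
          have "(u, q u) \<in> path_curve D" unfolding qu n
            by (rule in_path_curveI) (use \<open>real n < u\<close> \<open>\<not> real m < u\<close> n less.prems i b_eq in auto)
          moreover have "real p < u" "u < real i"
            using \<open>real n < u\<close> \<open>\<not> real m < u\<close> n less.prems False by auto
          ultimately show False using clear by blast
        qed
      qed (use qi in simp)
    qed
    then show "lasered profile p i"
      unfolding lasered_def using pi \<open>p \<noteq> i\<close> below by auto
  next
    assume l: "lasered profile p i"
    have qm: "q (real m) < ?h m" if "p < m" "m \<le> i" for m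
      using l below[of m] that by (auto simp: lasered_def)
    have pi: "p < i" using l by (simp add: lasered_def)
    have "(u, q u) \<notin> path_curve D" if u: "real p < u" "u < real i" for u
    proof
      assume "(u, q u) \<in> path_curve D"
      from in_path_curveD[OF this] show False
      proof
        assume "\<exists>m. real m \<le> u \<and> u \<le> real (Suc m) \<and> q u = ?h (Suc m)"
        then obtain m where m: "real m \<le> u" "u \<le> real (Suc m)" "q u = ?h (Suc m)" by blast
        have "real p < real (Suc m)" "real m < real i" using u m by linarith+
        then have "p < Suc m" "Suc m \<le> i" by auto
        then show False using qm[of "Suc m"] q_mono[OF m(2)] m(3) by linarith
      next
        assume "\<exists>m. u = real m \<and> ?h m \<le> q u"
        then show False using qm u by fastforce
      qed
    qed
    then have "(real i, q (real i)) \<in> laser a b D (p, profile p)" unfolding in_laser using pi by simp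
    moreover have "q (real i) < ?h i" using qm[of i] pi by simp
    \<comment> \<open>Any \<epsilon> smaller than the gap between the line and the lattice point
      works.\<close>
    ultimately show "label_above D (laser a b D (p, profile p)) i"
      unfolding label_above_def east
      by (intro eventually_at_rightI[of 0 "?h i - q (real i)"]) auto
  qed
qed

text \<open>If p > 0 runs below some label, the excess rises right after p, so p is a valley. Hence
  testing the valleys is the same as testing all p > 0, and \<open>same_lasers_iff\<close>
  applies.\<close>

lemma dyck_partition_eq: "dyck_partition a b D = blocks profile"
proof -
  have iff: "(\<forall>P\<in>valleys D. \<not> separates D (laser a b D P) i j) \<longleftrightarrow> leader profile i = leader profile j"
    if i: "i \<in> {1..N}" and j: "j \<in> {1..N}" for i j
  proof -
    have "(\<forall>P\<in>valleys D. \<not> separates D (laser a b D P) i j) \<longleftrightarrow>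
        (\<forall>p. p \<in> {1..N} \<and> profile p < profile (Suc p) \<longrightarrow> (lasered profile p i \<longleftrightarrow> lasered profile p j))"
      unfolding valleys_eq separates_def using label_above_iff i j by blast
    also have "\<dots> \<longleftrightarrow> (\<forall>p>0. lasered profile p i \<longleftrightarrow> lasered profile p j)"
    proof -
      have "p \<in> {1..N} \<and> profile p < profile (Suc p)" if "0 < p" "lasered profile p m" "m \<in> {1..N}" for p m
      proof -
        have "p < m" "excess profile p < excess profile (Suc p)" using that by (auto simp: lasered_def)
        then show ?thesis using that excess_Suc_less_iff by simp
      qed
      then show ?thesis using i j by (metis One_nat_def Suc_le_lessD atLeastAtMost_iff)
    qed
    also have "\<dots> \<longleftrightarrow> leader profile i = leader profile j"
      using same_lasers_iff[OF i j] by (simp add: leader_def)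
    finally show ?thesis .
  qed
  let ?R = "{(i, j). i \<in> {1..N} \<and> j \<in> {1..N} \<and> (\<forall>P\<in>valleys D. \<not> separates D (laser a b D P) i j)}"
  have "?R `` {i} = fibre profile (leader profile i)" if i: "i \<in> {1..N}" for i
  proof (rule Set.set_eqI)
    fix j
    show "j \<in> ?R `` {i} \<longleftrightarrow> j \<in> fibre profile (leader profile i)"
      unfolding Image_singleton_iff mem_Collect_eq prod.case fibre_def using iff[OF i, of j] i by auto
  qed
  then show ?thesis
    unfolding dyck_partition_def b_minus_1 quotient_def blocks_def by (auto simp: image_iff)
qed

end

section \<open>Dyck paths with a prescribed height function\<close>

definition staircase :: "(nat \<Rightarrow> nat) \<Rightarrow> nat \<Rightarrow> step list" where
  "staircase h n = concat (map (\<lambda>m. replicate (h (Suc m) - h m) North @ [East]) [0..<n])"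

lemma count_list_replicate: "count_list (replicate n x) y = (if x = y then n else 0)"
  by (induction n) auto

lemma path_pt_append: "k \<le> length D \<Longrightarrow> path_pt (D @ E) k = path_pt D k"
  by (simp add: path_pt_def)

text \<open>The induction is joint because the end point in the first claim locates the appended
  vertical run and east step in the other two.\<close>

lemma staircase_props:
  assumes h0: "h 0 = 0" and mono: "mono h"
  shows "path_pt (staircase h n) (length (staircase h n)) = (n, h n)"
    and "k \<le> length (staircase h n) \<Longrightarrow>
      fst (path_pt (staircase h n) k) \<le> n \<and> h (fst (path_pt (staircase h n) k)) \<le> snd (path_pt (staircase h n) k)"
    and "0 < i \<Longrightarrow> i \<le> n \<Longrightarrow> \<exists>k<length (staircase h n). staircase h n ! k = East \<and>
      path_pt (staircase h n) k = (i - 1, h i)"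
proof (induction n arbitrary: k i)
  case 0
  {
    case 1
    then show ?case by (simp add: staircase_def h0)
  next
    case 2
    then show ?case by (simp add: staircase_def h0)
  next
    case 3
    then show ?case by simp
  }
next
  case (Suc n)
  define r where "r = h (Suc n) - h n"
  have hr: "h (Suc n) = h n + r" using monoD[OF mono, of n "Suc n"] by (simp add: r_def)
  define E where "E = staircase h n"
  define S where "S = staircase h (Suc n)"
  have S: "S = E @ replicate r North @ [East]" by (simp add: S_def E_def staircase_def r_def)
  have E_counts: "count_list E East = n" "count_list E North = h n"
    using Suc.IH(1) by (auto simp: E_def path_pt_def)
  have low: "path_pt S k = path_pt E k" if "k \<le> length E" for k
    unfolding S by (rule path_pt_append[OF that])
  have mid: "path_pt S (length E + j) = (n, h n + j)" if "j \<le> r" for j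
    using that E_counts by (simp add: S path_pt_def count_list_replicate min_def)
  have top: "path_pt S (Suc (length E + r)) = (Suc n, h (Suc n))"
    using E_counts hr by (simp add: S path_pt_def count_list_replicate)
  have len: "length S = Suc (length E + r)" by (simp add: S)
  {
    case 1
    then show ?case using top len by (simp add: S_def[symmetric])
  next
    case (2 k)
    then have "k \<le> Suc (length E + r)" using len by (simp add: S_def[symmetric])
    then consider "k \<le> length E" | "length E \<le> k" "k \<le> length E + r" | "k = Suc (length E + r)"
      by linarith
    then show ?case unfolding S_def[symmetric]
    proof cases
      case 1
      then show "fst (path_pt S k) \<le> Suc n \<and> h (fst (path_pt S k)) \<le> snd (path_pt S k)"
        using Suc.IH(2)[of k] low[of k] by (simp add: E_def)
    next
      case 2
      then show "fst (path_pt S k) \<le> Suc n \<and> h (fst (path_pt S k)) \<le> snd (path_pt S k)"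
        using mid[of "k - length E"] by simp
    next
      case 3
      then show "fst (path_pt S k) \<le> Suc n \<and> h (fst (path_pt S k)) \<le> snd (path_pt S k)"
        using top by simp
    qed
  next
    case (3 i)
    show ?case unfolding S_def[symmetric]
    proof (cases "i = Suc n")
      case True
      have "S ! (length E + r) = East" by (simp add: S nth_append)
      then show "\<exists>k<length S. S ! k = East \<and> path_pt S k = (i - 1, h i)"
        using True mid[of r] len hr by (intro exI[of _ "length E + r"]) simp
    next
      case False
      then obtain k where k: "k < length E" "E ! k = East" "path_pt E k = (i - 1, h i)"
        using Suc.IH(3)[of i] 3 by (auto simp: E_def)
      then show "\<exists>k<length S. S ! k = East \<and> path_pt S k = (i - 1, h i)"
        using low[of k] len by (intro exI[of _ k]) (simp add: S nth_append)
    qed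
  }
qed

lemma NC_eq_blocks: "NC a b = blocks ` {h. heights h}"
proof (intro subset_antisym subsetI)
  fix \<pi> assume "\<pi> \<in> NC a b"
  then obtain D where "D \<in> dyck_paths a b" "\<pi> = dyck_partition a b D" by (auto simp: NC_def)
  then show "\<pi> \<in> blocks ` {h. heights h}" using dyck_partition_eq heights_profile by blast
next
  fix \<pi> assume "\<pi> \<in> blocks ` {h. heights h}"
  then obtain h where h: "heights h" "\<pi> = blocks h" by blast
  interpret path_heights a b N h
    by (intro path_heights.intro path_heights_axioms.intro rational_slope_axioms h)
  define D where "D = staircase h b"
  have mono: "mono h" using h by (simp add: heights_def)
  have D: "D \<in> dyck_paths a b" unfolding dyck_paths_def
  proof (intro CollectI conjI allI impI)
    have "h b = a" using h_N[of b] b_eq by simp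
    then show "path_pt D (length D) = (b, a)" using staircase_props(1)[OF h_0 mono, of b] by (simp add: D_def)
    fix k assume "k \<le> length D"
    then have le: "fst (path_pt D k) \<le> b" and hk: "h (fst (path_pt D k)) \<le> snd (path_pt D k)"
      using staircase_props(2)[OF h_0 mono, of k b] by (auto simp: D_def)
    define m where "m = fst (path_pt D k)"
    have "a * m \<le> b * h m" using h(1) le by (simp add: heights_def m_def)
    also have "\<dots> \<le> b * snd (path_pt D k)" using hk by (simp add: m_def)
    finally have "real (a * m) \<le> real (b * snd (path_pt D k))" by (simp only: of_nat_le_iff)
    moreover have "0 < real b" using b_eq by simp
    ultimately show "real a / real b * real (fst (path_pt D k)) \<le> real (snd (path_pt D k))"
      by (simp add: m_def field_simps)
  qed
  have "profile D = h"
  proof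
    fix m
    show "profile D m = h m"
    proof (cases "0 < m \<and> m \<le> b")
      case True
      then obtain k where k: "k < length D" "D ! k = East" "path_pt D k = (m - 1, h m)"
        using staircase_props(3)[OF h_0 mono, of m b] by (auto simp: D_def)
      then show ?thesis using profile_east(1)[OF D k(1,2)] True by simp
    next
      case False
      have "m = 0 \<or> b < m" using False by linarith
      then show ?thesis
      proof
        assume "b < m"
        then have "N \<le> m" using b_eq by linarith
        then show ?thesis using h_N[of m] \<open>b < m\<close> by (simp add: profile_def[OF D])
      qed (simp add: profile_def[OF D])
    qed
  qed
  then have "\<pi> = dyck_partition a b D" using dyck_partition_eq[OF D] h(2) by simp
  then show "\<pi> \<in> NC a b" using D by (auto simp: NC_def)
qed

end

subsection \<open>Eigenspaces of the reflection representation\<close>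

abbreviation (input) diag_coset :: "nat \<Rightarrow> complex vec \<Rightarrow> complex vec set" where
  "diag_coset a x \<equiv> {x + c \<cdot>\<^sub>v vec a (\<lambda>_. 1) | c. True}"

lemma diag_coset_eq_iff:
  assumes x: "x \<in> carrier_vec a" and y: "y \<in> carrier_vec a"
  shows "diag_coset a x = diag_coset a y \<longleftrightarrow> (\<exists>c. x = y + c \<cdot>\<^sub>v vec a (\<lambda>_. 1))"
proof
  have "x = x + 0 \<cdot>\<^sub>v vec a (\<lambda>_. 1)" using x by (intro eq_vecI) auto
  then have "x \<in> diag_coset a x" by blast
  moreover assume "diag_coset a x = diag_coset a y"
  ultimately have "x \<in> diag_coset a y" by (simp only:)
  then show "\<exists>c. x = y + c \<cdot>\<^sub>v vec a (\<lambda>_. 1)" by blast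
next
  assume "\<exists>c. x = y + c \<cdot>\<^sub>v vec a (\<lambda>_. 1)"
  then obtain c where c: "x = y + c \<cdot>\<^sub>v vec a (\<lambda>_. 1)" by blast
  have 1: "x + e \<cdot>\<^sub>v vec a (\<lambda>_. 1) = y + (c + e) \<cdot>\<^sub>v vec a (\<lambda>_. 1)" for e
    using y by (intro eq_vecI) (auto simp: c)
  have 2: "y + e \<cdot>\<^sub>v vec a (\<lambda>_. 1) = x + (e - c) \<cdot>\<^sub>v vec a (\<lambda>_. 1)" for e
    using y by (intro eq_vecI) (auto simp: c algebra_simps)
  show "diag_coset a x = diag_coset a y" using 1 2 by blast
qed

lemma perm_mat_mult_index:
  assumes w: "w permutes {1..a}" and x: "x \<in> carrier_vec a" and k: "k \<in> {1..a}"
  shows "(perm_mat a w *\<^sub>v x) $ (w k - 1) = x $ (k - 1)"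
proof -
  have wk: "w k \<in> {1..a}" using permutes_in_image[OF w] k by simp
  have i: "w k - 1 < a" "w k - 1 + 1 = w k" using wk by auto
  have "(perm_mat a w *\<^sub>v x) $ (w k - 1) = (\<Sum>j<a. (if w (j + 1) = w k - 1 + 1 then 1 else 0) * x $ j)"
    using i(1) x by (simp add: perm_mat_def scalar_prod_def row_def lessThan_atLeast0)
  also have "\<dots> = (\<Sum>j<a. (if w (j + 1) = w k then 1 else 0) * x $ j)" unfolding i(2) ..
  also have "\<dots> = (\<Sum>j<a. if j = k - 1 then x $ j else 0)"
  proof (rule sum.cong)
    fix j assume "j \<in> {..<a}"
    have "w (j + 1) = w k \<longleftrightarrow> j + 1 = k" using permutes_inj[OF w] by (simp add: inj_eq)
    then show "(if w (j + 1) = w k then 1 else 0) * x $ j = (if j = k - 1 then x $ j else 0)"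
      using k by auto
  qed simp
  also have "\<dots> = x $ (k - 1)" using k by (simp add: sum.delta) auto
  finally show ?thesis .
qed

section \<open>Eigenvectors for a root of unity of exact order \<open>q\<close>\<close>

context
  fixes a q :: nat and w :: "nat \<Rightarrow> nat" and z :: complex
  assumes a_pos: "0 < a" and w: "w permutes {1..a}" and z_ord: "\<And>l. z ^ l = 1 \<longleftrightarrow> q dvd l" and q_pos: "0 < q"
begin

lemma z_nonzero: "z \<noteq> 0"
proof
  assume "z = 0"
  moreover have "z ^ q = 1" using z_ord by simp
  ultimately show False using zero_power[OF q_pos, where 'a = complex] by simp
qed

lemma eigenvector_iff:
  assumes x: "x \<in> carrier_vec a"
  shows "perm_mat a w *\<^sub>v x = z \<cdot>\<^sub>v x + c \<cdot>\<^sub>v vec a (\<lambda>_. 1) \<longleftrightarrow>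
    (\<forall>k\<in>{1..a}. x $ (k - 1) = z * x $ (w k - 1) + c)"
proof
  assume eq: "perm_mat a w *\<^sub>v x = z \<cdot>\<^sub>v x + c \<cdot>\<^sub>v vec a (\<lambda>_. 1)"
  show "\<forall>k\<in>{1..a}. x $ (k - 1) = z * x $ (w k - 1) + c"
  proof
    fix k assume k: "k \<in> {1..a}"
    have "w k \<in> {1..a}" using permutes_in_image[OF w] k by simp
    then have "w k - 1 < a" by auto
    then show "x $ (k - 1) = z * x $ (w k - 1) + c"
      using perm_mat_mult_index[OF w x k] x by (simp add: eq)
  qed
next
  assume eq: "\<forall>k\<in>{1..a}. x $ (k - 1) = z * x $ (w k - 1) + c"
  show "perm_mat a w *\<^sub>v x = z \<cdot>\<^sub>v x + c \<cdot>\<^sub>v vec a (\<lambda>_. 1)"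
  proof (rule eq_vecI)
    fix i assume "i < dim_vec (z \<cdot>\<^sub>v x + c \<cdot>\<^sub>v vec a (\<lambda>_. 1))"
    then have i: "i < a" using x by simp
    define k where "k = inv_into UNIV w (i + 1)"
    have k: "k \<in> {1..a}" "w k = i + 1"
      using i permutes_in_image[OF permutes_inv[OF w], of "i + 1"] permutes_inverses(1)[OF w]
      by (auto simp: k_def)
    then have "(perm_mat a w *\<^sub>v x) $ i = x $ (k - 1)" using perm_mat_mult_index[OF w x k(1)] by simp
    also have "\<dots> = z * x $ i + c" using eq k by auto
    finally show "(perm_mat a w *\<^sub>v x) $ i = (z \<cdot>\<^sub>v x + c \<cdot>\<^sub>v vec a (\<lambda>_. 1)) $ i" using i x by simp
  qed (use x in \<open>simp add: perm_mat_def\<close>)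
qed

text \<open>Membership in the eigenspace of the permutation representation before passing to the
  quotient, so the zero vector is included.\<close>

definition eigvec :: "complex vec \<Rightarrow> bool" where
  "eigvec x \<longleftrightarrow> x \<in> carrier_vec a \<and> (\<forall>k\<in>{1..a}. x $ (k - 1) = z * x $ (w k - 1))"

lemma eigvec_carrier: "eigvec x \<Longrightarrow> x \<in> carrier_vec a"
  by (simp add: eigvec_def)

lemma eigvec_add: "eigvec x \<Longrightarrow> eigvec y \<Longrightarrow> eigvec (x + y)"
  and eigvec_smult: "eigvec x \<Longrightarrow> eigvec (r \<cdot>\<^sub>v x)"
proof -
  have wk: "w k - 1 < a" "k - 1 < a" if "k \<in> {1..a}" for k
    using that permutes_in_image[OF w, of k] by auto
  assume x: "eigvec x"
  then have xk: "x \<in> carrier_vec a" "\<And>k. k \<in> {1..a} \<Longrightarrow> x $ (k - 1) = z * x $ (w k - 1)"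
    by (auto simp: eigvec_def)
  show "eigvec (r \<cdot>\<^sub>v x)" unfolding eigvec_def
  proof (intro conjI ballI)
    fix k assume k: "k \<in> {1..a}"
    show "(r \<cdot>\<^sub>v x) $ (k - 1) = z * (r \<cdot>\<^sub>v x) $ (w k - 1)" using xk(1) xk(2)[OF k] wk[OF k] by simp
  qed (use xk in simp)
  assume y: "eigvec y"
  then have yk: "y \<in> carrier_vec a" "\<And>k. k \<in> {1..a} \<Longrightarrow> y $ (k - 1) = z * y $ (w k - 1)"
    by (auto simp: eigvec_def)
  show "eigvec (x + y)" unfolding eigvec_def
  proof (intro conjI ballI)
    fix k assume k: "k \<in> {1..a}"
    show "(x + y) $ (k - 1) = z * (x + y) $ (w k - 1)"
      using xk(1) yk(1) xk(2)[OF k] yk(2)[OF k] wk[OF k] by (simp add: algebra_simps)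
  qed (use xk yk in simp)
qed

text \<open>Along a cycle each coordinate is the previous one divided by z, so coordinates vanish on
  cycles of length not divisible by q and are fixed by one free value on the others.\<close>

lemma eigvec_determined: "\<exists>!x. eigvec x \<and> (\<forall>t\<in>cycle_reps w {1..a} q. x $ (t - 1) = g t)"
proof -
  let ?T = "cycle_reps w {1..a} q" and ?\<sigma> = "\<lambda>v. inverse z * v"
  have pow: "(?\<sigma> ^^ n) v = inverse z ^ n * v" for n v by (induction n) auto
  have inv_ord: "inverse z ^ l = 1 \<longleftrightarrow> q dvd l" for l
    using z_ord[of l] by (simp add: power_inverse inverse_eq_1_iff)
  have bij: "bij_betw (\<lambda>y. restrict y ?T)
      {y \<in> {1..a} \<rightarrow>\<^sub>E (UNIV :: complex set). \<forall>k\<in>{1..a}. y (w k) = ?\<sigma> (y k)} (?T \<rightarrow>\<^sub>E UNIV)"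
  proof (rule bij_betw_equivariant_restrict[where z = 0])
    fix v :: complex
    show "(?\<sigma> ^^ q) v = v" using inv_ord[of q] by (simp add: pow)
    fix l assume "(?\<sigma> ^^ l) v = v"
    then show "v = 0 \<or> q dvd l" using inv_ord[of l] by (simp add: pow)
  qed (use w in auto)
  define E where "E = {y \<in> {1..a} \<rightarrow>\<^sub>E (UNIV :: complex set). \<forall>k\<in>{1..a}. y (w k) = ?\<sigma> (y k)}"
  define fn where "fn x = (\<lambda>k\<in>{1..a}. x $ (k - 1))" for x :: "complex vec"
  have E_iff: "fn x \<in> E \<longleftrightarrow> eigvec x" if x: "x \<in> carrier_vec a" for x
  proof -
    have "fn x (w k) = ?\<sigma> (fn x k) \<longleftrightarrow> x $ (k - 1) = z * x $ (w k - 1)" if "k \<in> {1..a}" for k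
    proof -
      have "w k \<in> {1..a}" using permutes_in_image[OF w] that by simp
      then show ?thesis using that z_nonzero by (auto simp: fn_def field_simps)
    qed
    moreover have "fn x \<in> {1..a} \<rightarrow>\<^sub>E UNIV" by (simp add: fn_def)
    ultimately show ?thesis using x unfolding E_def eigvec_def by blast
  qed
  have fn_inj: "x = y" if "x \<in> carrier_vec a" "y \<in> carrier_vec a" "fn x = fn y" for x y
  proof (rule eq_vecI)
    fix i assume "i < dim_vec y"
    then have "i + 1 \<in> {1..a}" using that by simp
    then show "x $ i = y $ i" using fun_cong[OF that(3), of "i + 1"] by (simp add: fn_def)
  qed (use that in simp)
  have restr: "restrict (fn x) ?T = restrict g ?T \<longleftrightarrow> (\<forall>t\<in>?T. x $ (t - 1) = g t)" for x
  proof -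
    have "?T \<subseteq> {1..a}" by (auto simp: cycle_reps_def)
    then have "restrict (fn x) ?T = (\<lambda>t\<in>?T. x $ (t - 1))" by (intro restrict_ext) (auto simp: fn_def)
    then show ?thesis by (auto simp: fun_eq_iff restrict_def split: if_splits)
  qed
  have bij': "bij_betw (\<lambda>y. restrict y ?T) E (?T \<rightarrow>\<^sub>E UNIV)" using bij by (simp only: E_def)
  have "restrict g ?T \<in> ?T \<rightarrow>\<^sub>E UNIV" by simp
  then obtain y where y: "y \<in> E" "restrict y ?T = restrict g ?T"
    using bij_betw_imp_surj_on[OF bij'] by (metis (no_types, lifting) imageE)
  define x where "x = vec a (\<lambda>i. y (i + 1))"
  have xc: "x \<in> carrier_vec a" by (simp add: x_def)
  have fx: "fn x = y"
  proof (rule extensionalityI[of _ "{1..a}"])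
    show "fn x \<in> extensional {1..a}" by (simp add: fn_def)
    show "y \<in> extensional {1..a}" using y(1) by (simp add: E_def PiE_def)
    fix k assume "k \<in> {1..a}"
    then show "fn x k = y k" by (simp add: fn_def x_def less_eq_Suc_le)
  qed
  show ?thesis
  proof (rule ex1I[of _ x])
    show "eigvec x \<and> (\<forall>t\<in>?T. x $ (t - 1) = g t)" using E_iff[OF xc] restr[of x] fx y by simp
    fix x' assume x': "eigvec x' \<and> (\<forall>t\<in>?T. x' $ (t - 1) = g t)"
    then have "fn x' \<in> E" "restrict (fn x') ?T = restrict y ?T"
      using E_iff[of x'] eigvec_carrier restr[of x'] y(2) by auto
    then have "fn x' = y" using inj_onD[OF bij_betw_imp_inj_on[OF bij'], of "fn x'" y] y(1) by simp
    then show "x' = x" using fn_inj[of x' x] fx xc x' eigvec_carrier by simp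
  qed
qed

lemma coset_eigenspace_iff:
  assumes x: "x \<in> carrier_vec a"
  shows "diag_coset a x \<in> refl_eigenspace a w z \<longleftrightarrow>
    (\<exists>c. \<forall>k\<in>{1..a}. x $ (k - 1) = z * x $ (w k - 1) + c)"
proof -
  have P: "perm_mat a w *\<^sub>v x \<in> carrier_vec a" 
    by (rule mult_mat_vec_carrier[OF _ x]) (simp add: perm_mat_def)
  have zx: "z \<cdot>\<^sub>v x \<in> carrier_vec a" using x by simp
  have "diag_coset a x \<in> carrier (refl_rep a)" unfolding refl_rep_carrier using x by blast
  then have "diag_coset a x \<in> refl_eigenspace a w z \<longleftrightarrow>
      diag_coset a (perm_mat a w *\<^sub>v x) = diag_coset a (z \<cdot>\<^sub>v x)"
    unfolding refl_eigenspace_def mem_Collect_eq refl_act_coset[OF w x] refl_rep_smult[OF x] by simp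
  also have "\<dots> \<longleftrightarrow> (\<exists>c. perm_mat a w *\<^sub>v x = z \<cdot>\<^sub>v x + c \<cdot>\<^sub>v vec a (\<lambda>_. 1))"
    by (rule diag_coset_eq_iff[OF P zx])
  also have "\<dots> \<longleftrightarrow> (\<exists>c. \<forall>k\<in>{1..a}. x $ (k - 1) = z * x $ (w k - 1) + c)"
    unfolding eigenvector_iff[OF x] ..
  finally show ?thesis .
qed

text \<open>An eigencoset satisfies the eigenvector equation up to a constant c, which is absorbed
  by adding s times the all-ones vector with s = z * s - c. For z \<noteq> 1 this is solved by c /
  (z - 1); for z = 1 going around a cycle gives n * c = 0, so c = 0.\<close>

lemma refl_eigenspace_eq: "refl_eigenspace a w z = (\<lambda>x. diag_coset a x) ` {x. eigvec x}"
proof (intro subset_antisym subsetI)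
  have one_index: "k - 1 < a" "w k - 1 < a" if "k \<in> {1..a}" for k
    using that permutes_in_image[OF w, of k] by auto
  fix X assume X: "X \<in> refl_eigenspace a w z"
  then have "X \<in> carrier (refl_rep a)" by (simp add: refl_eigenspace_def)
  then obtain x where x: "x \<in> carrier_vec a" "X = diag_coset a x" unfolding refl_rep_carrier by blast
  then obtain c where c: "\<forall>k\<in>{1..a}. x $ (k - 1) = z * x $ (w k - 1) + c"
    using X coset_eigenspace_iff by blast
  obtain s where s: "s = z * s - c"
  proof (cases "z = 1")
    case True
    have iter: "x $ (1 - 1) = x $ ((w ^^ n) 1 - 1) + of_nat n * c" for n
    proof (induction n)
      case (Suc n)
      have "(w ^^ n) 1 \<in> {1..a}" using permutes_funpow_in[OF w, of 1 n] a_pos by simp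
      then have "x $ ((w ^^ n) 1 - 1) = x $ (w ((w ^^ n) 1) - 1) + c" using c True by simp
      then show ?case using Suc by (simp add: algebra_simps)
    qed simp
    obtain n where n: "0 < n" "(w ^^ n) 1 = 1"
      using permutes_funpow_cycle[of "{1..a}" w 1] w a_pos by auto
    then have "c = 0" using iter[of n] by simp
    then show thesis using that[of 0] by simp
  next
    case False
    have "c / (z - 1) = z * (c / (z - 1)) - c" using False by (simp add: field_simps)
    then show thesis by (rule that)
  qed
  define x' where "x' = x + s \<cdot>\<^sub>v vec a (\<lambda>_. 1)"
  have x'c: "x' \<in> carrier_vec a" using x by (simp add: x'_def)
  have "eigvec x'" unfolding eigvec_def
  proof (intro conjI ballI x'c)
    fix k assume k: "k \<in> {1..a}"
    have "x' $ (k - 1) = x $ (k - 1) + s" "x' $ (w k - 1) = x $ (w k - 1) + s"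
      using x one_index[OF k] by (auto simp: x'_def)
    then show "x' $ (k - 1) = z * x' $ (w k - 1)" using bspec[OF c k] s by (simp add: algebra_simps)
  qed
  moreover have "X = diag_coset a x'"
    unfolding x(2) using diag_coset_eq_iff[OF x'c x(1)] x'_def by blast
  ultimately show "X \<in> (\<lambda>x. diag_coset a x) ` {x. eigvec x}" by blast
next
  fix X assume "X \<in> (\<lambda>x. diag_coset a x) ` {x. eigvec x}"
  then obtain x where x: "eigvec x" "X = diag_coset a x" by blast
  have "\<forall>k\<in>{1..a}. x $ (k - 1) = z * x $ (w k - 1) + 0" using x(1) by (simp add: eigvec_def)
  then show "X \<in> refl_eigenspace a w z"
    unfolding x(2) using coset_eigenspace_iff[OF eigvec_carrier[OF x(1)]] by blast
qed

lemma vectorspace_eigenspace: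
  "vectorspace class_ring ((refl_rep a)\<lparr>carrier := refl_eigenspace a w z\<rparr>)"
proof (rule vectorspace.subspace_is_vs[OF vectorspace_refl_rep])
  have mod: "module class_ring (refl_rep a)" using vectorspace_refl_rep by (simp add: vectorspace_def)
  have zero: "eigvec (0\<^sub>v a)" unfolding eigvec_def
  proof (intro conjI ballI)
    fix k assume k: "k \<in> {1..a}"
    then have "k - 1 < a" "w k - 1 < a" using permutes_in_image[OF w, of k] by auto
    then show "0\<^sub>v a $ (k - 1) = z * 0\<^sub>v a $ (w k - 1)" by simp
  qed simp
  show "subspace class_ring (refl_eigenspace a w z) (refl_rep a)"
  proof (intro subspace.intro vectorspace_refl_rep submodule.intro mod)
    show "refl_eigenspace a w z \<subseteq> carrier (refl_rep a)" by (auto simp: refl_eigenspace_def)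
    show "\<zero>\<^bsub>refl_rep a\<^esub> \<in> refl_eigenspace a w z"
      unfolding refl_rep_zero refl_eigenspace_eq using zero by blast
    fix X Y assume "X \<in> refl_eigenspace a w z" "Y \<in> refl_eigenspace a w z"
    then obtain x y where "eigvec x" "X = diag_coset a x" "eigvec y" "Y = diag_coset a y"
      unfolding refl_eigenspace_eq by blast
    then show "X \<oplus>\<^bsub>refl_rep a\<^esub> Y \<in> refl_eigenspace a w z"
      using refl_rep_add[OF eigvec_carrier eigvec_carrier] eigvec_add unfolding refl_eigenspace_eq by blast
  next
    fix r X assume "X \<in> refl_eigenspace a w z"
    then obtain x where "eigvec x" "X = diag_coset a x" unfolding refl_eigenspace_eq by blast
    then show "r \<odot>\<^bsub>refl_rep a\<^esub> X \<in> refl_eigenspace a w z"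
      using refl_rep_smult[OF eigvec_carrier] eigvec_smult unfolding refl_eigenspace_eq by blast
  qed
qed

lemma one_in_cycle_reps: "z = 1 \<Longrightarrow> 1 \<in> cycle_reps w {1..a} q"
proof -
  assume "z = 1"
  then have "q dvd 1" using z_ord[of 1] by simp
  moreover have "1 \<le> (w ^^ n) 1" for n using permutes_funpow_in[OF w, of 1 n] a_pos by simp
  ultimately show ?thesis using a_pos by (auto simp: cycle_reps_def)
qed

text \<open>Eigenvectors are parametrised by their values at the representatives. For z \<noteq> 1
  the all-ones line meets the eigenspace only in 0, so nothing is lost in the quotient; for z = 1 it
  lies inside, and the coordinate of the representative 1 is normalised to 0.\<close>

lemma refl_mult_eq: "refl_mult a w z = card (cycle_reps w {1..a} q) - (if z = 1 then 1 else 0)"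
proof -
  let ?T = "cycle_reps w {1..a} q" and ?one = "vec a (\<lambda>_. 1) :: complex vec"
  let ?W = "(refl_rep a)\<lparr>carrier := refl_eigenspace a w z\<rparr>"
  define T' where "T' = ?T - (if z = 1 then {1} else {})"
  define n where "n = card T'"
  have T: "?T \<subseteq> {1..a}" by (auto simp: cycle_reps_def)
  have finT: "finite T'" using finite_subset[OF T] by (simp add: T'_def)
  have n_eq: "n = card ?T - (if z = 1 then 1 else 0)"
    using one_in_cycle_reps by (simp add: n_def T'_def)
  obtain idx where idx: "bij_betw idx T' {0..<n}"
    using ex_bij_betw_finite_nat[OF finT] by (auto simp: n_def)
  define g where "g u t = (if t \<in> T' then u $ idx t else 0)" for u :: "complex vec" and t
  define ev where "ev u = (THE x. eigvec x \<and> (\<forall>t\<in>?T. x $ (t - 1) = g u t))" for u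
  have ev: "eigvec (ev u)" "\<And>t. t \<in> ?T \<Longrightarrow> ev u $ (t - 1) = g u t" for u
    using theI'[OF eigvec_determined[of "g u"]] by (auto simp: ev_def)
  have ev_eqI: "x = ev u" if "eigvec x" "\<And>t. t \<in> ?T \<Longrightarrow> x $ (t - 1) = g u t" for x u
    using eigvec_determined[of "g u"] that ev by blast
  have ev_c: "ev u \<in> carrier_vec a" for u by (rule eigvec_carrier[OF ev(1)])
  have ind: "t - 1 < a" if "t \<in> ?T" for t
  proof -
    have "t \<in> {1..a}" using that T by blast
    then show ?thesis by auto
  qed
  have idx_less: "idx t < n" if "t \<in> T'" for t using bij_betwE[OF idx] that by auto
  have ev_add: "ev (u + v) = ev u + ev v" if "u \<in> carrier_vec n" "v \<in> carrier_vec n" for u v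
  proof (rule ev_eqI[symmetric])
    show "eigvec (ev u + ev v)" by (rule eigvec_add[OF ev(1) ev(1)])
    fix t assume t: "t \<in> ?T"
    then show "(ev u + ev v) $ (t - 1) = g (u + v) t"
      using ev(2)[OF t] ind[OF t] ev_c that idx_less by (simp add: g_def carrier_vecD[OF ev_c])
  qed
  have ev_smult: "ev (r \<cdot>\<^sub>v u) = r \<cdot>\<^sub>v ev u" if "u \<in> carrier_vec n" for r u
  proof (rule ev_eqI[symmetric])
    show "eigvec (r \<cdot>\<^sub>v ev u)" by (rule eigvec_smult[OF ev(1)])
    fix t assume t: "t \<in> ?T"
    then show "(r \<cdot>\<^sub>v ev u) $ (t - 1) = g (r \<cdot>\<^sub>v u) t"
      using ev(2)[OF t] ind[OF t] that idx_less by (simp add: g_def carrier_vecD[OF ev_c])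
  qed
  define L where "L u = diag_coset a (ev u)" for u
  interpret W: vectorspace class_ring ?W by (rule vectorspace_eigenspace)
  interpret V: vec_space "TYPE(complex)" n .
  have "L \<in> module_hom class_ring (module_vec TYPE(complex) n) ?W"
    unfolding module_hom_def mem_Collect_eq
  proof (intro conjI allI impI funcsetI)
    fix u show "L u \<in> carrier ?W" unfolding L_def using ev(1) refl_eigenspace_eq by auto
  next
    fix u v assume "u \<in> carrier (module_vec TYPE(complex) n) \<and> v \<in> carrier (module_vec TYPE(complex) n)"
    then have uv: "u \<in> carrier_vec n" "v \<in> carrier_vec n" by (auto simp: module_vec_simps)
    show "L (u \<oplus>\<^bsub>module_vec TYPE(complex) n\<^esub> v) = L u \<oplus>\<^bsub>?W\<^esub> L v"
      using refl_rep_add[OF ev_c ev_c] ev_add[OF uv] by (simp add: L_def module_vec_simps)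
  next
    fix r :: complex and u assume "r \<in> carrier class_ring \<and> u \<in> carrier (module_vec TYPE(complex) n)"
    then have u: "u \<in> carrier_vec n" by (simp add: module_vec_simps)
    show "L (r \<odot>\<^bsub>module_vec TYPE(complex) n\<^esub> u) = r \<odot>\<^bsub>?W\<^esub> L u"
      using refl_rep_smult[OF ev_c] ev_smult[OF u] by (simp add: L_def module_vec_simps)
  qed
  then interpret lin: linear_map class_ring "module_vec TYPE(complex) n" ?W L
    by (intro linear_map.intro mod_hom.intro mod_hom_axioms.intro vec_vs vectorspace_eigenspace
        V.module_axioms W.module_axioms)
  have inj: "inj_on L (carrier (module_vec TYPE(complex) n))"
  proof (rule inj_onI)
    fix u v assume "u \<in> carrier (module_vec TYPE(complex) n)" "v \<in> carrier (module_vec TYPE(complex) n)"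
      and eq: "L u = L v"
    then have uv: "u \<in> carrier_vec n" "v \<in> carrier_vec n" by (auto simp: module_vec_simps)
    obtain c where c: "ev u = ev v + c \<cdot>\<^sub>v ?one"
      using eq diag_coset_eq_iff[OF ev_c ev_c] unfolding L_def by blast
    have shift: "ev u $ i = ev v $ i + c" if "i < a" for i
      unfolding c using that by (simp add: carrier_vecD[OF ev_c])
    have "c = 0"
    proof (cases "z = 1")
      case True
      then have one: "1 \<in> ?T" "1 \<notin> T'" using one_in_cycle_reps by (auto simp: T'_def)
      then have "ev u $ (1 - 1) = 0" "ev v $ (1 - 1) = 0" using ev(2)[OF one(1)] by (auto simp: g_def)
      then show ?thesis using shift[of 0] a_pos by simp
    next
      case False
      have k: "1 \<in> {1..a}" "w 1 - 1 < a" using a_pos permutes_in_image[OF w, of 1] by auto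
      have "ev u $ (1 - 1) = z * ev u $ (w 1 - 1)" "ev v $ (1 - 1) = z * ev v $ (w 1 - 1)"
        using ev(1) k(1) unfolding eigvec_def by blast+
      then have "c = z * c" using shift[of 0] shift[OF k(2)] a_pos by (simp add: algebra_simps)
      then show ?thesis using False by simp
    qed
    show "u = v"
    proof (rule eq_vecI)
      fix i assume "i < dim_vec v"
      then have "i \<in> idx ` T'" unfolding bij_betw_imp_surj_on[OF idx] using uv by simp
      then obtain t where t: "t \<in> T'" "idx t = i" by blast
      then have tT: "t \<in> ?T" by (simp add: T'_def)
      have "g u t = g v t"
        using ev(2)[OF tT, of u] ev(2)[OF tT, of v] shift[OF ind[OF tT]] \<open>c = 0\<close> by simp
      then show "u $ i = v $ i" using t by (simp add: g_def)
    qed (use uv in simp)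
  qed
  have surj: "L ` carrier (module_vec TYPE(complex) n) = carrier ?W"
  proof (intro subset_antisym subsetI)
    fix X assume "X \<in> carrier ?W"
    then obtain x where x: "eigvec x" "X = diag_coset a x" using refl_eigenspace_eq by auto
    \<comment> \<open>For z = 1 this makes the coordinate of the representative 1 vanish; the
      all-ones vector is then itself an eigenvector, so adding a multiple of it is harmless.\<close>
    define s where "s = (if z = 1 then - x $ 0 else 0)"
    define x' where "x' = x + s \<cdot>\<^sub>v ?one"
    have xc: "x \<in> carrier_vec a" by (rule eigvec_carrier[OF x(1)])
    have x'c: "x' \<in> carrier_vec a" using xc by (simp add: x'_def)
    have x'i: "x' $ i = x $ i + s" if "i < a" for i using that xc by (simp add: x'_def)
    have ex': "eigvec x'" unfolding eigvec_def
    proof (intro conjI ballI x'c)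
      fix k assume k: "k \<in> {1..a}"
      then have "k - 1 < a" "w k - 1 < a" using permutes_in_image[OF w, of k] by auto
      moreover have "x $ (k - 1) = z * x $ (w k - 1)" using x(1) k unfolding eigvec_def by blast
      ultimately show "x' $ (k - 1) = z * x' $ (w k - 1)"
        using x'i by (simp add: s_def algebra_simps)
    qed
    define u where "u = vec n (\<lambda>i. x' $ (inv_into T' idx i - 1))"
    have "x' = ev u"
    proof (rule ev_eqI[OF ex'])
      fix t assume t: "t \<in> ?T"
      show "x' $ (t - 1) = g u t"
      proof (cases "t \<in> T'")
        case True
        then have "inv_into T' idx (idx t) = t" using idx by (simp add: bij_betw_def inv_into_f_f)
        then show ?thesis using True idx_less[OF True] by (simp add: g_def u_def)
      next
        case False
        then have "z = 1" "t = 1" using t by (auto simp: T'_def split: if_splits)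
        then show ?thesis using x'i[of 0] a_pos False by (simp add: g_def s_def)
      qed
    qed
    moreover have "diag_coset a x' = diag_coset a x" using diag_coset_eq_iff[OF x'c xc] x'_def by blast
    ultimately have "X = L u" unfolding L_def x(2) by (simp only:)
    moreover have "u \<in> carrier (module_vec TYPE(complex) n)" by (simp add: u_def module_vec_simps)
    ultimately show "X \<in> L ` carrier (module_vec TYPE(complex) n)" by blast
  next
    fix X assume "X \<in> L ` carrier (module_vec TYPE(complex) n)"
    then show "X \<in> carrier ?W" using ev(1) refl_eigenspace_eq by (auto simp: L_def)
  qed
  have "vectorspace.dim class_ring (module_vec TYPE(complex) n) = vectorspace.dim class_ring ?W"
    by (rule lin.dim_eq[OF _ inj surj]) simp
  then show ?thesis unfolding refl_mult_def n_eq[symmetric] using V.dim_is_n by simp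
qed

end

theorem theorem6p3:
  fixes a b d :: nat and w :: "nat \<Rightarrow> nat"
  assumes "0 < a" and "a < b" and "coprime a b" and "w permutes {1..a}"
  shows "park_char a b w d =
    b ^ refl_mult a w (exp (2 * complex_of_real pi * \<i> / of_nat (b - 1)) ^ d)"
proof -
  interpret rational_slope a b "b - 1"
    by unfold_locales (use assms in auto)
  define N where "N = b - 1"
  define z where "z = exp (2 * complex_of_real pi * \<i> / of_nat N) ^ d"
  \<comment> \<open>This is both the order of z and the orbit length of nonzero values under
    \<open>shift d\<close>; the coincidence links the two counts.\<close>
  define q where "q = N div gcd d N"
  have N: "0 < N" using N_pos by (simp add: N_def)
  have dvd: "N dvd d * l \<longleftrightarrow> q dvd l" for l unfolding q_def by (rule dvd_mult_iff_div_gcd[OF N])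
  have z_pow: "z ^ l = 1 \<longleftrightarrow> q dvd l" for l
  proof -
    have "z ^ l = exp (2 * complex_of_real pi * \<i> / of_nat N) ^ (d * l)" by (simp add: z_def power_mult)
    also have "\<dots> = exp (2 * of_real pi * \<i> * of_nat (d * l) / of_nat N)"
      by (simp only: exp_of_nat_mult[symmetric]) (simp add: mult_ac)
    finally have "z ^ l = 1 \<longleftrightarrow> N dvd d * l"
      using complex_root_unity_eq_1[of N "d * l"] N by simp
    then show ?thesis by (simp only: dvd)
  qed
  have q_pos: "0 < q" using N by (simp add: q_def div_greater_zero_iff gcd_le2_nat)
  have mult: "refl_mult a w z = card (cycle_reps w {1..a} q) - (if z = 1 then 1 else 0)"
    by (rule refl_mult_eq[OF assms(1,4) z_pow q_pos])
  have char: "park_char a b w d = card {x \<in> parking. (rho ^^ d) x = x \<circ> w}"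
    by (rule park_char_eq[OF NC_eq_blocks assms(4)])
  have "park_char a b w d = b ^ refl_mult a w z"
  proof (cases "N dvd d")
    case False
    then have "z \<noteq> 1" using z_pow[of 1] dvd[of 1] by simp
    have "card {y \<in> {1..a} \<rightarrow>\<^sub>E {0..N}. y \<circ> w = tau d y} = park_char a b w d"
      unfolding char N_def
      by (rule bij_betw_same_card[OF bij_betw_cut[OF assms(4) _ refl]]) (use False in \<open>simp add: N_def\<close>)
    then show ?thesis
      using card_equivariant[OF assms(4), of d] mult \<open>z \<noteq> 1\<close> by (simp add: q_def N_def)
  next
    case True
    then have "z = 1" "q = 1" using z_pow[of 1] dvd[of 1] by auto
    have "(rho ^^ d) x = x" if "x \<in> parking" for x
      using funpow_mod_eq[OF funpow_rho_N[OF that], of d] True by (simp add: N_def)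
    then have "{x \<in> parking. (rho ^^ d) x = x \<circ> w} = {x \<in> parking. x \<circ> w = x}" by auto
    \<comment> \<open>As q = 1, every cycle of w counts; the factor b on the left corresponds to the
      dimension lost to the constant vector.\<close>
    then have "b * park_char a b w d = b ^ card (cycle_reps w {1..a} 1)"
      using card_fixed_parking[OF assms(4)] char by simp
    \<comment> \<open>Since 1 is a representative, the truncated subtraction in \<open>mult\<close>
      is a genuine one.\<close>
    moreover have "card (cycle_reps w {1..a} 1) = Suc (refl_mult a w z)"
    proof -
      have "1 \<in> cycle_reps w {1..a} q"
        by (rule one_in_cycle_reps[OF assms(1,4) z_pow q_pos \<open>z = 1\<close>])
      moreover have "finite (cycle_reps w {1..a} q)" by (simp add: cycle_reps_def)
      ultimately have "0 < card (cycle_reps w {1..a} q)" by (auto simp: card_gt_0_iff)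
      then show ?thesis using mult \<open>z = 1\<close> \<open>q = 1\<close> by simp
    qed
    ultimately show ?thesis using assms(2) by simp
  qed
  then show ?thesis by (simp only: z_def N_def)
qed

end
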